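(* Every essentially convex potential $W$ on $\mathbb{R}^d$ is strictly positive definite (SPD): for any nontrivial signed measure $\mu$ on $\mathbb{R}^d$ such that $E_W[\mu]$ is well-defined (as a number in $[-\infty,\infty]$), one has $E_W[\mu]>0$.
   Context: (W0): $W:\mathbb{R}^d\to\mathbb{R}\cup\{\infty\}$ is locally integrable, bounded from below and lower-semicontinuous, with $W(\mathbf{x})=W(-\mathbf{x})$. (W1): $W$ is continuous on $\mathbb{R}^d\setminus\{0\}$, $W(0)=\lim_{\mathbf{x}\to 0}W(\mathbf{x})\in\mathbb{R}\cup\{\infty\}$, and for any $R>0$ there are constants $C_1(R),C_2(R)$ with $\frac{1}{|B(\mathbf{x};\epsilon)|}\int_{B(\mathbf{x};\epsilon)}W(\mathbf{y})\,d\mathbf{y}\le C_1(R)+C_2(R)W(\mathbf{x})$ for all $|\mathbf{x}|<R$, $0<\epsilon<1$. Essentially convex: $W\in C^2(\mathbb{R}^d\setminus\{0\})$ satisfying (W0), (W1) is essentially convex if $\Delta W>0$ on $\mathbb{R}^d\setminus\{0\}$ and, for some $-d<b<\min\{2-d,0\}$ and $-d<a<\min\{2-d,0\}$, $|W|\lesssim|\mathbf{x}|^{b}$, $|\nabla W|\lesssim|\mathbf{x}|^{b-1}$, $|\Delta W|\lesssim|\mathbf{x}|^{b-2}$ for $0<|\mathbf{x}|<1$, and $|W|\lesssim|\mathbf{x}|^{a}$, $|\nabla W|\lesssim|\mathbf{x}|^{a-1}$, $|\Delta W|\lesssim|\mathbf{x}|^{a-2}$ for $|\mathbf{x}|\ge1$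 (where $\lesssim$ means $\le$ up to a multiplicative constant). Signed measures are finite signed Borel measures. For a signed measure $\mu=\mu_+-\mu_-$ (Jordan decomposition), $E_W[\mu]=\frac12\int\int W(\mathbf{x}-\mathbf{y})\,d\mu(\mathbf{y})\,d\mu(\mathbf{x})=E_W[\mu_+]+E_W[\mu_-]-\int\int W(\mathbf{x}-\mathbf{y})\,d\mu_+(\mathbf{x})\,d\mu_-(\mathbf{y})$; it is well-defined if this is not of the form $\infty-\infty$ (each of the three terms lies in $(-\infty,\infty]$ since $W$ is bounded below). *)

theory Defs
  imports "HOL-Analysis.Analysis"
begin

section \<open>Integrals of extended-real functions\<close>

text \<open>Meaningful whenever one of the two terms is finite; this is always so below, since the
  integrands are bounded from below and the measures are finite.\<close>

definition ereal_integral :: "'a measure \<Rightarrow> ('a \<Rightarrow> ereal) \<Rightarrow> ereal" where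
  "ereal_integral M f =
     enn2ereal (\<integral>\<^sup>+x. e2ennreal (max 0 (f x)) \<partial>M) - enn2ereal (\<integral>\<^sup>+x. e2ennreal (max 0 (- f x)) \<partial>M)"

definition locally_integrable :: "('a::euclidean_space \<Rightarrow> ereal) \<Rightarrow> bool" where
  "locally_integrable f \<longleftrightarrow> f \<in> borel_measurable borel \<and>
     (\<forall>K. compact K \<longrightarrow> (\<integral>\<^sup>+x\<in>K. e2ennreal \<bar>f x\<bar> \<partial>lborel) < \<infinity>)"

definition ball_average :: "('a::euclidean_space \<Rightarrow> ereal) \<Rightarrow> 'a \<Rightarrow> real \<Rightarrow> ereal" where
  "ball_average f x \<epsilon> =
     ereal (1 / measure lborel (ball x \<epsilon>)) * ereal_integral (restrict_space lborel (ball x \<epsilon>)) f"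


section \<open>Assumptions on the potential\<close>

definition lower_semicontinuous :: "('a::topological_space \<Rightarrow> ereal) \<Rightarrow> bool" where
  "lower_semicontinuous f \<longleftrightarrow> (\<forall>x. f x \<le> Liminf (at x) f)"

text \<open>The lower bound also excludes the value \<open>-\<infinity>\<close>, so that potentials take values in
  \<open>\<real> \<union> {\<infinity>}\<close>.\<close>

definition W0 :: "('a::euclidean_space \<Rightarrow> ereal) \<Rightarrow> bool" where
  "W0 W \<longleftrightarrow> locally_integrable W \<and> (\<exists>c::real. \<forall>x. ereal c \<le> W x) \<and>
     lower_semicontinuous W \<and> (\<forall>x. W x = W (- x))"

definition W1 :: "('a::euclidean_space \<Rightarrow> ereal) \<Rightarrow> bool" where
  "W1 W \<longleftrightarrow> continuous_on (- {0}) W \<and> (W \<longlongrightarrow> W 0) (at 0) \<and>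
     (\<forall>R>0. \<exists>C1 C2 :: real. \<forall>x \<epsilon>. norm x < R \<and> 0 < \<epsilon> \<and> \<epsilon> < 1 \<longrightarrow>
        ball_average W x \<epsilon> \<le> ereal C1 + ereal C2 * W x)"


section \<open>Gradient, Laplacian and essentially convex potentials\<close>

definition gradient :: "('a::euclidean_space \<Rightarrow> real) \<Rightarrow> 'a \<Rightarrow> 'a" where
  "gradient f x = (THE D. GDERIV f x :> D)"

definition laplacian :: "('a::euclidean_space \<Rightarrow> real) \<Rightarrow> 'a \<Rightarrow> real" where
  "laplacian f x = (\<Sum>e\<in>Basis. frechet_derivative (gradient f) (at x) e \<bullet> e)"

text \<open>Twice continuously differentiable on an open set, with gradient field \<open>G\<close> and Hessian \<open>H\<close>.\<close>

definition C2_on :: "'a::euclidean_space set \<Rightarrow> ('a \<Rightarrow> real) \<Rightarrow> bool" where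
  "C2_on S f \<longleftrightarrow> (\<exists>(G :: 'a \<Rightarrow> 'a) (H :: 'a \<Rightarrow> 'a \<Rightarrow>\<^sub>L 'a).
     (\<forall>x\<in>S. GDERIV f x :> G x) \<and>
     (\<forall>x\<in>S. (G has_derivative blinfun_apply (H x)) (at x)) \<and>
     continuous_on S H)"

definition bounded_up_to_const :: "'a set \<Rightarrow> ('a \<Rightarrow> real) \<Rightarrow> ('a \<Rightarrow> real) \<Rightarrow> bool" where
  "bounded_up_to_const S f g \<longleftrightarrow> (\<exists>C>0. \<forall>x\<in>S. f x \<le> C * g x)"

definition power_growth :: "'a::euclidean_space set \<Rightarrow> ('a \<Rightarrow> real) \<Rightarrow> real \<Rightarrow> bool" where
  "power_growth S f s \<longleftrightarrow>
     bounded_up_to_const S (\<lambda>x. \<bar>f x\<bar>) (\<lambda>x. norm x powr s) \<and>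
     bounded_up_to_const S (\<lambda>x. norm (gradient f x)) (\<lambda>x. norm x powr (s - 1)) \<and>
     bounded_up_to_const S (\<lambda>x. \<bar>laplacian f x\<bar>) (\<lambda>x. norm x powr (s - 2))"

text \<open>Being of class \<open>C\<^sup>2\<close> away from the origin includes finiteness there; only \<open>W 0\<close> may be
  \<open>\<infinity>\<close>. The function \<open>w\<close> is the real-valued version of \<open>W\<close> (its value at \<open>0\<close> is irrelevant).\<close>

definition essentially_convex :: "('a::euclidean_space \<Rightarrow> ereal) \<Rightarrow> bool" where
  "essentially_convex W \<longleftrightarrow>
     W0 W \<and> W1 W \<and> (\<forall>x. x \<noteq> 0 \<longrightarrow> \<bar>W x\<bar> \<noteq> \<infinity>) \<and>
     (let w = (\<lambda>x. real_of_ereal (W x)); d = real DIM('a) in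
        C2_on (- {0}) w \<and>
        (\<forall>x. x \<noteq> 0 \<longrightarrow> laplacian w x > 0) \<and>
        (\<exists>b. - d < b \<and> b < min (2 - d) 0 \<and> power_growth {x. 0 < norm x \<and> norm x < 1} w b) \<and>
        (\<exists>a. - d < a \<and> a < min (2 - d) 0 \<and> power_growth {x. 1 \<le> norm x} w a))"


section \<open>Finite signed Borel measures and the interaction energy\<close>

text \<open>A finite signed Borel measure is a countably additive real-valued set function on the Borel
  sets; its values on other sets are irrelevant.\<close>

definition signed_borel_measure :: "('a::topological_space set \<Rightarrow> real) \<Rightarrow> bool" where
  "signed_borel_measure \<mu> \<longleftrightarrow>
     (\<forall>A :: nat \<Rightarrow> 'a set. range A \<subseteq> sets borel \<longrightarrow> disjoint_family A \<longrightarrow>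
        (\<lambda>i. \<mu> (A i)) sums \<mu> (\<Union>i. A i))"

definition nontrivial_measure :: "('a::topological_space set \<Rightarrow> real) \<Rightarrow> bool" where
  "nontrivial_measure \<mu> \<longleftrightarrow> (\<exists>A\<in>sets borel. \<mu> A \<noteq> 0)"

definition jordan_decomposition ::
    "('a::topological_space set \<Rightarrow> real) \<Rightarrow> 'a measure \<Rightarrow> 'a measure \<Rightarrow> bool" where
  "jordan_decomposition \<mu> P N \<longleftrightarrow>
     sets P = sets borel \<and> sets N = sets borel \<and> finite_measure P \<and> finite_measure N \<and>
     (\<exists>S\<in>sets borel. emeasure P (- S) = 0 \<and> emeasure N S = 0) \<and>
     (\<forall>A\<in>sets borel. \<mu> A = measure P A - measure N A)"

text \<open>By the Hahn--Jordan theorem both parts exist and are unique for every signed measure.\<close>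

definition pos_part :: "('a::topological_space set \<Rightarrow> real) \<Rightarrow> 'a measure" where
  "pos_part \<mu> = (THE P. \<exists>N. jordan_decomposition \<mu> P N)"

definition neg_part :: "('a::topological_space set \<Rightarrow> real) \<Rightarrow> 'a measure" where
  "neg_part \<mu> = (THE N. \<exists>P. jordan_decomposition \<mu> P N)"

definition interaction ::
    "('a::euclidean_space \<Rightarrow> ereal) \<Rightarrow> 'a measure \<Rightarrow> 'a measure \<Rightarrow> ereal" where
  "interaction W M N = ereal_integral N (\<lambda>y. ereal_integral M (\<lambda>x. W (x - y)))"

definition self_energy :: "('a::euclidean_space \<Rightarrow> ereal) \<Rightarrow> 'a measure \<Rightarrow> ereal" where
  "self_energy W M = ereal (1 / 2) * interaction W M M"

text \<open>On \<open>ereal\<close> the difference \<open>\<infinity> - \<infinity>\<close> has the value \<open>\<infinity>\<close>, so \<open>energy\<close> is meaningful only under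
  \<open>energy_well_defined\<close>.\<close>

definition energy :: "('a::euclidean_space \<Rightarrow> ereal) \<Rightarrow> ('a set \<Rightarrow> real) \<Rightarrow> ereal" where
  "energy W \<mu> = self_energy W (pos_part \<mu>) + self_energy W (neg_part \<mu>)
     - interaction W (pos_part \<mu>) (neg_part \<mu>)"

definition energy_well_defined :: "('a::euclidean_space \<Rightarrow> ereal) \<Rightarrow> ('a set \<Rightarrow> real) \<Rightarrow> bool" where
  "energy_well_defined W \<mu> \<longleftrightarrow>
     \<not> (self_energy W (pos_part \<mu>) + self_energy W (neg_part \<mu>) = \<infinity> \<and>
        interaction W (pos_part \<mu>) (neg_part \<mu>) = \<infinity>)"

definition strictly_positive_definite :: "('a::euclidean_space \<Rightarrow> ereal) \<Rightarrow> bool" where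
  "strictly_positive_definite W \<longleftrightarrow>
     (\<forall>\<mu>. signed_borel_measure \<mu> \<and> nontrivial_measure \<mu> \<and> energy_well_defined W \<mu> \<longrightarrow>
        energy W \<mu> > 0)"

end

theory Submission
  imports Defs "HOL-Probability.Distributions" "HOL-Real_Asymp.Real_Asymp"
begin

text \<open>
  Let \<open>w\<close> be the real-valued potential, \<open>g = \<Delta>w > 0\<close> its Laplacian off the origin and \<open>p\<^sub>t\<close> the heat
  kernel. The proof follows the interaction energy of a signed measure \<open>\<mu>\<close> when \<open>w\<close> is replaced by its
  heat regularisation \<open>w\<^sub>t = p\<^sub>t * w\<close>. As \<open>w\<close> vanishes at infinity, \<open>w\<^sub>t \<rightarrow> 0\<close> as \<open>t \<rightarrow> \<infinity>\<close>, so a strictly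
  decreasing energy must have been positive.

  The energy decreases because \<open>\<Delta>w > 0\<close>. Differentiating under the integral gives
  \<open>\<partial>\<^sub>t w\<^sub>t(v) = \<integral> w(z) \<Delta>p\<^sub>t(v - z) dz\<close>, and as \<open>w\<close> is even, Green's identity turns this into
  \<open>\<integral> g(z) \<phi>\<^sub>v(z) dz\<close> with \<open>\<phi>\<^sub>v(z) = (p\<^sub>t(v - z) + p\<^sub>t(v + z)) / 2 - p\<^sub>t(v)\<close>. The subtracted constant is
  harmless for \<open>\<Delta>\<phi>\<^sub>v\<close> and makes \<open>\<phi>\<^sub>v\<close> vanish to second order at the origin. This is what the exponent
  \<open>b > -d\<close> needs for \<open>g \<phi>\<^sub>v\<close> to be integrable and for the flux through small spheres to vanish; the
  flux through large spheres vanishes because \<open>a < 2 - d\<close> (lemma \<open>green\<close>). Now put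
  \<open>A\<^sub>t(z) = \<integral>\<integral> p\<^sub>t(x - y - z) d\<mu>(x) d\<mu>(y)\<close>. By the semigroup law this is the autocorrelation
  \<open>\<integral> f(u) f(u - z) du\<close> of \<open>f = p\<^bsub>t/2\<^esub> * \<mu>\<close>, so \<open>\<bar>A\<^sub>t(z)\<bar> \<le> A\<^sub>t(0)\<close>, and the derivative of the regularised
  energy \<open>F(t) = \<integral>\<integral> w\<^sub>t(x - y) d\<mu> d\<mu>\<close> is
  \<open>- \<integral> g(z) (A\<^sub>t(0) - (A\<^sub>t(z) + A\<^sub>t(-z)) / 2) dz \<le> 0\<close> (lemma \<open>smoothed_energy_derivative\<close>).

  If the derivative vanishes at time \<open>t\<close>, then \<open>A\<^sub>t(0) = 0\<close>, because \<open>g > 0\<close> and \<open>A\<^sub>t\<close> tends to 0 at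
  infinity; hence \<open>p\<^bsub>t/2\<^esub> * \<mu> = 0\<close>. If \<open>F\<close> had a limit \<open>\<le> 0\<close> at time 0, it would vanish identically, so
  \<open>p\<^sub>t * \<mu> = 0\<close> for all \<open>t\<close> and \<open>\<mu> = 0\<close> (lemma \<open>smoothed_energy_limit_pos\<close>).

  It remains to let \<open>t \<rightarrow> 0\<close>. If a self-energy is infinite, so is the energy. Otherwise the averaging
  condition of (W1) gives \<open>p\<^sub>t * W \<le> A (1 + W)\<close> up to constants, since a Gaussian is a mixture of ball
  averages (lemma \<open>heat_average_le_ball_averages\<close>). This dominates the self-interactions; since
  \<open>F \<ge> 0\<close>, the mixed regularised interaction stays bounded as well, and Fatou's lemma makes
  the mixed interaction finite. By dominated convergence, \<open>F(t)\<close> tends to twice the energy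
  (lemma \<open>smoothed_energy_tendsto\<close>).
\<close>

section \<open>Jordan decomposition of signed Borel measures\<close>

lemma signed_borel_measure_empty:
  assumes "signed_borel_measure \<mu>" shows "\<mu> {} = 0"
proof -
  have "(\<lambda>i::nat. \<mu> {}) sums \<mu> {}"
    using assms[unfolded signed_borel_measure_def, rule_format, of "\<lambda>_. {}"]
    by (simp add: disjoint_family_on_def)
  then show ?thesis using summable_const_iff sums_summable by blast
qed

lemma signed_borel_measure_Un:
  assumes "signed_borel_measure \<mu>" "A \<in> sets borel" "B \<in> sets borel" "A \<inter> B = {}"
  shows "\<mu> (A \<union> B) = \<mu> A + \<mu> B"
proof -
  let ?D = "\<lambda>i::nat. if i = 0 then A else if i = 1 then B else {}"
  have "range ?D \<subseteq> sets borel" "disjoint_family ?D"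
    using assms by (auto simp: disjoint_family_on_def)
  then have "(\<lambda>i. \<mu> (?D i)) sums \<mu> (\<Union>i. ?D i)"
    using assms(1)[unfolded signed_borel_measure_def] by blast
  moreover have "(\<Union>i. ?D i) = A \<union> B"
    by (force split: if_splits)
  moreover have "(\<lambda>i. \<mu> (?D i)) sums (\<Sum>i\<in>{0,1}. \<mu> (?D i))"
    by (rule sums_finite) (auto simp: signed_borel_measure_empty[OF assms(1)])
  ultimately show ?thesis by (auto dest: sums_unique2)
qed

lemma signed_borel_measure_Diff:
  assumes "signed_borel_measure \<mu>" "A \<in> sets borel" "B \<in> sets borel" "B \<subseteq> A"
  shows "\<mu> (A - B) = \<mu> A - \<mu> B"
proof -
  have "\<mu> ((A - B) \<union> B) = \<mu> (A - B) + \<mu> B"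
    using assms by (intro signed_borel_measure_Un) auto
  moreover have "(A - B) \<union> B = A" using assms(4) by auto
  ultimately show ?thesis by simp
qed

lemma signed_borel_measure_incseq:
  assumes \<mu>: "signed_borel_measure \<mu>" and A: "range A \<subseteq> sets borel" "incseq A"
  shows "(\<lambda>n. \<mu> (A n)) \<longlonglongrightarrow> \<mu> (\<Union>n. A n)"
proof -
  have D: "range (disjointed A) \<subseteq> sets borel"
    using A(1) by (rule sets.range_disjointed_sets)
  have s: "(\<lambda>i. \<mu> (disjointed A i)) sums \<mu> (\<Union>n. A n)"
    using \<mu>[unfolded signed_borel_measure_def, rule_format, OF D disjoint_family_disjointed]
    by (simp add: UN_disjointed_eq)
  have "(\<Sum>i<Suc n. \<mu> (disjointed A i)) = \<mu> (A n)" for n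
  proof (induction n)
    case 0 then show ?case by (simp add: disjointed_def)
  next
    case (Suc n)
    have "disjointed A (Suc n) = A (Suc n) - A n"
      using A(2) by (intro disjointed_mono)
    moreover have "A n \<subseteq> A (Suc n)" using A(2) by (simp add: incseq_SucD)
    moreover have "A n \<in> sets borel" "A (Suc n) \<in> sets borel" using A(1) by auto
    ultimately have "\<mu> (disjointed A (Suc n)) = \<mu> (A (Suc n)) - \<mu> (A n)"
      using signed_borel_measure_Diff[OF \<mu>] by simp
    then show ?case using Suc by simp
  qed
  then show ?thesis using s[unfolded sums_def] LIMSEQ_Suc[of "\<lambda>n. \<Sum>i<n. \<mu> (disjointed A i)"]
    by simp
qed

lemma signed_borel_measure_decseq:
  assumes \<mu>: "signed_borel_measure \<mu>" and A: "range A \<subseteq> sets borel" "decseq A"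
  shows "(\<lambda>n. \<mu> (A n)) \<longlonglongrightarrow> \<mu> (\<Inter>n. A n)"
proof -
  have c: "\<mu> (- X) = \<mu> UNIV - \<mu> X" if "X \<in> sets borel" for X
    using signed_borel_measure_Diff[OF \<mu>, of UNIV X] that by (simp add: Compl_eq_Diff_UNIV)
  have i: "incseq (\<lambda>n. - A n)" using A(2) by (auto simp: incseq_def decseq_def)
  have r: "range (\<lambda>n. - A n) \<subseteq> sets borel" using A(1) by auto
  have "(\<lambda>n. \<mu> UNIV - \<mu> (- A n)) \<longlonglongrightarrow> \<mu> UNIV - \<mu> (\<Union>n. - A n)"
    by (intro tendsto_intros signed_borel_measure_incseq[OF \<mu> r i])
  moreover have "\<mu> UNIV - \<mu> (- A n) = \<mu> (A n)" for n using c[of "A n"] A(1) by auto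
  moreover have "\<mu> UNIV - \<mu> (\<Union>n. - A n) = \<mu> (\<Inter>n. A n)"
    using c[of "\<Inter>n. A n"] A(1) by (auto simp: Compl_INT)
  ultimately show ?thesis by (simp only:)
qed

text \<open>
  If \<open>\<mu>\<close> were unbounded on the subsets of \<open>X\<close>, a subset \<open>A\<close> with \<open>\<bar>\<mu> A\<bar> > \<bar>\<mu> X\<bar> + 1\<close> would split \<open>X\<close> into
  two pieces of measure larger than 1 in absolute value, and \<open>\<mu>\<close> would be unbounded on one of them.
  Splitting that piece again and again produces infinitely many disjoint sets of measure larger than 1,
  against countable additivity.
\<close>

lemma signed_borel_measure_bounded:
  assumes \<mu>: "signed_borel_measure \<mu>"
  shows "\<exists>K. \<forall>A\<in>sets borel. \<bar>\<mu> A\<bar> \<le> K"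
proof (rule ccontr)
  assume unb: "\<not> ?thesis"
  define U where "U X \<longleftrightarrow> X \<in> sets borel \<and> (\<forall>K. \<exists>A\<in>sets borel. A \<subseteq> X \<and> \<bar>\<mu> A\<bar> > K)" for X
  have step: "\<exists>Y. U Y \<and> Y \<subseteq> X \<and> \<bar>\<mu> (X - Y)\<bar> > 1" if "U X" for X
  proof -
    have X: "X \<in> sets borel" using that by (simp add: U_def)
    obtain A where A: "A \<in> sets borel" "A \<subseteq> X" "\<bar>\<mu> A\<bar> > \<bar>\<mu> X\<bar> + 1"
      using \<open>U X\<close> by (auto simp: U_def)
    have d: "\<mu> (X - A) = \<mu> X - \<mu> A" using signed_borel_measure_Diff[OF \<mu> X A(1,2)] .
    show ?thesis
    proof (cases "U A")
      case True
      then show ?thesis using A d by (intro exI[of _ A]) auto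
    next
      case False
      have "U (X - A)"
      proof (rule ccontr)
        assume "\<not> U (X - A)"
        moreover have "X - A \<in> sets borel" using X A by auto
        ultimately obtain K1 K2 where
          K: "\<And>B. B \<in> sets borel \<Longrightarrow> B \<subseteq> A \<Longrightarrow> \<bar>\<mu> B\<bar> \<le> K1"
          "\<And>B. B \<in> sets borel \<Longrightarrow> B \<subseteq> X - A \<Longrightarrow> \<bar>\<mu> B\<bar> \<le> K2"
          using False A(1) unfolding U_def by (meson not_less)
        have "\<bar>\<mu> B\<bar> \<le> K1 + K2" if "B \<in> sets borel" "B \<subseteq> X" for B
        proof -
          have "\<mu> ((B \<inter> A) \<union> (B - A)) = \<mu> (B \<inter> A) + \<mu> (B - A)"
            using that A by (intro signed_borel_measure_Un[OF \<mu>]) auto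
          moreover have "(B \<inter> A) \<union> (B - A) = B" by auto
          moreover have "\<bar>\<mu> (B \<inter> A)\<bar> \<le> K1" "\<bar>\<mu> (B - A)\<bar> \<le> K2" using that A by (auto intro!: K)
          ultimately show ?thesis by auto
        qed
        then show False using \<open>U X\<close> unfolding U_def by (meson not_less)
      qed
      moreover have "X - (X - A) = A" using A by auto
      ultimately show ?thesis using A by (intro exI[of _ "X - A"]) auto
    qed
  qed
  have "U UNIV" using unb by (auto simp: U_def not_le)
  then have "\<exists>X. \<forall>n::nat. U (X n) \<and> (X (Suc n) \<subseteq> X n \<and> \<bar>\<mu> (X n - X (Suc n))\<bar> > 1)"
    using step by (intro dependent_nat_choice) blast+
  then obtain X where X: "\<And>n::nat. U (X n)" "\<And>n. X (Suc n) \<subseteq> X n \<and> \<bar>\<mu> (X n - X (Suc n))\<bar> > 1"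
    by metis
  have dec: "decseq X" using X(2) by (auto intro: decseq_SucI)
  have "disjoint_family (\<lambda>n. X n - X (Suc n))"
    unfolding disjoint_family_on_def
  proof (intro ballI impI)
    fix m n :: nat assume "m \<noteq> n"
    then consider "Suc m \<le> n" | "Suc n \<le> m" by linarith
    then show "(X m - X (Suc m)) \<inter> (X n - X (Suc n)) = {}"
      using dec unfolding decseq_def by cases blast+
  qed
  moreover have "range (\<lambda>n. X n - X (Suc n)) \<subseteq> sets borel" using X(1) by (auto simp: U_def)
  ultimately have "(\<lambda>n. \<mu> (X n - X (Suc n))) sums \<mu> (\<Union>n. X n - X (Suc n))"
    using \<mu> unfolding signed_borel_measure_def by blast
  then have "(\<lambda>n. \<mu> (X n - X (Suc n))) \<longlonglongrightarrow> 0" using sums_summable summable_LIMSEQ_zero by blast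
  then have "\<forall>\<^sub>F n in sequentially. \<bar>\<mu> (X n - X (Suc n))\<bar> < 1"
    by (auto simp: tendsto_iff dist_real_def dest: spec[of _ 1])
  then obtain n where "\<bar>\<mu> (X n - X (Suc n))\<bar> < 1" unfolding eventually_sequentially by blast
  then show False using X(2)[of n] by simp
qed

text \<open>
  The positive set is one on which \<open>\<mu>\<close> attains its supremum \<open>s\<close>. Choose \<open>A\<^sub>n\<close> with deficit
  \<open>s - \<mu> A\<^sub>n < 2\<^sup>-\<^sup>n\<close>. Modularity of \<open>\<mu>\<close> makes deficits subadditive under intersection, so
  \<open>A\<^sub>n \<inter> A\<^sub>n\<^sub>+\<^sub>1 \<inter> \<dots>\<close> has deficit at most \<open>2 \<cdot> 2\<^sup>-\<^sup>n\<close>, and the increasing union of these sets has none.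
\<close>

lemma Hahn_decomposition:
  assumes \<mu>: "signed_borel_measure \<mu>"
  obtains S where "S \<in> sets borel"
    "\<And>X. X \<in> sets borel \<Longrightarrow> X \<subseteq> S \<Longrightarrow> 0 \<le> \<mu> X"
    "\<And>X. X \<in> sets borel \<Longrightarrow> X \<subseteq> - S \<Longrightarrow> \<mu> X \<le> 0"
proof -
  obtain K where K: "\<And>A. A \<in> sets borel \<Longrightarrow> \<bar>\<mu> A\<bar> \<le> K"
    using signed_borel_measure_bounded[OF \<mu>] by blast
  define s where "s = Sup (\<mu> ` sets borel)"
  have bdd: "bdd_above (\<mu> ` sets borel)" using K by (intro bdd_aboveI[of _ K]) (auto intro: abs_le_D1)
  have le: "\<mu> A \<le> s" if "A \<in> sets borel" for A
    unfolding s_def using that bdd by (auto intro: cSup_upper)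
  have "\<exists>A\<in>sets borel. s - (1/2)^n < \<mu> A" for n :: nat
    using less_cSup_iff[OF _ bdd, of "s - (1/2)^n"] unfolding s_def[symmetric] by auto
  then obtain A where A: "\<And>n. A n \<in> sets borel" "\<And>n. s - (1/2)^n < \<mu> (A n)" by metis
  have modular: "\<mu> (X \<union> Y) + \<mu> (X \<inter> Y) = \<mu> X + \<mu> Y" if "X \<in> sets borel" "Y \<in> sets borel" for X Y
  proof -
    have "\<mu> (X \<union> (Y - X)) = \<mu> X + \<mu> (Y - X)"
      using that by (intro signed_borel_measure_Un[OF \<mu>]) auto
    moreover have "\<mu> (Y - (X \<inter> Y)) = \<mu> Y - \<mu> (X \<inter> Y)"
      using that by (intro signed_borel_measure_Diff[OF \<mu>]) auto
    moreover have "Y - X \<inter> Y = Y - X" "X \<union> (Y - X) = X \<union> Y" by auto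
    ultimately show ?thesis by simp
  qed
  define B where "B n k = (\<Inter>i\<le>k. A (n + i))" for n k
  have Bm: "B n k \<in> sets borel" for n k using A(1) by (auto simp: B_def)
  have B: "s - \<mu> (B n k) \<le> 2 * (1/2)^n - (1/2)^(n + k)" for n k
  proof (induction k)
    case 0 then show ?case using A(2)[of n] by (simp add: B_def)
  next
    case (Suc k)
    have "B n (Suc k) = B n k \<inter> A (n + Suc k)" by (auto simp: B_def atMost_Suc)
    moreover have "\<mu> (B n k \<union> A (n + Suc k)) \<le> s" using A(1) Bm by (intro le) auto
    ultimately show ?case using modular[of "B n k" "A (n + Suc k)"] A(1) Bm A(2)[of "n + Suc k"] Suc
      by auto
  qed
  define C where "C n = (\<Inter>k. B n k)" for n
  have Cm: "C n \<in> sets borel" for n using Bm by (auto simp: C_def)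
  have C: "s - 2 * (1/2)^n \<le> \<mu> (C n)" for n
  proof -
    have "(\<lambda>k. \<mu> (B n k)) \<longlonglongrightarrow> \<mu> (C n)"
      unfolding C_def using Bm by (intro signed_borel_measure_decseq[OF \<mu>]) (auto simp: decseq_def B_def)
    moreover have "s - 2 * (1/2)^n \<le> \<mu> (B n k)" for k
    proof -
      have "(0::real) \<le> (1/2)^(n+k)" by simp
      then show ?thesis using B[of n k] by linarith
    qed
    ultimately show ?thesis by (intro LIMSEQ_le_const) auto
  qed
  have "incseq C"
  proof (intro incseq_SucI subsetI)
    fix n x assume x: "x \<in> C n"
    have "x \<in> A (Suc n + i)" for i
    proof -
      have "x \<in> B n (Suc i)" using x by (simp add: C_def)
      then have "x \<in> A (n + Suc i)" unfolding B_def by blast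
      then show ?thesis by simp
    qed
    then show "x \<in> C (Suc n)" by (auto simp: C_def B_def)
  qed
  define S where "S = (\<Union>n. C n)"
  have S: "S \<in> sets borel" using Cm by (auto simp: S_def)
  have "(\<lambda>n. \<mu> (C n)) \<longlonglongrightarrow> \<mu> S"
    unfolding S_def using Cm \<open>incseq C\<close> by (intro signed_borel_measure_incseq[OF \<mu>]) auto
  moreover have "(\<lambda>n. s - 2 * (1/2)^n) \<longlonglongrightarrow> s - 2 * 0"
    by (intro tendsto_intros LIMSEQ_power_zero) auto
  ultimately have max: "s \<le> \<mu> S"
    using C by (auto intro: LIMSEQ_le)
  show ?thesis
  proof (rule that[OF S])
    fix X :: "'a set" assume "X \<in> sets borel" "X \<subseteq> S"
    then show "0 \<le> \<mu> X"
      using le[of "S - X"] max S signed_borel_measure_Diff[OF \<mu>, of S X] by auto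
  next
    fix X :: "'a set" assume "X \<in> sets borel" "X \<subseteq> - S"
    moreover from this have "\<mu> (S \<union> X) = \<mu> S + \<mu> X"
      using S by (intro signed_borel_measure_Un[OF \<mu>]) auto
    ultimately show "\<mu> X \<le> 0"
      using le[of "S \<union> X"] max S by auto
  qed
qed

lemma measure_of_signed:
  assumes \<mu>: "signed_borel_measure \<mu>" and S: "S \<in> sets borel"
    and nn: "\<And>X. X \<in> sets borel \<Longrightarrow> X \<subseteq> S \<Longrightarrow> 0 \<le> \<mu> X"
  obtains P where "sets P = sets borel" "finite_measure P"
    "\<And>A. A \<in> sets borel \<Longrightarrow> emeasure P A = ennreal (\<mu> (A \<inter> S))"
proof -
  define P where "P = measure_of UNIV (sets borel) (\<lambda>A. ennreal (\<mu> (A \<inter> S)))"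
  have sP: "sets P = sets borel"
    unfolding P_def by (metis sets.sets_measure_of_eq space_borel)
  have "countably_additive (sets borel) (\<lambda>A. ennreal (\<mu> (A \<inter> S)))"
  proof (rule countably_additiveI)
    fix A :: "nat \<Rightarrow> 'a set" assume A: "range A \<subseteq> sets borel" "disjoint_family A"
    have "range (\<lambda>i. A i \<inter> S) \<subseteq> sets borel" "disjoint_family (\<lambda>i. A i \<inter> S)"
      using A S by (auto simp: disjoint_family_on_def)
    then have "(\<lambda>i. \<mu> (A i \<inter> S)) sums \<mu> (\<Union>i. A i \<inter> S)"
      using \<mu> unfolding signed_borel_measure_def by blast
    then have "(\<lambda>i. \<mu> (A i \<inter> S)) sums \<mu> ((\<Union>i. A i) \<inter> S)" by (simp add: Int_UN_distrib2)
    moreover have "0 \<le> \<mu> (A i \<inter> S)" for i using A S by (intro nn) auto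
    ultimately show "(\<Sum>i. ennreal (\<mu> (A i \<inter> S))) = ennreal (\<mu> ((\<Union>i. A i) \<inter> S))"
      by (intro suminf_ennreal_eq) auto
  qed
  moreover have "positive (sets borel) (\<lambda>A. ennreal (\<mu> (A \<inter> S)))"
    by (simp add: positive_def signed_borel_measure_empty[OF \<mu>])
  ultimately have e: "emeasure P A = ennreal (\<mu> (A \<inter> S))" if "A \<in> sets borel" for A
    using that sP by (intro emeasure_measure_of[OF P_def]) auto
  have "finite_measure P"
    by (rule finite_measureI) (simp add: e sets_eq_imp_space_eq[OF sP])
  with sP e show ?thesis using that by blast
qed

lemma jordan_decomposition_exists:
  assumes \<mu>: "signed_borel_measure \<mu>"
  shows "\<exists>P N. jordan_decomposition \<mu> P N"
proof -
  obtain S where S: "S \<in> sets borel"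
    "\<And>X. X \<in> sets borel \<Longrightarrow> X \<subseteq> S \<Longrightarrow> 0 \<le> \<mu> X"
    "\<And>X. X \<in> sets borel \<Longrightarrow> X \<subseteq> - S \<Longrightarrow> \<mu> X \<le> 0"
    using Hahn_decomposition[OF \<mu>] by blast
  obtain P where P: "sets P = sets borel" "finite_measure P"
    "\<And>A. A \<in> sets borel \<Longrightarrow> emeasure P A = ennreal (\<mu> (A \<inter> S))"
    using measure_of_signed[OF \<mu> S(1,2)] by metis
  have n: "signed_borel_measure (\<lambda>A. - \<mu> A)"
    using \<mu> by (auto simp: signed_borel_measure_def intro!: sums_minus)
  have "- S \<in> sets borel" using S(1) by auto
  then obtain N where N: "sets N = sets borel" "finite_measure N"
    "\<And>A. A \<in> sets borel \<Longrightarrow> emeasure N A = ennreal (- \<mu> (A \<inter> - S))"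
    using measure_of_signed[OF n, of "- S"] S(3) by (metis neg_0_le_iff_le)
  have "\<mu> A = measure P A - measure N A" if "A \<in> sets borel" for A
  proof -
    have "\<mu> ((A \<inter> S) \<union> (A \<inter> - S)) = \<mu> (A \<inter> S) + \<mu> (A \<inter> - S)"
      using that S(1) by (intro signed_borel_measure_Un[OF \<mu>]) auto
    moreover have "(A \<inter> S) \<union> (A \<inter> - S) = A" by auto
    moreover have "0 \<le> \<mu> (A \<inter> S)" "\<mu> (A \<inter> - S) \<le> 0" using that S by auto
    ultimately show ?thesis using P(3)[OF that] N(3)[OF that] by (simp add: measure_def)
  qed
  moreover have "emeasure P (- S) = 0" "emeasure N S = 0"
    using P(3)[of "- S"] N(3)[of S] S(1) by (auto simp: signed_borel_measure_empty[OF \<mu>])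
  ultimately show ?thesis
    using P(1,2) N(1,2) S(1) unfolding jordan_decomposition_def by blast
qed

lemma jordan_decomposition_minus:
  assumes "jordan_decomposition \<mu> P N" shows "jordan_decomposition (\<lambda>A. - \<mu> A) N P"
proof -
  obtain S where "S \<in> sets borel" "emeasure P (- S) = 0" "emeasure N S = 0"
    using assms unfolding jordan_decomposition_def by blast
  then have "\<exists>S\<in>sets borel. emeasure N (- S) = 0 \<and> emeasure P S = 0"
    by (intro bexI[of _ "- S"]) auto
  then show ?thesis using assms unfolding jordan_decomposition_def by auto
qed

text \<open>
  The positive part is recovered from \<open>\<mu>\<close> alone, which is why Jordan decompositions are unique.
\<close>

lemma jordan_decomposition_pos:
  assumes "jordan_decomposition \<mu> P N" "A \<in> sets borel"
  shows "measure P A = (SUP B\<in>{B\<in>sets borel. B \<subseteq> A}. \<mu> B)"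
proof -
  obtain S where S: "S \<in> sets borel" "emeasure P (- S) = 0" "emeasure N S = 0"
    and s: "sets P = sets borel" "sets N = sets borel" "finite_measure P" "finite_measure N"
    and e: "\<And>A. A \<in> sets borel \<Longrightarrow> \<mu> A = measure P A - measure N A"
    using assms(1) unfolding jordan_decomposition_def by blast
  interpret P: finite_measure P by fact
  interpret N: finite_measure N by fact
  have "measure N (A \<inter> S) \<le> measure N S" using s S by (intro N.finite_measure_mono) auto
  then have "measure N (A \<inter> S) = 0" using S(3) by (simp add: measure_def antisym)
  moreover have "measure P A = measure P (A \<inter> S)"
  proof -
    have "measure P A = measure P (A \<inter> S) + measure P (A - S)"
      using assms(2) S(1) s P.finite_measure_Union[of "A \<inter> S" "A - S"] by (auto simp: Int_Diff_Un)
    moreover have "measure P (A - S) \<le> measure P (- S)"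
      using s S assms by (intro P.finite_measure_mono) auto
    ultimately show ?thesis using S(2) by (simp add: measure_def antisym)
  qed
  ultimately have "\<mu> (A \<inter> S) = measure P A" using e[of "A \<inter> S"] assms S(1) by simp
  show ?thesis
  proof (rule cSup_eq_maximum[symmetric])
    show "measure P A \<in> \<mu> ` {B \<in> sets borel. B \<subseteq> A}"
      using \<open>\<mu> (A \<inter> S) = measure P A\<close> assms(2) S(1) by (force intro!: image_eqI[of _ _ "A \<inter> S"])
  next
    fix x assume "x \<in> \<mu> ` {B \<in> sets borel. B \<subseteq> A}"
    then obtain B where B: "B \<in> sets borel" "B \<subseteq> A" "x = \<mu> B" by auto
    have "\<mu> B \<le> measure P B" using e[OF B(1)] by simp
    also have "\<dots> \<le> measure P A" using B s assms by (intro P.finite_measure_mono) auto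
    finally show "x \<le> measure P A" using B by simp
  qed
qed

lemma jordan_decomposition_pos_unique:
  assumes "jordan_decomposition \<mu> P N" "jordan_decomposition \<mu> P' N'"
  shows "P = P'"
proof (rule measure_eqI)
  show "sets P = sets P'" using assms by (simp add: jordan_decomposition_def)
  fix A assume "A \<in> sets P"
  then have "A \<in> sets borel" using assms by (simp add: jordan_decomposition_def)
  then have "measure P A = measure P' A" using assms by (simp add: jordan_decomposition_pos)
  then show "emeasure P A = emeasure P' A"
    using assms by (simp add: jordan_decomposition_def finite_measure.emeasure_eq_measure)
qed

lemma jordan_decomposition_parts:
  assumes "signed_borel_measure \<mu>"
  shows "jordan_decomposition \<mu> (pos_part \<mu>) (neg_part \<mu>)"
proof -
  obtain P N where J: "jordan_decomposition \<mu> P N" using jordan_decomposition_exists[OF assms] by blast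
  have "pos_part \<mu> = P"
    unfolding pos_part_def using J jordan_decomposition_pos_unique by (intro the_equality) blast+
  moreover have "neg_part \<mu> = N"
    unfolding neg_part_def
    using J jordan_decomposition_pos_unique[OF jordan_decomposition_minus jordan_decomposition_minus]
    by (intro the_equality) blast+
  ultimately show ?thesis using J by simp
qed

section \<open>Integrability of powers of the norm\<close>

text \<open>
  A function below a step function on balls is dominated by \<open>\<Sum> c\<^sub>n 1\<^bsub>B(0, r\<^sub>n)\<^esub>\<close>; with dyadic radii this
  replaces polar coordinates.
\<close>

lemma nn_integral_dyadic_finite:
  fixes f :: "'a::euclidean_space \<Rightarrow> ennreal"
  assumes le: "\<And>z. f z \<noteq> 0 \<Longrightarrow> \<exists>n. norm z < r n \<and> f z \<le> ennreal (c n)"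
    and nn: "\<And>n::nat. 0 \<le> c n" "\<And>n. 0 \<le> r n"
    and s: "summable (\<lambda>n. c n * r n ^ DIM('a))"
  shows "(\<integral>\<^sup>+z. f z \<partial>lborel) < \<infinity>"
proof -
  let ?v = "unit_ball_vol (real DIM('a))"
  have "f z \<le> (\<Sum>n. ennreal (c n) * indicator (ball 0 (r n)) z)" for z
  proof (cases "f z = 0")
    case False
    then obtain n where n: "norm z < r n" "f z \<le> ennreal (c n)" using le by blast
    define h where "h n = ennreal (c n) * indicator (ball 0 (r n)) z" for n
    have "f z \<le> h n" using n by (simp add: h_def)
    also have "\<dots> = sum h {n}" by simp
    also have "\<dots> \<le> suminf h" by (intro sum_le_suminf) auto
    finally show ?thesis by (simp add: h_def[abs_def])
  qed simp
  then have "(\<integral>\<^sup>+z. f z \<partial>lborel) \<le> (\<integral>\<^sup>+z. (\<Sum>n. ennreal (c n) * indicator (ball 0 (r n)) z) \<partial>(lborel :: 'a measure))"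
    by (intro nn_integral_mono) auto
  also have "\<dots> = (\<Sum>n. ennreal (c n) * emeasure lborel (ball 0 (r n) :: 'a set))"
  proof (subst nn_integral_suminf)
    show "(\<lambda>z. ennreal (c n) * indicator (ball 0 (r n)) z) \<in> borel_measurable (lborel :: 'a measure)" for n
      by (intro borel_measurable_times_ennreal borel_measurable_const borel_measurable_indicator) auto
    have "(\<integral>\<^sup>+z. ennreal (c n) * indicator (ball 0 (r n)) z \<partial>(lborel :: 'a measure)) = ennreal (c n) * emeasure lborel (ball 0 (r n) :: 'a set)" for n
      by (rule nn_integral_cmult_indicator) simp
    then show "(\<Sum>n. \<integral>\<^sup>+z. ennreal (c n) * indicator (ball 0 (r n)) z \<partial>(lborel :: 'a measure))
      = (\<Sum>n. ennreal (c n) * emeasure lborel (ball 0 (r n) :: 'a set))" by simp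
  qed
  also have "\<dots> = (\<Sum>n. ennreal (?v * (c n * r n ^ DIM('a))))"
    using nn by (intro suminf_cong) (simp add: emeasure_ball ennreal_mult[symmetric] ac_simps)
  also have "\<dots> = ennreal (\<Sum>n. ?v * (c n * r n ^ DIM('a)))"
    using nn s by (intro suminf_ennreal2 summable_mult) auto
  also have "\<dots> < \<infinity>" by simp
  finally show ?thesis .
qed

lemma dyadic_shell:
  fixes x :: real assumes "1 \<le> x" shows "\<exists>n. 2 ^ n \<le> x \<and> x < 2 ^ Suc n"
proof -
  have ex: "\<exists>n. x < 2 ^ n" using real_arch_pow[of 2 x] by simp
  define N where "N = (LEAST n. x < 2 ^ n)"
  have N: "x < 2 ^ N" unfolding N_def using ex by (rule LeastI_ex)
  then have "N \<noteq> 0" using assms by (cases N) auto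
  then obtain n where n: "N = Suc n" using not0_implies_Suc by blast
  then have "\<not> x < 2 ^ n" using not_less_Least[of n "\<lambda>n. x < 2 ^ n"] unfolding N_def by simp
  then show ?thesis using N n by (intro exI[of _ n]) auto
qed

text \<open>
  The exponents will be those of the potential near the origin and of its Laplacian at infinity; both
  lie in the range where the power is integrable.
\<close>

definition majorant :: "real \<Rightarrow> real \<Rightarrow> 'a::real_normed_vector \<Rightarrow> real" where
  "majorant b s z = (if norm z < 1 then norm z powr b else norm z powr s)"

lemma majorant_nonneg [simp]: "0 \<le> majorant b s z" by (simp add: majorant_def)

lemma majorant_measurable [measurable]: "majorant b s \<in> borel_measurable borel"
  unfolding majorant_def[abs_def]
  by (intro measurable_If powr_real_measurable) auto

lemma powr_pow_swap: "0 < x \<Longrightarrow> (x ^ n) powr y = (x powr y) ^ n" for x :: real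
  by (induction n) (auto simp: powr_mult)

text \<open>
  On the shells \<open>norm z \<approx> 2\<^sup>\<plusminus>\<^sup>n\<close> the series of the previous criterion are geometric, with ratios
  \<open>2\<^bsup>-(b + d)\<^esup>\<close> near the origin and \<open>2\<^bsup>s + d\<^esup>\<close> at infinity.
\<close>

lemma integrable_majorant:
  assumes b: "- real DIM('a) < b" "b < 0" and s: "s < - real DIM('a)"
  shows "integrable lborel (majorant b s :: 'a::euclidean_space \<Rightarrow> real)"
proof (rule integrableI_bounded)
  let ?d = "DIM('a)"
  have near: "(\<integral>\<^sup>+z. ennreal (if norm z < 1 then norm z powr b else 0) \<partial>(lborel :: 'a measure)) < \<infinity>"
  proof (rule nn_integral_dyadic_finite[where r = "\<lambda>n. 2 * (1/2)^n" and c = "\<lambda>n. (2 powr - b) ^ Suc n"])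
    fix z :: 'a assume "ennreal (if norm z < 1 then norm z powr b else 0) \<noteq> 0"
    then have z: "0 < norm z" "norm z < 1" by (auto split: if_splits)
    then obtain n where n: "2 ^ n \<le> 1 / norm z" "1 / norm z < 2 ^ Suc n"
      using dyadic_shell[of "1 / norm z"] by auto
    have "norm z \<le> (1/2)^n" using n(1) z by (simp add: field_simps power_one_over)
    then have "norm z < 2 * (1/2)^n" by (rule order.strict_trans1) simp
    moreover have "norm z powr b \<le> (2 powr - b) ^ Suc n"
    proof -
      have "norm z powr b = (1 / norm z) powr - b" using z by (simp add: powr_minus_divide powr_divide)
      also have "\<dots> \<le> (2 ^ Suc n) powr - b" using n(2) z b by (intro powr_mono2) auto
      finally show ?thesis by (simp only: powr_pow_swap)
    qed
    ultimately show "\<exists>n. norm z < 2 * (1/2)^n \<and>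
        ennreal (if norm z < 1 then norm z powr b else 0) \<le> ennreal ((2 powr - b) ^ Suc n)"
      using z by (intro exI[of _ n]) (auto intro: ennreal_leI)
  next
    have "(2::real) powr - (b + ?d) = 2 powr - b * (1/2) ^ ?d"
      using powr_add[of 2 "- b" "- real ?d"] by (simp add: powr_minus powr_realpow power_one_over inverse_eq_divide)
    then have "(2 powr - b) ^ Suc n * (2 * (1/2)^n) ^ ?d = (2 powr - b * 2 ^ ?d) * (2 powr - (b + ?d)) ^ n" for n
      by (simp add: power_mult_distrib mult.commute mult.left_commute flip: power_mult)
    moreover have "(2::real) powr - (b + ?d) < 1"
      using b by (simp add: powr_less_one)
    ultimately show "summable (\<lambda>n. (2 powr - b) ^ Suc n * (2 * (1/2)^n) ^ ?d)"
      by (simp only:) (intro summable_mult summable_geometric, simp)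
  qed auto
  have far: "(\<integral>\<^sup>+z. ennreal (if norm z < 1 then 0 else norm z powr s) \<partial>(lborel :: 'a measure)) < \<infinity>"
  proof (rule nn_integral_dyadic_finite[where r = "\<lambda>n. 2 * 2^n" and c = "\<lambda>n. (2 powr s) ^ n"])
    fix z :: 'a assume "ennreal (if norm z < 1 then 0 else norm z powr s) \<noteq> 0"
    then have z: "1 \<le> norm z" by (auto split: if_splits)
    then obtain n where n: "2 ^ n \<le> norm z" "norm z < 2 ^ Suc n"
      using dyadic_shell by auto
    have "norm z powr s \<le> (2 ^ n) powr s" using n z s by (intro powr_mono2') auto
    then have "norm z powr s \<le> (2 powr s) ^ n" by (simp only: powr_pow_swap)
    then show "\<exists>n. norm z < 2 * 2^n \<and>
        ennreal (if norm z < 1 then 0 else norm z powr s) \<le> ennreal ((2 powr s) ^ n)"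
      using z n by (intro exI[of _ n]) (auto intro: ennreal_leI)
  next
    have "(2::real) powr (s + ?d) = 2 powr s * 2 ^ ?d" by (simp add: powr_add powr_realpow)
    then have "(2 powr s) ^ n * (2 * 2^n) ^ ?d = 2 ^ ?d * (2 powr (s + ?d)) ^ n" for n
      by (simp add: power_mult_distrib mult.commute mult.left_commute flip: power_mult)
    moreover have "(2::real) powr (s + ?d) < 1"
      using s by (simp add: powr_less_one)
    ultimately show "summable (\<lambda>n. (2 powr s) ^ n * (2 * 2^n) ^ ?d)"
      by (simp only:) (intro summable_mult summable_geometric, simp)
  qed auto
  have "(\<integral>\<^sup>+z. ennreal (norm (majorant b s z)) \<partial>(lborel :: 'a measure)) =
      (\<integral>\<^sup>+z. ennreal (if norm z < 1 then norm z powr b else 0) + ennreal (if norm z < 1 then 0 else norm z powr s) \<partial>(lborel :: 'a measure))"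
    by (intro nn_integral_cong) (auto simp: majorant_def)
  also have "\<dots> < \<infinity>" using near far by (subst nn_integral_add) auto
  finally show "(\<integral>\<^sup>+z. ennreal (norm (majorant b s z)) \<partial>(lborel :: 'a measure)) < \<infinity>" .
qed simp

section \<open>The divergence theorem on punctured space\<close>

lemma lborel_integral_translate:
  fixes f :: "'a::euclidean_space \<Rightarrow> real"
  shows "(\<integral>x. f (x + a) \<partial>lborel) = (\<integral>x. f x \<partial>lborel)"
proof (cases "f \<in> borel_measurable borel")
  case True
  have "(\<integral>x. f x \<partial>lborel) = (\<integral>x. f x \<partial>(distr lborel borel (\<lambda>x. a + x)))"
    using lborel_affine[of 1 a] by (simp add: density_1)
  also have "\<dots> = (\<integral>x. f (a + x) \<partial>lborel)" using True by (intro integral_distr) auto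
  finally show ?thesis by (simp add: add.commute)
next
  case False
  have "(\<lambda>x. f (x + a)) \<notin> borel_measurable borel"
  proof
    assume "(\<lambda>x. f (x + a)) \<in> borel_measurable borel"
    then have "(\<lambda>x. f ((x - a) + a)) \<in> borel_measurable borel" by (rule measurable_compose[rotated]) auto
    then show False using False by simp
  qed
  then show ?thesis using False by (simp add: not_integrable_integral_eq integrable_iff_bounded)
qed

lemma lborel_integrable_translate:
  fixes f :: "'a::euclidean_space \<Rightarrow> real"
  assumes "integrable lborel f" shows "integrable lborel (\<lambda>x. f (x + a))"
proof -
  have "integrable (distr lborel borel (\<lambda>x. a + x)) f"
    using assms lborel_affine[of 1 a] by (simp add: density_1)
  then have "integrable lborel (\<lambda>x. f (a + x))" using assms by (subst (asm) integrable_distr_eq) auto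
  then show ?thesis by (simp add: add.commute)
qed

text \<open>
  By translation invariance the difference quotients \<open>(f(x + h e) - f(x)) / h\<close> have integral 0, and
  as \<open>f\<close> is Lipschitz with compact support they converge dominatedly.
\<close>

lemma directional_derivative_compact_support:
  fixes f :: "'a::euclidean_space \<Rightarrow> real"
  assumes der: "\<And>x. (f has_derivative f' x) (at x)"
    and cont: "continuous_on UNIV (\<lambda>x. f' x e)"
    and supp: "\<And>x. R < norm x \<Longrightarrow> f x = 0"
  shows "integrable lborel (\<lambda>x. f' x e)" "(\<integral>x. f' x e \<partial>lborel) = 0"
proof -
  have f0: "f' x e = 0" if "R < norm x" for x
  proof -
    have "open {x::'a. R < norm x}" by (intro open_Collect_less continuous_intros)
    then have "(f has_derivative (\<lambda>_. 0)) (at x)"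
      using supp that by (intro has_derivative_transform_within_open[OF has_derivative_const[of 0]]) auto
    then have "f' x = (\<lambda>_. 0)" using der has_derivative_unique by blast
    then show ?thesis by simp
  qed
  have "bounded ((\<lambda>x. f' x e) ` cball 0 R)"
    by (intro compact_imp_bounded compact_continuous_image continuous_on_subset[OF cont]) auto
  then obtain L where "0 < L" "\<forall>y\<in>(\<lambda>x. f' x e) ` cball 0 R. norm y \<le> L"
    unfolding bounded_pos by blast
  then have L: "\<And>x. norm x \<le> R \<Longrightarrow> \<bar>f' x e\<bar> \<le> L" "0 < L" by auto
  then have L': "\<bar>f' x e\<bar> \<le> L" for x using f0[of x] by (cases "norm x \<le> R") auto
  have fm [measurable]: "f \<in> borel_measurable borel"
    using der by (intro borel_measurable_continuous_onI) (auto intro: has_derivative_continuous_on)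
  have dm [measurable]: "(\<lambda>x. f' x e) \<in> borel_measurable borel"
    using cont by (rule borel_measurable_continuous_onI)
  have bound: "\<bar>f (x + h *\<^sub>R e) - f x\<bar> \<le> L * h" if "0 < h" for x h
  proof -
    have "((\<lambda>t. f (x + t *\<^sub>R e)) has_real_derivative f' (x + t *\<^sub>R e) e) (at t)" for t
    proof -
      have "((\<lambda>t. f (x + t *\<^sub>R e)) has_derivative (\<lambda>s. f' (x + t *\<^sub>R e) (s *\<^sub>R e))) (at t)"
        by (rule has_derivative_compose[OF _ der, of "\<lambda>t. x + t *\<^sub>R e"]) (auto intro!: derivative_eq_intros)
      moreover have "f' (x + t *\<^sub>R e) (s *\<^sub>R e) = f' (x + t *\<^sub>R e) e * s" for s
        using der[of "x + t *\<^sub>R e"] by (simp add: has_derivative_bounded_linear linear_simps)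
      ultimately show ?thesis by (simp add: has_field_derivative_def)
    qed
    then have "\<exists>z>0. z < h \<and> f (x + h *\<^sub>R e) - f (x + 0 *\<^sub>R e) = (h - 0) * f' (x + z *\<^sub>R e) e"
      using that by (intro MVT2) auto
    then obtain z where "f (x + h *\<^sub>R e) - f x = h * f' (x + z *\<^sub>R e) e"
      by (metis add.right_neutral diff_zero scaleR_zero_left)
    then show ?thesis using L'[of "x + z *\<^sub>R e"] that by (simp add: abs_mult mult.commute mult_left_mono)
  qed
  have dom: "integrable lborel (\<lambda>x. L * indicator (cball 0 (R + norm e)) x :: real)"
    by (intro integrable_mult_right integrable_real_indicator emeasure_lborel_cball_finite) auto
  show "integrable lborel (\<lambda>x. f' x e)"
  proof (rule Bochner_Integration.integrable_bound[OF dom])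
    have "\<bar>f' x e\<bar> \<le> L * indicator (cball 0 (R + norm e)) x" for x
    proof (cases "norm x \<le> R + norm e")
      case False
      then have "R < norm x" using norm_ge_zero[of e] by linarith
      then show ?thesis using False f0 by simp
    qed (use L' in simp)
    then show "AE x in lborel. norm (f' x e) \<le> norm (L * indicator (cball 0 (R + norm e)) x :: real)"
      using L(2) by (auto simp: abs_mult)
  qed simp
  have "integrable lborel (\<lambda>x. f x)"
  proof -
    have "continuous_on UNIV f"
      using der by (auto intro: has_derivative_continuous_on)
    then have "bounded (f ` cball 0 R)"
      by (intro compact_imp_bounded compact_continuous_image) (auto intro: continuous_on_subset)
    then obtain B where B: "\<And>x. norm x \<le> R \<Longrightarrow> \<bar>f x\<bar> \<le> B" unfolding bounded_iff by fastforce
    have "integrable lborel (\<lambda>x. B * indicator (cball 0 R) x :: real)"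
      by (intro integrable_mult_right integrable_real_indicator emeasure_lborel_cball_finite) auto
    then show ?thesis
      by (rule Bochner_Integration.integrable_bound)
        (use B supp in \<open>auto simp: indicator_def not_le intro: order_trans[OF _ abs_ge_self]\<close>)
  qed
  define h where "h n = 1 / real (Suc n)" for n
  have h: "0 < h n" "h n \<le> 1" for n by (auto simp: h_def)
  have h0: "h \<longlonglongrightarrow> 0" unfolding h_def[abs_def] by (rule LIMSEQ_Suc[OF lim_const_over_n])
  define q where "q n x = (f (x + h n *\<^sub>R e) - f x) / h n" for n x
  have "(\<lambda>n. \<integral>x. q n x \<partial>lborel) \<longlonglongrightarrow> (\<integral>x. f' x e \<partial>lborel)"
  proof (rule integral_dominated_convergence[OF _ _ dom])
    show "AE x in lborel. (\<lambda>n. q n x) \<longlonglongrightarrow> f' x e"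
    proof (intro AE_I2)
      fix x
      have "((\<lambda>t. (f (x + t *\<^sub>R e) - f x) / t) \<longlongrightarrow> f' x e) (at 0)"
      proof -
        have "((\<lambda>t. f (x + t *\<^sub>R e)) has_derivative (\<lambda>s. f' (x + 0 *\<^sub>R e) (s *\<^sub>R e))) (at 0)"
          by (rule has_derivative_compose[OF _ der, of "\<lambda>t. x + t *\<^sub>R e"]) (auto intro!: derivative_eq_intros)
        moreover have "f' (x + 0 *\<^sub>R e) (s *\<^sub>R e) = f' x e * s" for s
          using der[of x] by (simp add: has_derivative_bounded_linear linear_simps)
        ultimately have "((\<lambda>t. f (x + t *\<^sub>R e)) has_real_derivative f' x e) (at 0)"
          by (simp add: has_field_derivative_def)
        then show ?thesis by (simp add: DERIV_def)
      qed
      moreover have "filterlim h (at 0) sequentially"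
        using h0 h(1) by (intro filterlim_atI always_eventually) (auto simp: less_imp_neq[symmetric])
      ultimately show "(\<lambda>n. q n x) \<longlonglongrightarrow> f' x e"
        unfolding q_def by (rule filterlim_compose)
    qed
    fix n
    show "AE x in lborel. norm (q n x) \<le> L * indicator (cball 0 (R + norm e)) x"
    proof (intro AE_I2)
      fix x
      have "q n x = 0" if "R + norm e < norm x"
      proof -
        have "norm (h n *\<^sub>R e) \<le> norm e" using h[of n] by (simp add: mult_left_le_one_le)
        then have "R < norm (x + h n *\<^sub>R e)" using that norm_diff_ineq[of x "h n *\<^sub>R e"] by linarith
        moreover have "R < norm x" using that norm_ge_zero[of e] by linarith
        ultimately show ?thesis by (simp add: q_def supp)
      qed
      moreover have "\<bar>q n x\<bar> \<le> L" using bound[OF h(1), of x n] h(1)[of n] by (simp add: q_def field_simps)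
      ultimately show "norm (q n x) \<le> L * indicator (cball 0 (R + norm e)) x"
        by (auto simp: indicator_def not_le)
    qed
  qed (simp_all add: q_def[abs_def])
  moreover have "(\<integral>x. q n x \<partial>lborel) = 0" for n
    unfolding q_def using \<open>integrable lborel f\<close> lborel_integrable_translate[of f "h n *\<^sub>R e"]
    by (simp add: lborel_integral_translate)
  ultimately show "(\<integral>x. f' x e \<partial>lborel) = 0" by (simp add: LIMSEQ_const_iff)
qed

text \<open>
  The square makes the hinge continuously differentiable.
\<close>

definition hinge_sq :: "real \<Rightarrow> real" where "hinge_sq t = (max 0 t)\<^sup>2"

lemma hinge_sq_deriv [derivative_intros]:
  assumes "(f has_derivative f') (at x within S)"
  shows "((\<lambda>x. hinge_sq (f x)) has_derivative (\<lambda>h. 2 * max 0 (f x) * f' h)) (at x within S)"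
proof -
  have "(hinge_sq has_real_derivative 2 * max 0 t) (at t)" for t
  proof -
    consider "t > 0" | "t < 0" | "t = 0" by linarith
    then show ?thesis
    proof cases
      case 1
      have "((\<lambda>t. t\<^sup>2) has_real_derivative 2 * max 0 t) (at t)"
        using 1 by (auto intro!: derivative_eq_intros)
      then show ?thesis
        by (rule has_field_derivative_transform_within_open[of _ _ _ "{0<..}"])
          (use 1 in \<open>auto simp: hinge_sq_def\<close>)
    next
      case 2
      have "((\<lambda>t. 0) has_real_derivative 2 * max 0 t) (at t)"
        using 2 by (auto intro!: derivative_eq_intros)
      then show ?thesis
        by (rule has_field_derivative_transform_within_open[of _ _ _ "{..<0}"])
          (use 2 in \<open>auto simp: hinge_sq_def\<close>)
    next
      case 3
      have "((\<lambda>h. hinge_sq h / h) \<longlongrightarrow> 0) (at 0)"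
      proof (rule tendsto_rabs_zero_cancel, rule tendsto_sandwich[OF _ _ tendsto_const])
        show "\<forall>\<^sub>F h in at 0. 0 \<le> \<bar>hinge_sq h / h\<bar>" by simp
        show "\<forall>\<^sub>F h in at 0. \<bar>hinge_sq h / h\<bar> \<le> \<bar>h\<bar>"
          by (intro always_eventually allI) (auto simp: hinge_sq_def power2_eq_square max_def)
        show "((\<lambda>h::real. \<bar>h\<bar>) \<longlongrightarrow> 0) (at 0)" by (intro tendsto_rabs_zero tendsto_ident_at)
      qed
      then show ?thesis using 3 by (simp add: DERIV_def hinge_sq_def)
    qed
  qed
  from has_derivative_compose[OF assms this[of "f x", unfolded has_field_derivative_def]]
  show ?thesis by (simp add: mult.assoc)
qed

lemma continuous_on_hinge_sq [continuous_intros]: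
  "continuous_on S f \<Longrightarrow> continuous_on S (\<lambda>x. hinge_sq (f x))"
  unfolding hinge_sq_def by (intro continuous_intros)

lemma hinge_sq_bounds: "0 \<le> hinge_sq t" "t \<le> 1 \<Longrightarrow> hinge_sq t \<le> 1"
  by (auto simp: hinge_sq_def power_le_one)

text \<open>
  For \<open>n > 0\<close> this vanishes off the annulus \<open>1 / n < \<bar>z\<bar>\<^sup>2 < n\<close>, up to the default value at the
  origin, and it tends to 1 as \<open>n \<rightarrow> \<infinity>\<close>. Its gradient at \<open>z\<close> is \<open>annular_slope n z\<close> times \<open>z\<close>.
\<close>

definition annular_cutoff :: "nat \<Rightarrow> 'a::real_inner \<Rightarrow> real" where
  "annular_cutoff n z = hinge_sq (1 - 1 / (real n * (z \<bullet> z))) * hinge_sq (1 - (z \<bullet> z) / real n)"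

definition annular_slope :: "nat \<Rightarrow> 'a::real_inner \<Rightarrow> real" where
  "annular_slope n z =
     4 * max 0 (1 - 1 / (real n * (z \<bullet> z))) / (real n * (z \<bullet> z)\<^sup>2) * hinge_sq (1 - (z \<bullet> z) / real n)
   - 4 * max 0 (1 - (z \<bullet> z) / real n) / real n * hinge_sq (1 - 1 / (real n * (z \<bullet> z)))"

lemma annular_cutoff_has_derivative:
  assumes "z \<noteq> 0" "n > 0"
  shows "(annular_cutoff n has_derivative (\<lambda>h. annular_slope n z * (z \<bullet> h))) (at z)"
proof -
  have "z \<bullet> z \<noteq> 0" using assms by simp
  then show ?thesis
    unfolding annular_cutoff_def[abs_def] annular_slope_def
    using assms
    by (auto intro!: derivative_eq_intros simp: field_simps power2_eq_square inner_commute)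
qed

lemma annular_cutoff_bounds: "0 \<le> annular_cutoff n z" "annular_cutoff n z \<le> 1"
proof -
  have a: "0 \<le> 1 / (real n * (z \<bullet> z))" "0 \<le> (z \<bullet> z) / real n" by simp_all
  then show "annular_cutoff n z \<le> 1" unfolding annular_cutoff_def
    by (intro mult_le_one hinge_sq_bounds) auto
qed (simp add: annular_cutoff_def hinge_sq_bounds)

lemma annular_cutoff_tendsto:
  assumes "z \<noteq> 0" shows "(\<lambda>n. annular_cutoff n z) \<longlonglongrightarrow> 1"
proof -
  have "(\<lambda>n. 1 - (1 / (z \<bullet> z)) * (1 / real n)) \<longlonglongrightarrow> 1 - (1 / (z \<bullet> z)) * 0"
    "(\<lambda>n. 1 - (z \<bullet> z) * (1 / real n)) \<longlonglongrightarrow> 1 - (z \<bullet> z) * 0"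
    by (intro tendsto_intros lim_1_over_n)+
  then have "(\<lambda>n. (max 0 (1 - (1 / (z \<bullet> z)) * (1 / real n)))\<^sup>2 * (max 0 (1 - (z \<bullet> z) * (1 / real n)))\<^sup>2)
     \<longlonglongrightarrow> (max 0 (1 - (1 / (z \<bullet> z)) * 0))\<^sup>2 * (max 0 (1 - (z \<bullet> z) * 0))\<^sup>2"
    by (intro tendsto_intros)
  then show ?thesis by (simp add: annular_cutoff_def hinge_sq_def field_simps)
qed

text \<open>
  The first bound is scale invariant and does not depend on \<open>n\<close>, so that \<open>norm (F z) / norm z\<close>
  dominates the boundary terms in the divergence theorem; the second makes them tend to 0.
\<close>

lemma annular_slope_bound:
  assumes "z \<noteq> 0" "n > 0" shows "\<bar>annular_slope n z\<bar> \<le> 8 / (z \<bullet> z)"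
    and "\<bar>annular_slope n z\<bar> \<le> (4 / (z \<bullet> z)\<^sup>2 + 4) * (1 / real n)"
proof -
  define s where "s = z \<bullet> z"
  have s: "s > 0" using assms by (simp add: s_def)
  have n: "real n > 0" using assms by simp
  define u where "u = 1 / (real n * s)"
  define v where "v = s / real n"
  have uv: "u > 0" "v > 0" using s n by (auto simp: u_def v_def)
  have eq: "annular_slope n z = 4 * max 0 (1 - u) * u / s * hinge_sq (1 - v) - 4 * max 0 (1 - v) * v / s * hinge_sq (1 - u)"
    unfolding annular_slope_def s_def[symmetric] u_def v_def using s n by (simp add: field_simps power2_eq_square)
  have hu: "0 \<le> hinge_sq (1 - u)" "hinge_sq (1 - u) \<le> 1" and hv: "0 \<le> hinge_sq (1 - v)" "hinge_sq (1 - v) \<le> 1"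
    using uv by (auto intro: hinge_sq_bounds)
  have nn: "0 \<le> 4 * max 0 (1 - u) * u / s" "0 \<le> 4 * max 0 (1 - v) * v / s" using uv s by simp_all
  have "\<bar>annular_slope n z\<bar> \<le> 4 * max 0 (1 - u) * u / s * 1 + 4 * max 0 (1 - v) * v / s * 1"
  proof -
    show ?thesis
      unfolding eq
      using mult_nonneg_nonneg[OF nn(1) hv(1)] mult_left_mono[OF hv(2) nn(1)]
        mult_nonneg_nonneg[OF nn(2) hu(1)] mult_left_mono[OF hu(2) nn(2)] by linarith
  qed
  also have "\<dots> = (4 * (max 0 (1 - u) * u) + 4 * (max 0 (1 - v) * v)) / s" by (simp add: add_divide_distrib)
  finally have main: "\<bar>annular_slope n z\<bar> \<le> (4 * (max 0 (1 - u) * u) + 4 * (max 0 (1 - v) * v)) / s" .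
  have le: "max 0 (1 - x) * x \<le> 1" "max 0 (1 - x) * x \<le> x" if "x > 0" for x :: real
    using that by (auto simp: max_def mult_le_one intro: mult_left_le_one_le)
  have "(4 * (max 0 (1 - u) * u) + 4 * (max 0 (1 - v) * v)) / s \<le> 8 / s"
    using le(1)[OF uv(1)] le(1)[OF uv(2)] s by (intro divide_right_mono) auto
  with main show "\<bar>annular_slope n z\<bar> \<le> 8 / (z \<bullet> z)" unfolding s_def by linarith
  have "(4 * (max 0 (1 - u) * u) + 4 * (max 0 (1 - v) * v)) / s \<le> (4 * u + 4 * v) / s"
    using le(2)[OF uv(1)] le(2)[OF uv(2)] s by (intro divide_right_mono) auto
  also have "\<dots> = (4 / s\<^sup>2 + 4) * (1 / real n)"
    unfolding u_def v_def using s n by (simp add: field_simps power2_eq_square)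
  finally show "\<bar>annular_slope n z\<bar> \<le> (4 / (z \<bullet> z)\<^sup>2 + 4) * (1 / real n)"
    using main unfolding s_def by linarith
qed

text \<open>
  No boundary term survives, neither at the origin nor at infinity, because \<open>norm (F z) / norm z\<close> is
  integrable: after multiplication with the annular cutoff, the divergence integrates to 0, and the
  term in which the cutoff is differentiated is at most \<open>8 norm (F z) / norm z\<close> and tends to 0.
\<close>

lemma integral_divergence_punctured:
  fixes F :: "'a::euclidean_space \<Rightarrow> 'a" and F' :: "'a \<Rightarrow> 'a \<Rightarrow> 'a"
  assumes der: "\<And>z. z \<noteq> 0 \<Longrightarrow> (F has_derivative F' z) (at z)"
    and cont: "\<And>e. e \<in> Basis \<Longrightarrow> continuous_on (- {0}) (\<lambda>z. F' z e)"
    and F: "integrable lborel (\<lambda>z. norm (F z) / norm z)"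
    and div: "integrable lborel (\<lambda>z. \<Sum>e\<in>Basis. F' z e \<bullet> e)"
  shows "(\<integral>z. (\<Sum>e\<in>Basis. F' z e \<bullet> e) \<partial>lborel) = 0"
proof -
  let ?div = "\<lambda>z. \<Sum>e\<in>Basis. F' z e \<bullet> e"
  let ?\<chi> = "annular_cutoff :: nat \<Rightarrow> 'a \<Rightarrow> real" and ?s = "annular_slope :: nat \<Rightarrow> 'a \<Rightarrow> real"
  have Fc: "continuous_on (- {0}) F"
    using der by (intro has_derivative_continuous_on) (auto intro: has_derivative_at_withinI)
  have Fm [measurable]: "F \<in> borel_measurable borel"
    by (rule borel_measurable_continuous_countable_exceptions[where X="{0}"]) (use Fc in auto)
  have Dm [measurable]: "(\<lambda>z. F' z e) \<in> borel_measurable borel" if "e \<in> Basis" for e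
    by (rule borel_measurable_continuous_countable_exceptions[where X="{0}"]) (use cont that in auto)
  have zero: "?s n z = 0 \<and> ?\<chi> n z = 0" if "n > 0" "z \<bullet> z < 1 / real n" "z \<noteq> 0" for n z
  proof -
    have "1 / (real n * (z \<bullet> z)) > 1" using that by (simp add: field_simps)
    then show ?thesis by (simp add: annular_slope_def annular_cutoff_def hinge_sq_def)
  qed
  have far: "?\<chi> n z = 0" if "n > 0" "real n < norm z" for n z
  proof -
    have "real n * 1 < norm z * norm z" using that by (intro mult_strict_mono) auto
    then have "(z \<bullet> z) / real n > 1" using that by (simp add: power2_norm_eq_inner[symmetric] power2_eq_square)
    then show ?thesis by (simp add: annular_cutoff_def hinge_sq_def)
  qed
  have near: "\<forall>\<^sub>F y in nhds (0::'a). y \<bullet> y < 1 / real n" if "n > 0" for n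
  proof -
    have "open {y::'a. y \<bullet> y < 1 / real n}" by (intro open_Collect_less continuous_intros)
    then show ?thesis using that unfolding eventually_nhds
      by (intro exI[of _ "{y. y \<bullet> y < 1 / real n}"]) auto
  qed
  \<comment> \<open>As \<open>1 / 0 = 0\<close>, the cutoff is 1 at the origin itself; the value 0 is put there by hand.\<close>
  define f where "f n e z = (if z = 0 then 0 else ?\<chi> n z * (F z \<bullet> e))" for n e z
  define f' where "f' n e z h = (if z = 0 then 0 else ?s n z * (z \<bullet> h) * (F z \<bullet> e) + ?\<chi> n z * (F' z h \<bullet> e))"
    for n e z h
  have fd: "(f n e has_derivative f' n e z) (at z)" if "n > 0" for n e z
  proof (cases "z = 0")
    case True
    have "\<forall>\<^sub>F y in nhds 0. 0 = f n e y"
      using near[OF that] by eventually_elim (use zero[OF that] in \<open>auto simp: f_def\<close>)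
    then have "(f n e has_derivative (\<lambda>_. 0)) (at 0)"
      by (intro has_derivative_transform_eventually[OF has_derivative_const[of 0]])
        (auto simp: f_def eventually_at_filter elim: eventually_mono)
    then show ?thesis using True by (simp add: f'_def[abs_def])
  next
    case False
    have "((\<lambda>z. ?\<chi> n z * (F z \<bullet> e)) has_derivative f' n e z) (at z)"
      unfolding f'_def[abs_def] using False
      by (auto intro!: derivative_eq_intros annular_cutoff_has_derivative that der)
    then show ?thesis
      by (rule has_derivative_transform_within_open[of _ _ _ _ "- {0}"]) (use False in \<open>auto simp: f_def\<close>)
  qed
  have fc: "continuous_on UNIV (\<lambda>z. f' n e z e)" if "n > 0" "e \<in> Basis" for n e
  proof (intro continuous_at_imp_continuous_on ballI)
    fix z
    show "isCont (\<lambda>z. f' n e z e) z"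
    proof (cases "z = 0")
      case True
      have "\<forall>\<^sub>F y in nhds 0. f' n e y e = 0"
        using near[OF that(1)] by eventually_elim (use zero[OF that(1)] in \<open>auto simp: f'_def\<close>)
      then have "isCont (\<lambda>z. f' n e z e) 0 \<longleftrightarrow> isCont (\<lambda>_::'a. 0::real) 0" by (rule isCont_cong)
      then show ?thesis using True by simp
    next
      case False
      have "continuous_on (- {0}) (\<lambda>z. ?s n z * (z \<bullet> e) * (F z \<bullet> e) + ?\<chi> n z * (F' z e \<bullet> e))"
        unfolding annular_slope_def annular_cutoff_def
        using that by (intro continuous_intros Fc cont) auto
      then have "continuous_on (- {0}) (\<lambda>z. f' n e z e)"
        by (rule continuous_on_cong[THEN iffD1, rotated -1]) (auto simp: f'_def)
      then show ?thesis using False by (simp add: continuous_on_eq_continuous_at open_Compl)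
    qed
  qed
  have fs: "f n e z = 0" if "n > 0" "real n < norm z" for n e z
    using far[OF that] by (simp add: f_def)
  note dd = directional_derivative_compact_support[where f = "f n e" and f' = "f' n e" and R = "real n" for n e,
      OF fd fc fs]
  have id: "(\<Sum>e\<in>Basis. f' n e z e) = ?s n z * (z \<bullet> F z) + ?\<chi> n z * ?div z" if "z \<noteq> 0" for n z
  proof -
    have "(\<Sum>e\<in>Basis. f' n e z e) =
        ?s n z * (\<Sum>e\<in>Basis. (z \<bullet> e) * (F z \<bullet> e)) + ?\<chi> n z * ?div z"
      using that by (simp add: f'_def sum.distrib sum_distrib_left mult.assoc)
    then show ?thesis by (simp add: euclidean_inner[of z "F z"])
  qed
  have sum0: "(\<integral>z. (\<Sum>e\<in>Basis. f' (Suc n) e z e) \<partial>lborel) = 0" for n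
    using dd by (subst Bochner_Integration.integral_sum) auto
  define g where "g n z = ?s (Suc n) z * (z \<bullet> F z) + ?\<chi> (Suc n) z * ?div z" for n z
  have "AE z in lborel. z \<noteq> (0::'a)" by (rule AE_lborel_singleton)
  have [measurable]: "?s n \<in> borel_measurable borel" "?\<chi> n \<in> borel_measurable borel" for n
    unfolding annular_slope_def[abs_def] annular_cutoff_def[abs_def] hinge_sq_def by measurable
  have gm [measurable]: "g n \<in> borel_measurable borel" for n
    unfolding g_def[abs_def] by measurable
  have g0: "(\<integral>z. g n z \<partial>lborel) = 0" for n
  proof -
    have "(\<integral>z. g n z \<partial>lborel) = (\<integral>z. (\<Sum>e\<in>Basis. f' (Suc n) e z e) \<partial>lborel)"
    proof (rule integral_cong_AE)
      show "AE z in lborel. g n z = (\<Sum>e\<in>Basis. f' (Suc n) e z e)"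
        using \<open>AE z in lborel. z \<noteq> 0\<close> by eventually_elim (simp add: g_def id)
    next
      show "(\<lambda>z. \<Sum>e\<in>Basis. f' (Suc n) e z e) \<in> borel_measurable lborel"
        using dd(1)[of "Suc n"] by (intro borel_measurable_sum) (auto dest: borel_measurable_integrable)
    qed simp
    then show ?thesis using sum0 by simp
  qed
  have "(\<lambda>n. \<integral>z. g n z \<partial>lborel) \<longlonglongrightarrow> (\<integral>z. ?div z \<partial>lborel)"
  proof (rule integral_dominated_convergence)
    show "integrable lborel (\<lambda>z. 8 * (norm (F z) / norm z) + \<bar>?div z\<bar>)"
      using F div by (intro Bochner_Integration.integrable_add integrable_mult_right integrable_abs)
    show "AE z in lborel. (\<lambda>n. g n z) \<longlonglongrightarrow> ?div z"
      using \<open>AE z in lborel. z \<noteq> 0\<close>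
    proof eventually_elim
      case (elim z)
      have "(\<lambda>n. ?s (Suc n) z) \<longlonglongrightarrow> 0"
      proof (rule tendsto_rabs_zero_cancel, rule tendsto_sandwich[OF _ _ tendsto_const])
        show "(\<lambda>n. (4 / (z \<bullet> z)\<^sup>2 + 4) * (1 / real (Suc n))) \<longlonglongrightarrow> 0"
          by (intro tendsto_mult_right_zero LIMSEQ_Suc[OF lim_1_over_n])
      qed (use annular_slope_bound(2)[OF elim zero_less_Suc] in \<open>auto intro!: always_eventually\<close>)
      then have "(\<lambda>n. g n z) \<longlonglongrightarrow> 0 * (z \<bullet> F z) + 1 * ?div z"
        unfolding g_def by (intro tendsto_intros LIMSEQ_Suc[OF annular_cutoff_tendsto] elim)
      then show ?case by simp
    qed
    fix n
    show "AE z in lborel. norm (g n z) \<le> 8 * (norm (F z) / norm z) + \<bar>?div z\<bar>"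
      using \<open>AE z in lborel. z \<noteq> 0\<close>
    proof eventually_elim
      case (elim z)
      have "\<bar>?s (Suc n) z * (z \<bullet> F z)\<bar> \<le> 8 / (z \<bullet> z) * (norm z * norm (F z))"
        unfolding abs_mult using elim
        by (intro mult_mono annular_slope_bound Cauchy_Schwarz_ineq2) auto
      also have "\<dots> = 8 * (norm (F z) / norm z)"
        using elim by (simp add: power2_norm_eq_inner[symmetric] power2_eq_square field_simps)
      finally have "\<bar>?s (Suc n) z * (z \<bullet> F z)\<bar> \<le> 8 * (norm (F z) / norm z)" .
      moreover have "\<bar>?\<chi> (Suc n) z * ?div z\<bar> \<le> \<bar>?div z\<bar>"
        using annular_cutoff_bounds[of "Suc n" z]
        by (auto simp: abs_mult intro: mult_left_le_one_le)
      ultimately show ?case unfolding g_def by simp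
    qed
  qed (use Dm in auto)
  then show ?thesis by (simp add: g0 LIMSEQ_const_iff)
qed

section \<open>The heat kernel\<close>

definition heat_kernel :: "real \<Rightarrow> 'a::euclidean_space \<Rightarrow> real" where
  "heat_kernel t x = (4 * pi * t) powr - (real DIM('a) / 2) * exp (- (x \<bullet> x) / (4 * t))"

text \<open>
  The common value of \<open>\<partial>\<^sub>t p\<^sub>t\<close> and \<open>\<Delta>p\<^sub>t\<close>.
\<close>

definition heat_rate :: "real \<Rightarrow> 'a::euclidean_space \<Rightarrow> real" where
  "heat_rate t x = ((x \<bullet> x) / (4 * t\<^sup>2) - real DIM('a) / (2 * t)) * heat_kernel t x"

lemma heat_kernel_nonneg [simp]: "0 \<le> heat_kernel t x"
  by (simp add: heat_kernel_def)

lemma continuous_on_heat_kernel [continuous_intros]: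
  fixes f :: "'b::topological_space \<Rightarrow> 'a::euclidean_space"
  shows "continuous_on S f \<Longrightarrow> continuous_on S (\<lambda>x. heat_kernel t (f x))"
  unfolding heat_kernel_def divide_inverse by (intro continuous_intros)

lemma heat_kernel_measurable [measurable]: "heat_kernel t \<in> borel_measurable borel"
  by (intro borel_measurable_continuous_onI continuous_intros)

lemma heat_rate_measurable [measurable]: "heat_rate t \<in> borel_measurable borel"
  unfolding heat_rate_def[abs_def] divide_inverse
  by (intro borel_measurable_continuous_onI continuous_intros)

lemma heat_kernel_le_max:
  assumes "0 < t" shows "heat_kernel t (x :: 'a::euclidean_space) \<le> (4 * pi * t) powr - (real DIM('a) / 2)"
  using assms unfolding heat_kernel_def by (intro mult_left_le) auto

lemma heat_kernel_le_0:
  assumes "0 < t" shows "heat_kernel t (x :: 'a::euclidean_space) \<le> heat_kernel t (0 :: 'a)"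
  using heat_kernel_le_max[OF assms, of x] by (simp add: heat_kernel_def)

lemma heat_kernel_eq_prod:
  assumes "0 < t"
  shows "heat_kernel t (x :: 'a::euclidean_space) = (\<Prod>b\<in>Basis. normal_density 0 (sqrt (2 * t)) (x \<bullet> b))"
proof -
  have "(\<Prod>b\<in>Basis. normal_density 0 (sqrt (2 * t)) (x \<bullet> b)) =
      (\<Prod>b\<in>(Basis::'a set). 1 / sqrt (4 * pi * t)) * (\<Prod>b\<in>Basis. exp (- ((x \<bullet> b)\<^sup>2 / (4 * t))))"
  proof -
    have "normal_density 0 (sqrt (2 * t)) y = 1 / sqrt (4 * pi * t) * exp (- (y\<^sup>2 / (4 * t)))" for y
      using assms by (simp add: normal_density_def ac_simps)
    then show ?thesis by (simp only: prod.distrib)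
  qed
  also have "(\<Prod>b\<in>(Basis::'a set). 1 / sqrt (4 * pi * t)) = (1 / sqrt (4 * pi * t)) ^ DIM('a)" by simp
  also have "\<dots> = (4 * pi * t) powr - (real DIM('a) / 2)"
  proof -
    have "1 / sqrt (4 * pi * t) = (4 * pi * t) powr - (1 / 2)"
      using assms by (simp add: powr_minus powr_half_sqrt inverse_eq_divide)
    then show ?thesis using assms by (simp add: powr_realpow[symmetric] powr_powr)
  qed
  also have "(\<Prod>b\<in>Basis. exp (- ((x \<bullet> b)\<^sup>2 / (4 * t)))) = exp (- (x \<bullet> x) / (4 * t))"
    by (subst exp_sum[symmetric])
      (simp_all add: sum_negf euclidean_inner[of x x] sum_divide_distrib power2_eq_square)
  finally show ?thesis by (simp add: heat_kernel_def)
qed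

lemma nn_integral_heat_kernel:
  assumes "0 < t" shows "(\<integral>\<^sup>+x. ennreal (heat_kernel t (x :: 'a::euclidean_space)) \<partial>lborel) = 1"
proof -
  let ?n = "normal_density 0 (sqrt (2 * t))"
  have "(\<integral>\<^sup>+x. ennreal (?n x) \<partial>lborel) = 1"
    using assms by (subst nn_integral_eq_integral) auto
  moreover have "(\<integral>\<^sup>+x. ennreal (heat_kernel t (x :: 'a)) \<partial>lborel) =
      (\<integral>\<^sup>+x. (\<Prod>b\<in>Basis. ennreal (?n (x \<bullet> b))) \<partial>(lborel :: 'a measure))"
    using assms by (simp add: heat_kernel_eq_prod prod_ennreal)
  ultimately show ?thesis by (subst (asm) nn_integral_lborel_prod) auto
qed

lemma heat_kernel_integral:
  assumes "0 < t"
  shows "integrable lborel (heat_kernel t :: 'a::euclidean_space \<Rightarrow> real)"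
    and "(\<integral>x. heat_kernel t (x :: 'a) \<partial>lborel) = 1"
  using nn_integral_heat_kernel[OF assms, where 'a = 'a]
  by (auto simp: integrable_iff_bounded integral_eq_nn_integral)

lemma lborel_reflect:
  fixes f :: "'a::euclidean_space \<Rightarrow> real"
  shows "(\<integral>z. f (v - z) \<partial>lborel) = (\<integral>z. f z \<partial>lborel)"
    and "integrable lborel f \<Longrightarrow> integrable lborel (\<lambda>z. f (v - z))"
proof -
  have L: "lborel = distr lborel borel (\<lambda>z. v - z :: 'a)"
    using lborel_affine[of "-1" v] by (simp add: density_1)
  show "integrable lborel (\<lambda>z. f (v - z))" if "integrable lborel f"
    using that L by (intro integrable_distr_eq[THEN iffD1, of "\<lambda>z. v - z" lborel borel f]) auto
  show "(\<integral>z. f (v - z) \<partial>lborel) = (\<integral>z. f z \<partial>lborel)"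
  proof (cases "f \<in> borel_measurable borel")
    case True
    then have "(\<integral>z. f z \<partial>distr lborel borel (\<lambda>z. v - z)) = (\<integral>z. f (v - z) \<partial>lborel)"
      by (intro integral_distr) auto
    then show ?thesis using L by simp
  next
    case False
    have "(\<lambda>z. f (v - z)) \<notin> borel_measurable borel"
    proof
      assume "(\<lambda>z. f (v - z)) \<in> borel_measurable borel"
      then have "(\<lambda>z. f (v - (v - z))) \<in> borel_measurable borel"
        by (rule measurable_compose[rotated]) auto
      then show False using False by simp
    qed
    then show ?thesis using False by (simp add: not_integrable_integral_eq integrable_iff_bounded)
  qed
qed

lemma heat_kernel_translate_integral:
  assumes "0 < t"
  shows "integrable lborel (\<lambda>z. heat_kernel t (v - z :: 'a::euclidean_space))"
    and "(\<integral>z. heat_kernel t (v - z :: 'a) \<partial>lborel) = 1"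
  using heat_kernel_integral[OF assms, where 'a = 'a] lborel_reflect[of "heat_kernel t" v] by auto

text \<open>
  Completing the square: with the midpoint \<open>m\<close> of \<open>x\<close> and \<open>y\<close>,
  \<open>\<bar>x - u\<bar>\<^sup>2 + \<bar>y - u\<bar>\<^sup>2 = \<bar>x - y\<bar>\<^sup>2 / 2 + 2 \<bar>m - u\<bar>\<^sup>2\<close>.
\<close>

lemma heat_kernel_semigroup:
  assumes "0 < t"
  shows "integrable lborel (\<lambda>u. heat_kernel t (x - u) * heat_kernel t (y - u :: 'a::euclidean_space))"
    and "(\<integral>u. heat_kernel t (x - u) * heat_kernel t (y - u) \<partial>lborel) = heat_kernel (2 * t) (x - y :: 'a)"
proof -
  define m where "m = (1/2) *\<^sub>R (x + y)"
  have eq: "heat_kernel t (x - u) * heat_kernel t (y - u) = heat_kernel (2 * t) (x - y) * heat_kernel (t / 2) (m - u)" for u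
  proof -
    have "(x - u) \<bullet> (x - u) = ((x - y) \<bullet> (x - y)) / 2 + 2 * ((m - u) \<bullet> (m - u)) - (y - u) \<bullet> (y - u)"
      by (simp add: m_def inner_diff_left inner_diff_right inner_add_left inner_add_right inner_commute field_simps)
    then have "- ((x - u) \<bullet> (x - u)) / (4 * t) + - ((y - u) \<bullet> (y - u)) / (4 * t)
        = - ((x - y) \<bullet> (x - y)) / (4 * (2 * t)) + - ((m - u) \<bullet> (m - u)) / (4 * (t / 2))"
      using assms by (simp only:) (simp add: field_simps)
    then have e: "exp (- ((x - u) \<bullet> (x - u)) / (4 * t)) * exp (- ((y - u) \<bullet> (y - u)) / (4 * t))
        = exp (- ((x - y) \<bullet> (x - y)) / (4 * (2 * t))) * exp (- ((m - u) \<bullet> (m - u)) / (4 * (t / 2)))"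
      by (simp only: exp_add[symmetric])
    have "(4 * pi * t) powr p * (4 * pi * t) powr p = (4 * pi * (2 * t)) powr p * (4 * pi * (t / 2)) powr p" for p
      using assms by (simp add: powr_mult[symmetric] ac_simps)
    from arg_cong2[OF this[of "- (real DIM('a) / 2)"] e, of "(*)"] show ?thesis
      unfolding heat_kernel_def by (simp only: ac_simps)
  qed
  have "0 < t / 2" using assms by simp
  note h = heat_kernel_translate_integral[OF this, of m]
  show "integrable lborel (\<lambda>u. heat_kernel t (x - u) * heat_kernel t (y - u))"
    unfolding eq by (intro integrable_mult_right h)
  show "(\<integral>u. heat_kernel t (x - u) * heat_kernel t (y - u) \<partial>lborel) = heat_kernel (2 * t) (x - y)"
    unfolding eq using h by simp
qed

lemma heat_kernel_time_derivative:
  assumes "0 < t"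
  shows "((\<lambda>t. heat_kernel t x) has_real_derivative heat_rate t x) (at t)"
proof -
  have "((\<lambda>t. (4 * pi * t) powr - (real DIM('a) / 2) * exp (- (x \<bullet> x) / (4 * t))) has_real_derivative
     (4 * pi * t) powr (- (real DIM('a) / 2) - 1) * (- (real DIM('a) / 2)) * (4 * pi) * exp (- (x \<bullet> x) / (4 * t))
     + (4 * pi * t) powr - (real DIM('a) / 2) * (exp (- (x \<bullet> x) / (4 * t)) * ((x \<bullet> x) / (4 * t\<^sup>2)))) (at t)"
    using assms
    by (auto intro!: derivative_eq_intros simp: field_simps power2_eq_square)
  moreover have "(4 * pi * t) powr (- (real DIM('a) / 2) - 1) = (4 * pi * t) powr - (real DIM('a) / 2) / (4 * pi * t)"
    using assms by (simp add: powr_diff)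
  ultimately show ?thesis
    unfolding heat_kernel_def heat_rate_def using assms
    by (elim DERIV_cong) (simp add: divide_simps, simp add: algebra_simps power2_eq_square)
qed

definition heat_gradient :: "real \<Rightarrow> 'a::euclidean_space \<Rightarrow> 'a" where
  "heat_gradient t x = - (heat_kernel t x / (2 * t)) *\<^sub>R x"

definition heat_hessian :: "real \<Rightarrow> 'a::euclidean_space \<Rightarrow> 'a \<Rightarrow> 'a" where
  "heat_hessian t x h = (heat_kernel t x * (x \<bullet> h) / (4 * t\<^sup>2)) *\<^sub>R x - (heat_kernel t x / (2 * t)) *\<^sub>R h"

lemma heat_kernel_has_derivative:
  "0 < t \<Longrightarrow> (heat_kernel t has_derivative (\<lambda>h. heat_gradient t x \<bullet> h)) (at x)"
  unfolding heat_kernel_def[abs_def] heat_gradient_def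
  by (auto intro!: derivative_eq_intros simp: inner_commute field_simps)

lemma heat_gradient_has_derivative:
  "0 < t \<Longrightarrow> (heat_gradient t has_derivative heat_hessian t x) (at x)"
  unfolding heat_gradient_def[abs_def] heat_hessian_def[abs_def]
  by (auto intro!: derivative_eq_intros heat_kernel_has_derivative
      simp: heat_gradient_def field_simps power2_eq_square)

text \<open>
  Together with the time derivative above, this is the heat equation.
\<close>

lemma trace_heat_hessian:
  assumes "0 < t" shows "(\<Sum>e\<in>Basis. heat_hessian t x e \<bullet> e) = heat_rate t (x :: 'a::euclidean_space)"
proof -
  have "heat_hessian t x e \<bullet> e = heat_kernel t x / (4 * t\<^sup>2) * ((x \<bullet> e) * (x \<bullet> e)) - heat_kernel t x / (2 * t)"
    if "e \<in> Basis" for e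
    using that by (simp add: heat_hessian_def inner_diff_left)
  then have "(\<Sum>e\<in>Basis. heat_hessian t x e \<bullet> e) = heat_kernel t x / (4 * t\<^sup>2) * (\<Sum>e\<in>Basis. (x \<bullet> e) * (x \<bullet> e))
      - (\<Sum>e\<in>(Basis::'a set). heat_kernel t x / (2 * t))"
    by (simp add: sum_subtractf sum_distrib_left)
  then show ?thesis
    by (simp add: euclidean_inner[of x x, symmetric] heat_rate_def field_simps)
qed

lemma continuous_on_heat_gradient [continuous_intros]:
  fixes f :: "'b::topological_space \<Rightarrow> 'a::euclidean_space"
  shows "continuous_on S f \<Longrightarrow> continuous_on S (\<lambda>x. heat_gradient t (f x))"
  unfolding heat_gradient_def divide_inverse by (intro continuous_intros)

lemma continuous_on_heat_hessian [continuous_intros]: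
  fixes f :: "'b::topological_space \<Rightarrow> 'a::euclidean_space"
  shows "continuous_on S f \<Longrightarrow> continuous_on S (\<lambda>x. heat_hessian t (f x) h)"
  unfolding heat_hessian_def divide_inverse by (intro continuous_intros)

lemma power_exp_minus_bound: "0 \<le> y \<Longrightarrow> y ^ k * exp (- y) \<le> fact k" for y :: real
proof -
  assume y: "0 \<le> y"
  have "y ^ k / fact k = sum (\<lambda>n. y ^ n / fact n) {k}" by simp
  also have "\<dots> \<le> (\<Sum>n. y ^ n / fact n)"
    using y summable_exp[of y] by (intro sum_le_suminf) (auto simp: field_simps)
  also have "\<dots> = exp y" by (simp add: exp_def divide_inverse scaleR_conv_of_real mult.commute)
  finally show ?thesis by (simp add: exp_minus field_simps)
qed

lemma heat_kernel_moment_bound: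
  assumes "0 < t"
  shows "\<exists>C. \<forall>x :: 'a::euclidean_space. norm x ^ k * heat_kernel t x \<le> C"
proof -
  let ?c = "(4 * pi * t) powr - (real DIM('a) / 2)"
  have "norm x ^ k * heat_kernel t x \<le> ?c + (4 * t) ^ k * fact k * ?c" for x :: 'a
  proof -
    define y where "y = (x \<bullet> x) / (4 * t)"
    have y: "0 \<le> y" "(norm x)\<^sup>2 = 4 * t * y" using assms by (auto simp: y_def power2_norm_eq_inner)
    have "norm x ^ k \<le> 1 + (norm x ^ k)\<^sup>2"
    proof -
      have "0 \<le> (norm x ^ k - 1)\<^sup>2" "0 \<le> norm x ^ k" by simp_all
      then show ?thesis unfolding power2_diff one_power2 by linarith
    qed
    moreover have "(norm x ^ k)\<^sup>2 = ((norm x)\<^sup>2) ^ k" by (metis power_mult mult.commute)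
    then have "(norm x ^ k)\<^sup>2 = (4 * t) ^ k * y ^ k" by (simp only: y(2) power_mult_distrib)
    ultimately have k: "norm x ^ k \<le> 1 + (4 * t) ^ k * y ^ k" by linarith
    have h: "heat_kernel t x = ?c * exp (- y)" by (simp add: heat_kernel_def y_def)
    have "norm x ^ k * heat_kernel t x \<le> (1 + (4 * t) ^ k * y ^ k) * heat_kernel t x"
      using k by (intro mult_right_mono) auto
    also have "\<dots> = heat_kernel t x + (4 * t) ^ k * ?c * (y ^ k * exp (- y))" by (simp add: h algebra_simps)
    also have "\<dots> \<le> ?c + (4 * t) ^ k * ?c * fact k"
      using assms y heat_kernel_le_max[OF assms, of x] power_exp_minus_bound[OF y(1), of k]
      by (intro add_mono mult_left_mono) auto
    finally show ?thesis by (simp add: ac_simps)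
  qed
  then show ?thesis by blast
qed

text \<open>
  The polynomial factor is absorbed by passing to a wider Gaussian, uniformly for times comparable to
  \<open>t\<close>. This is the dominating function for differentiation in time.
\<close>

lemma heat_rate_dominated:
  assumes "0 < t"
  shows "\<exists>C>0. \<forall>s\<in>{t/2..2*t}. \<forall>x :: 'a::euclidean_space. \<bar>heat_rate s x\<bar> \<le> C * heat_kernel (4 * t) x"
proof -
  let ?d = "real DIM('a)"
  define c where "c = (4 * pi * (t/2)) powr - (?d / 2)"
  define c' where "c' = (4 * pi * (4 * t)) powr - (?d / 2)"
  have pos: "0 < c" "0 < c'" using assms by (auto simp: c_def c'_def)
  have "\<bar>heat_rate s x\<bar> \<le> ((16 + ?d) / t * (c / c')) * heat_kernel (4 * t) x"
    if s: "s \<in> {t/2..2*t}" for s and x :: 'a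
  proof -
    define y where "y = (x \<bullet> x) / (16 * t)"
    have y: "0 \<le> y" "x \<bullet> x = 16 * t * y" using assms by (auto simp: y_def)
    have s0: "0 < s" using s assms by auto
    have "x \<bullet> x / (4 * s\<^sup>2) \<le> 16 * y / t"
    proof -
      have "(t/2)\<^sup>2 \<le> s\<^sup>2" using s assms by (intro power_mono) auto
      then have "x \<bullet> x / (4 * s\<^sup>2) \<le> x \<bullet> x / (4 * (t/2)\<^sup>2)"
        using assms s0 by (intro divide_left_mono) auto
      then show ?thesis using assms by (simp add: y(2) power2_eq_square)
    qed
    moreover have "?d / (2 * s) \<le> ?d / t" using s assms s0 by (intro divide_left_mono) auto
    ultimately have 1: "\<bar>x \<bullet> x / (4 * s\<^sup>2) - ?d / (2 * s)\<bar> \<le> 16 * y / t + ?d / t"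
    proof -
      have "0 \<le> x \<bullet> x / (4 * s\<^sup>2)" "0 \<le> ?d / (2 * s)" using s0 by simp_all
      with \<open>x \<bullet> x / (4 * s\<^sup>2) \<le> 16 * y / t\<close> \<open>?d / (2 * s) \<le> ?d / t\<close> show ?thesis by linarith
    qed
    have 2: "heat_kernel s x \<le> c * exp (- (2 * y))"
    proof -
      have "(4 * pi * s) powr - (?d / 2) \<le> c" unfolding c_def
        using s assms by (intro powr_mono2') auto
      moreover have "exp (- (x \<bullet> x) / (4 * s)) \<le> exp (- (2 * y))"
      proof -
        have "x \<bullet> x / (8 * t) \<le> x \<bullet> x / (4 * s)"
          using s s0 assms by (intro divide_left_mono) auto
        then show ?thesis using assms by (simp add: y_def)
      qed
      ultimately show ?thesis unfolding heat_kernel_def using pos by (intro mult_mono) auto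
    qed
    have 3: "(16 * y / t + ?d / t) * exp (- (2 * y)) \<le> (16 + ?d) / t * exp (- y)"
    proof -
      have "y * exp (- y) \<le> 1" using power_exp_minus_bound[OF y(1), of 1] by simp
      moreover have "exp (- y) \<le> 1" using y by simp
      ultimately have "16 * (y * exp (- y)) + ?d * exp (- y) \<le> 16 * 1 + ?d * 1"
        by (intro add_mono mult_left_mono) auto
      then have "(16 * y + ?d) * exp (- y) / t * exp (- y) \<le> (16 + ?d) / t * exp (- y)"
        using assms by (intro mult_right_mono divide_right_mono) (auto simp: algebra_simps)
      moreover have "exp (- (2 * y)) = exp (- y) * exp (- y)" by (simp add: exp_add[symmetric])
      ultimately show ?thesis using assms by (simp add: field_simps)
    qed
    have "\<bar>heat_rate s x\<bar> = \<bar>x \<bullet> x / (4 * s\<^sup>2) - ?d / (2 * s)\<bar> * heat_kernel s x"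
      by (simp add: heat_rate_def abs_mult)
    also have "\<dots> \<le> (16 * y / t + ?d / t) * (c * exp (- (2 * y)))"
      using 1 2 y assms by (intro mult_mono) auto
    also have "\<dots> \<le> c * ((16 + ?d) / t * exp (- y))"
      using mult_left_mono[OF 3, of c] pos by (simp add: ac_simps)
    also have "exp (- y) = heat_kernel (4 * t) x / c'"
      using pos by (simp add: heat_kernel_def c'_def y_def)
    finally show ?thesis by (simp add: ac_simps)
  qed
  moreover have "0 < (16 + ?d) / t * (c / c')" using pos assms by (intro mult_pos_pos divide_pos_pos) auto
  ultimately show ?thesis by blast
qed

section \<open>Second differences of the heat kernel\<close>

lemma DERIV_integral_dominated:
  fixes f :: "real \<Rightarrow> 'b \<Rightarrow> real"
  assumes t: "a < t" "t < b"
    and int: "\<And>s. s \<in> {a..b} \<Longrightarrow> integrable M (f s)"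
    and der: "\<And>x. x \<in> space M \<Longrightarrow> ((\<lambda>s. f s x) has_real_derivative f' x) (at t)"
    and meas: "f' \<in> borel_measurable M"
    and lip: "\<And>s x. s \<in> {a..b} \<Longrightarrow> x \<in> space M \<Longrightarrow> \<bar>f s x - f t x\<bar> \<le> B x * \<bar>s - t\<bar>"
    and B: "integrable M B"
  shows "((\<lambda>s. \<integral>x. f s x \<partial>M) has_real_derivative (\<integral>x. f' x \<partial>M)) (at t)"
proof -
  have "((\<lambda>s. ((\<integral>x. f s x \<partial>M) - (\<integral>x. f t x \<partial>M)) / (s - t)) \<longlongrightarrow> (\<integral>x. f' x \<partial>M)) (at t within {a..b})"
    unfolding tendsto_at_iff_sequentially
  proof (intro allI impI)
    fix X :: "nat \<Rightarrow> real" assume X: "\<forall>i. X i \<in> {a..b} - {t}" "X \<longlonglongrightarrow> t"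
    have "(\<lambda>i. \<integral>x. (f (X i) x - f t x) / (X i - t) \<partial>M) \<longlonglongrightarrow> (\<integral>x. f' x \<partial>M)"
    proof (rule integral_dominated_convergence[OF meas _ B])
      show "(\<lambda>x. (f (X i) x - f t x) / (X i - t)) \<in> borel_measurable M" for i
        using int[of "X i"] int[of t] X(1) t by auto
      show "AE x in M. (\<lambda>i. (f (X i) x - f t x) / (X i - t)) \<longlonglongrightarrow> f' x"
      proof (intro AE_I2)
        fix x assume "x \<in> space M"
        from der[OF this] have "((\<lambda>s. (f s x - f t x) / (s - t)) \<longlongrightarrow> f' x) (at t)"
          by (simp add: has_field_derivative_iff)
        then show "(\<lambda>i. (f (X i) x - f t x) / (X i - t)) \<longlonglongrightarrow> f' x"
          using X by (auto simp: tendsto_at_iff_sequentially comp_def)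
      qed
      show "AE x in M. norm ((f (X i) x - f t x) / (X i - t)) \<le> B x" for i
      proof (intro AE_I2)
        fix x assume "x \<in> space M"
        then show "norm ((f (X i) x - f t x) / (X i - t)) \<le> B x"
          using lip[of "X i" x] X(1) by (auto simp: abs_divide divide_le_eq)
      qed
    qed
    moreover have "(\<integral>x. (f (X i) x - f t x) / (X i - t) \<partial>M)
        = ((\<integral>x. f (X i) x \<partial>M) - (\<integral>x. f t x \<partial>M)) / (X i - t)" for i
    proof -
      have "X i \<in> {a..b}" "X i \<noteq> t" "t \<in> {a..b}" using X(1) t by auto
      then show ?thesis using int[of "X i"] int[of t] by simp
    qed
    ultimately show "((\<lambda>s. ((\<integral>x. f s x \<partial>M) - (\<integral>x. f t x \<partial>M)) / (s - t)) \<circ> X) \<longlonglongrightarrow> (\<integral>x. f' x \<partial>M)"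
      by (simp only: comp_def)
  qed
  then show ?thesis
    using t by (simp add: has_field_derivative_iff at_within_Icc_at)
qed

lemma heat_kernel_lipschitz_in_time:
  assumes "0 < t"
  shows "\<exists>C>0. \<forall>s\<in>{t/2..2*t}. \<forall>x :: 'a::euclidean_space.
    \<bar>heat_kernel s x - heat_kernel t x\<bar> \<le> C * heat_kernel (4 * t) x * \<bar>s - t\<bar>"
proof -
  obtain C where C: "C > 0" "\<And>s x. s \<in> {t/2..2*t} \<Longrightarrow> \<bar>heat_rate s (x :: 'a)\<bar> \<le> C * heat_kernel (4 * t) x"
    using heat_rate_dominated[OF assms, where 'a = 'a] by blast
  have "\<bar>heat_kernel s x - heat_kernel t x\<bar> \<le> C * heat_kernel (4 * t) x * \<bar>s - t\<bar>"
    if "s \<in> {t/2..2*t}" for s and x :: 'a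
  proof -
    have "norm (heat_kernel s x - heat_kernel t x) \<le> (C * heat_kernel (4 * t) x) * norm (s - t)"
    proof (rule field_differentiable_bound[where S = "{t/2..2*t}" and f' = "\<lambda>s. heat_rate s x"])
      show "((\<lambda>s. heat_kernel s x) has_field_derivative heat_rate s x) (at s within {t/2..2*t})"
        if "s \<in> {t/2..2*t}" for s
        using that assms heat_kernel_time_derivative[of s x] by (auto intro: has_field_derivative_at_within)
    qed (use that C assms in auto)
    then show ?thesis by simp
  qed
  with C show ?thesis by blast
qed

lemma heat_gradient_moment_bound:
  assumes "0 < t"
  shows "\<exists>C. \<forall>x :: 'a::euclidean_space. norm x ^ k * norm (heat_gradient t x) \<le> C"
proof -
  obtain C where C: "\<And>x::'a. norm x ^ Suc k * heat_kernel t x \<le> C"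
    using heat_kernel_moment_bound[OF assms] by blast
  have "norm x ^ k * norm (heat_gradient t x) \<le> C / (2 * t)" for x :: 'a
    using divide_right_mono[OF C[of x], of "2 * t"] assms by (simp add: heat_gradient_def mult_ac)
  then show ?thesis by blast
qed

lemma heat_rate_moment_bound:
  assumes "0 < t"
  shows "\<exists>C. \<forall>x :: 'a::euclidean_space. norm x ^ k * \<bar>heat_rate t x\<bar> \<le> C"
proof -
  obtain A where A: "A > 0" "\<And>x::'a. \<bar>heat_rate t x\<bar> \<le> A * heat_kernel (4 * t) x"
    using heat_rate_dominated[OF assms, where 'a = 'a] assms by fastforce
  obtain C where C: "\<And>x::'a. norm x ^ k * heat_kernel (4 * t) x \<le> C"
    using heat_kernel_moment_bound[of "4 * t"] assms by auto
  have "norm x ^ k * \<bar>heat_rate t x\<bar> \<le> A * C" for x :: 'a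
  proof -
    have "norm x ^ k * \<bar>heat_rate t x\<bar> \<le> norm x ^ k * (A * heat_kernel (4 * t) x)"
      using A by (intro mult_left_mono) auto
    also have "\<dots> \<le> A * C" using mult_left_mono[OF C[of x], of A] A by (simp add: mult_ac)
    finally show ?thesis .
  qed
  then show ?thesis by blast
qed

lemma heat_gradient_lipschitz:
  assumes "0 < t"
  shows "\<exists>L\<ge>0. \<forall>x y :: 'a::euclidean_space. norm (heat_gradient t x - heat_gradient t y) \<le> L * norm (x - y)"
proof -
  obtain C0 C2 where C: "\<And>x::'a. norm x ^ 0 * heat_kernel t x \<le> C0" "\<And>x::'a. norm x ^ 2 * heat_kernel t x \<le> C2"
    using heat_kernel_moment_bound[OF assms] by metis
  define L where "L = C2 / (4 * t\<^sup>2) + C0 / (2 * t)"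
  have on: "onorm (heat_hessian t x) \<le> L" for x :: 'a
  proof (rule onorm_le)
    fix h :: 'a
    have "norm (heat_hessian t x h) \<le> heat_kernel t x * \<bar>x \<bullet> h\<bar> / (4 * t\<^sup>2) * norm x + heat_kernel t x / (2 * t) * norm h"
      unfolding heat_hessian_def using assms
      by (intro order_trans[OF norm_triangle_ineq4] add_mono) (auto simp: abs_mult)
    also have "heat_kernel t x * \<bar>x \<bullet> h\<bar> / (4 * t\<^sup>2) * norm x \<le> heat_kernel t x * (norm x * norm h) / (4 * t\<^sup>2) * norm x"
      by (intro mult_right_mono divide_right_mono mult_left_mono Cauchy_Schwarz_ineq2) auto
    also have "\<dots> = (norm x ^ 2 * heat_kernel t x) / (4 * t\<^sup>2) * norm h" by (simp add: power2_eq_square)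
    also have "\<dots> \<le> C2 / (4 * t\<^sup>2) * norm h" by (intro mult_right_mono divide_right_mono C) auto
    also have "heat_kernel t x / (2 * t) * norm h \<le> C0 / (2 * t) * norm h"
      using C(1)[of x] assms by (intro mult_right_mono divide_right_mono) auto
    finally show "norm (heat_hessian t x h) \<le> L * norm h" by (simp add: L_def distrib_right)
  qed
  have "0 \<le> L" using onorm_pos_le[OF has_derivative_bounded_linear[OF heat_gradient_has_derivative[OF assms, of "0::'a"]]] on[of 0]
    by linarith
  moreover have "norm (heat_gradient t x - heat_gradient t y) \<le> L * norm (x - y)" for x y :: 'a
    by (rule differentiable_bound[where S = UNIV and f' = "heat_hessian t"])
      (use heat_gradient_has_derivative[OF assms] on in auto)
  ultimately show ?thesis by blast
qed

text \<open>
  The test function for Green's identity. It is even in \<open>z\<close>, its Laplacian is the even part of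
  \<open>z \<mapsto> \<Delta>p\<^sub>t(v - z)\<close>, and it vanishes to second order at \<open>z = 0\<close>.
\<close>

definition heat_diff :: "real \<Rightarrow> 'a::euclidean_space \<Rightarrow> 'a \<Rightarrow> real" where
  "heat_diff t v z = (heat_kernel t (v - z) + heat_kernel t (v + z)) / 2 - heat_kernel t v"

definition heat_diff_gradient :: "real \<Rightarrow> 'a::euclidean_space \<Rightarrow> 'a \<Rightarrow> 'a" where
  "heat_diff_gradient t v z = (1/2) *\<^sub>R (heat_gradient t (v + z) - heat_gradient t (v - z))"

definition heat_diff_hessian :: "real \<Rightarrow> 'a::euclidean_space \<Rightarrow> 'a \<Rightarrow> 'a \<Rightarrow> 'a" where
  "heat_diff_hessian t v z h = (1/2) *\<^sub>R (heat_hessian t (v + z) h + heat_hessian t (v - z) h)"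

lemma heat_diff_has_derivative:
  assumes "0 < t"
  shows "(heat_diff t v has_derivative (\<lambda>h. heat_diff_gradient t v z \<bullet> h)) (at z)"
proof -
  have plus: "((\<lambda>z. v + z) has_derivative (\<lambda>h. h)) (at z)"
    and minus: "((\<lambda>z. v - z) has_derivative (\<lambda>h. - h)) (at z)"
    by (auto intro!: derivative_eq_intros)
  have "((\<lambda>z. heat_kernel t (v + z)) has_derivative (\<lambda>h. heat_gradient t (v + z) \<bullet> h)) (at z)"
    by (rule has_derivative_compose[OF plus heat_kernel_has_derivative[OF assms]])
  moreover have "((\<lambda>z. heat_kernel t (v - z)) has_derivative (\<lambda>h. heat_gradient t (v - z) \<bullet> (- h))) (at z)"
    by (rule has_derivative_compose[OF minus heat_kernel_has_derivative[OF assms]])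
  ultimately show ?thesis
    unfolding heat_diff_def[abs_def] heat_diff_gradient_def
    by (auto intro!: derivative_eq_intros simp: inner_diff_left field_simps)
qed

lemma heat_diff_gradient_has_derivative:
  assumes "0 < t"
  shows "(heat_diff_gradient t v has_derivative heat_diff_hessian t v z) (at z)"
proof -
  have plus: "((\<lambda>z. v + z) has_derivative (\<lambda>h. h)) (at z)"
    and minus: "((\<lambda>z. v - z) has_derivative (\<lambda>h. - h)) (at z)"
    by (auto intro!: derivative_eq_intros)
  have "((\<lambda>z. heat_gradient t (v + z)) has_derivative heat_hessian t (v + z)) (at z)"
    by (rule has_derivative_compose[OF plus heat_gradient_has_derivative[OF assms]])
  moreover have "((\<lambda>z. heat_gradient t (v - z)) has_derivative (\<lambda>h. heat_hessian t (v - z) (- h))) (at z)"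
    by (rule has_derivative_compose[OF minus heat_gradient_has_derivative[OF assms]])
  moreover have "heat_hessian t x (- h) = - heat_hessian t x h" for x h :: 'a
    by (simp add: heat_hessian_def)
  ultimately show ?thesis
    unfolding heat_diff_gradient_def[abs_def] heat_diff_hessian_def[abs_def]
    by (auto intro!: derivative_eq_intros)
qed

lemma trace_heat_diff_hessian:
  assumes "0 < t"
  shows "(\<Sum>e\<in>Basis. heat_diff_hessian t v z e \<bullet> e) = (heat_rate t (v + z) + heat_rate t (v - z)) / 2"
proof -
  have "(\<Sum>e\<in>Basis. heat_diff_hessian t v z e \<bullet> e) =
      (1/2) * ((\<Sum>e\<in>Basis. heat_hessian t (v + z) e \<bullet> e) + (\<Sum>e\<in>Basis. heat_hessian t (v - z) e \<bullet> e))"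
    by (simp add: heat_diff_hessian_def inner_add_left sum.distrib sum_divide_distrib[symmetric])
  then show ?thesis by (simp add: trace_heat_hessian[OF assms])
qed

text \<open>
  The form in which a bound near the origin and a bound at infinity are combined.
\<close>

lemma le_max_times_min:
  fixes x :: real
  assumes "x \<le> A * y" "x \<le> B" "0 \<le> y" shows "x \<le> max A B * min 1 y"
proof (cases "y \<le> 1")
  case True
  then show ?thesis using assms mult_right_mono[of A "max A B" y] by (simp add: min_absorb2)
qed (use assms in auto)

lemma heat_diff_gradient_le:
  assumes L: "\<And>x y :: 'a::euclidean_space. norm (heat_gradient t x - heat_gradient t y) \<le> L * norm (x - y)"
  shows "norm (heat_diff_gradient t v z) \<le> L * norm (z :: 'a)"
proof -
  have "norm (heat_diff_gradient t v z) = (1/2) * norm (heat_gradient t (v + z) - heat_gradient t (v - z))"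
    by (simp add: heat_diff_gradient_def)
  also have "\<dots> \<le> (1/2) * (L * norm ((v + z) - (v - z)))" by (rule mult_left_mono[OF L]) simp
  also have "(v + z) - (v - z) = 2 *\<^sub>R z" by (simp add: scaleR_2)
  finally show ?thesis by simp
qed

text \<open>
  Near the origin the gradient of \<open>heat_diff t v\<close> is Lipschitz and vanishes at 0. The constant does not
  depend on \<open>v\<close>, which makes the later integration over \<open>v = x - y\<close> possible.
\<close>

lemma heat_diff_bound:
  assumes "0 < t"
  shows "\<exists>A. \<forall>v z :: 'a::euclidean_space. \<bar>heat_diff t v z\<bar> \<le> A * min 1 (z \<bullet> z)"
proof -
  obtain L where L: "L \<ge> 0" "\<And>x y :: 'a. norm (heat_gradient t x - heat_gradient t y) \<le> L * norm (x - y)"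
    using heat_gradient_lipschitz[OF assms] by blast
  let ?m = "heat_kernel t (0::'a)"
  have "\<bar>heat_diff t v z\<bar> \<le> max L ?m * min 1 (z \<bullet> z)" for v z :: 'a
  proof -
    have a: "\<bar>heat_diff t v z\<bar> \<le> ?m"
    proof -
      have "heat_kernel t (v - z) \<le> ?m" "heat_kernel t (v + z) \<le> ?m" "heat_kernel t v \<le> ?m"
        "0 \<le> heat_kernel t (v - z)" "0 \<le> heat_kernel t (v + z)" "0 \<le> heat_kernel t v"
        using heat_kernel_le_0[OF assms] by auto
      moreover have "\<bar>(a + b) / 2 - c\<bar> \<le> m"
        if "a \<le> m" "b \<le> m" "c \<le> m" "0 \<le> a" "0 \<le> b" "0 \<le> c" for a b c m :: real
        using that by (auto simp: abs_le_iff field_simps)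
      ultimately show ?thesis unfolding heat_diff_def by blast
    qed
    have b: "\<bar>heat_diff t v z\<bar> \<le> L * (z \<bullet> z)"
    proof -
      have "norm (heat_diff t v z - heat_diff t v 0) \<le> (L * norm z) * norm (z - 0)"
      proof (rule differentiable_bound[where S = "cball 0 (norm z)" and f' = "\<lambda>z h. heat_diff_gradient t v z \<bullet> h"])
        fix x :: 'a assume x: "x \<in> cball 0 (norm z)"
        show "(heat_diff t v has_derivative (\<lambda>h. heat_diff_gradient t v x \<bullet> h)) (at x within cball 0 (norm z))"
          using heat_diff_has_derivative[OF assms] by (rule has_derivative_at_withinI)
        have "norm (heat_diff_gradient t v x) \<le> L * norm z"
          using heat_diff_gradient_le[OF L(2), of v x] mult_left_mono[of "norm x" "norm z" L] L(1) x by simp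
        then show "onorm ((\<bullet>) (heat_diff_gradient t v x)) \<le> L * norm z"
          by (intro onorm_le) (auto intro!: order_trans[OF Cauchy_Schwarz_ineq2] mult_right_mono)
      qed auto
      then show ?thesis by (simp add: heat_diff_def power2_norm_eq_inner[symmetric] power2_eq_square mult.assoc)
    qed
    show ?thesis using le_max_times_min[OF b a] by simp
  qed
  then show ?thesis by blast
qed

text \<open>
  Here and in the next lemma the constant depends on \<open>v\<close>: the Gaussians are centred at \<open>\<plusminus>v\<close>, and
  \<open>norm z \<le> norm (v \<plusminus> z) + norm v\<close>.
\<close>

lemma heat_diff_gradient_bound:
  assumes "0 < t"
  shows "\<exists>A. \<forall>z :: 'a::euclidean_space. norm (heat_diff_gradient t v z) * norm z \<le> A * min 1 (z \<bullet> z)"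
proof -
  obtain L where L: "L \<ge> 0" "\<And>x y :: 'a. norm (heat_gradient t x - heat_gradient t y) \<le> L * norm (x - y)"
    using heat_gradient_lipschitz[OF assms] by blast
  obtain C0 C1 where C: "\<And>x::'a. norm x ^ 0 * norm (heat_gradient t x) \<le> C0" "\<And>x::'a. norm x ^ 1 * norm (heat_gradient t x) \<le> C1"
    using heat_gradient_moment_bound[OF assms] by metis
  define A where "A = C1 + C0 * norm v"
  have part: "norm (heat_gradient t x) * norm z \<le> A" if "norm z \<le> norm x + norm v" for x z :: 'a
  proof -
    have "norm (heat_gradient t x) * norm z \<le> norm (heat_gradient t x) * (norm x + norm v)"
      using that by (intro mult_left_mono) auto
    also have "\<dots> = norm x * norm (heat_gradient t x) + norm (heat_gradient t x) * norm v" by (simp add: algebra_simps)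
    also have "\<dots> \<le> A" unfolding A_def using C(1)[of x] C(2)[of x] by (intro add_mono mult_right_mono) auto
    finally show ?thesis .
  qed
  have "norm (heat_diff_gradient t v z) * norm z \<le> max L A * min 1 (z \<bullet> z)" for z
  proof -
    have "norm (heat_diff_gradient t v z) \<le> (norm (heat_gradient t (v + z)) + norm (heat_gradient t (v - z))) / 2"
      unfolding heat_diff_gradient_def using norm_triangle_ineq4 by simp
    then have "norm (heat_diff_gradient t v z) * norm z \<le>
        (norm (heat_gradient t (v + z)) * norm z + norm (heat_gradient t (v - z)) * norm z) / 2"
      using mult_right_mono[of _ _ "norm z"] by (fastforce simp: distrib_right)
    also have "\<dots> \<le> (A + A) / 2"
    proof -
      have "norm z \<le> norm (v + z) + norm v" using norm_triangle_ineq4[of "v + z" v] by simp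
      moreover have "norm z \<le> norm (v - z) + norm v" using norm_triangle_ineq4[of v "v - z"] by simp
      ultimately show ?thesis by (intro divide_right_mono add_mono part) auto
    qed
    finally have a: "norm (heat_diff_gradient t v z) * norm z \<le> A" by simp
    have b: "norm (heat_diff_gradient t v z) * norm z \<le> L * (z \<bullet> z)"
      using mult_right_mono[OF heat_diff_gradient_le[OF L(2), of v z], of "norm z"]
      by (simp add: power2_norm_eq_inner[symmetric] power2_eq_square mult.assoc)
    show ?thesis using le_max_times_min[OF b a] by simp
  qed
  then show ?thesis by blast
qed

lemma heat_diff_laplacian_bound:
  assumes "0 < t"
  shows "\<exists>A. \<forall>z :: 'a::euclidean_space. \<bar>(heat_rate t (v + z) + heat_rate t (v - z)) / 2\<bar> * (z \<bullet> z) \<le> A * min 1 (z \<bullet> z)"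
proof -
  obtain C0 C2 where C: "\<And>x::'a. norm x ^ 0 * \<bar>heat_rate t x\<bar> \<le> C0" "\<And>x::'a. norm x ^ 2 * \<bar>heat_rate t x\<bar> \<le> C2"
    using heat_rate_moment_bound[OF assms] by metis
  define A where "A = 2 * C2 + 2 * C0 * (v \<bullet> v)"
  have part: "\<bar>heat_rate t x\<bar> * (z \<bullet> z) \<le> A" if "z = x - v \<or> z = v - x" for x z :: 'a
  proof -
    have "(x + v) \<bullet> (x + v) \<ge> 0" by simp
    then have "z \<bullet> z \<le> 2 * (x \<bullet> x) + 2 * (v \<bullet> v)"
      using that by (auto simp: inner_diff_left inner_diff_right inner_add_left inner_add_right inner_commute)
    then have "\<bar>heat_rate t x\<bar> * (z \<bullet> z) \<le> \<bar>heat_rate t x\<bar> * (2 * (x \<bullet> x) + 2 * (v \<bullet> v))"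
      by (intro mult_left_mono) auto
    also have "\<dots> = 2 * (norm x ^ 2 * \<bar>heat_rate t x\<bar>) + 2 * \<bar>heat_rate t x\<bar> * (v \<bullet> v)"
      by (simp add: power2_norm_eq_inner algebra_simps)
    also have "\<dots> \<le> A" unfolding A_def using C(1)[of x] C(2)[of x] by (intro add_mono mult_right_mono mult_left_mono) auto
    finally show ?thesis .
  qed
  have "\<bar>(heat_rate t (v + z) + heat_rate t (v - z)) / 2\<bar> * (z \<bullet> z) \<le> max C0 A * min 1 (z \<bullet> z)" for z
  proof -
    let ?r = "\<bar>(heat_rate t (v + z) + heat_rate t (v - z)) / 2\<bar>"
    have r: "?r \<le> (\<bar>heat_rate t (v + z)\<bar> + \<bar>heat_rate t (v - z)\<bar>) / 2" by simp
    from mult_right_mono[OF this, of "z \<bullet> z"]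
    have "?r * (z \<bullet> z) \<le> (\<bar>heat_rate t (v + z)\<bar> * (z \<bullet> z) + \<bar>heat_rate t (v - z)\<bar> * (z \<bullet> z)) / 2"
      by (simp add: algebra_simps)
    also have "\<dots> \<le> (A + A) / 2" by (intro divide_right_mono add_mono part) auto
    finally have a: "?r * (z \<bullet> z) \<le> A" by simp
    have "?r \<le> C0" using r C(1)[of "v + z"] C(1)[of "v - z"] by simp
    then have b: "?r * (z \<bullet> z) \<le> C0 * (z \<bullet> z)" by (intro mult_right_mono) auto
    show ?thesis using le_max_times_min[OF b a] by simp
  qed
  then show ?thesis by blast
qed

section \<open>Potentials with a singularity at the origin\<close>

text \<open>
  Layer cake: the superlevel sets of \<open>z \<mapsto> p\<^sub>t(v - z)\<close> are balls around \<open>v\<close>, so a Gaussian average is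
  an average of ball averages.
\<close>

lemma heat_average_le_ball_averages:
  fixes f :: "'a::euclidean_space \<Rightarrow> ennreal"
  assumes [measurable]: "f \<in> borel_measurable borel" and t: "0 < t"
    and ball: "\<And>r. 0 < r \<Longrightarrow> (\<integral>\<^sup>+z. f z * indicator (ball v r) z \<partial>lborel) \<le> K * emeasure lborel (ball v r)"
  shows "(\<integral>\<^sup>+z. f z * ennreal (heat_kernel t (v - z)) \<partial>lborel) \<le> K"
proof -
  let ?p = "\<lambda>z. heat_kernel t (v - z)"
  let ?c = "(4 * pi * t) powr - (real DIM('a) / 2)"
  have c: "0 < ?c" using t by simp
  define S where "S u = {z. u < ?p z}" for u
  have cont: "continuous_on UNIV ?p" by (intro continuous_intros)
  have S: "S u \<in> sets borel" for u
    unfolding S_def using cont by (intro borel_open open_Collect_less continuous_on_const)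
  have lc: "ennreal (?p z) = (\<integral>\<^sup>+u. indicator {0<..} u * indicator (S u) z \<partial>lborel)" for z
  proof -
    have "(\<integral>\<^sup>+u. indicator {0<..} u * indicator (S u) z \<partial>lborel) = (\<integral>\<^sup>+u. indicator {0<..<?p z} u \<partial>lborel)"
      by (intro nn_integral_cong) (auto simp: S_def indicator_def)
    then show ?thesis by simp
  qed
  have level: "(\<integral>\<^sup>+z. f z * indicator (S u) z \<partial>lborel) \<le> K * emeasure lborel (S u)" if u: "0 < u" for u
  proof (cases "u < ?c")
    case True
    \<comment> \<open>Solve \<open>p\<^sub>t(y) = u\<close> for \<open>norm y\<close>.\<close>
    define r where "r = sqrt (4 * t * ln (?c / u))"
    have "1 < ?c / u" using True u by (simp only: less_divide_eq_1_pos)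
    then have ln: "0 < ln (?c / u)" by simp
    then have r: "0 < r" "r\<^sup>2 = 4 * t * ln (?c / u)" using t by (auto simp: r_def)
    have "S u = ball v r"
    proof (intro set_eqI)
      fix z
      have "u < ?p z \<longleftrightarrow> u / ?c < exp (- ((v - z) \<bullet> (v - z)) / (4 * t))"
        using c by (simp add: heat_kernel_def field_simps)
      also have "\<dots> \<longleftrightarrow> ln (u / ?c) < - ((v - z) \<bullet> (v - z)) / (4 * t)"
        using u c by (metis exp_less_cancel_iff exp_ln divide_pos_pos)
      also have "ln (u / ?c) = - ln (?c / u)" using u c by (simp add: ln_div)
      also have "- ln (?c / u) < - ((v - z) \<bullet> (v - z)) / (4 * t) \<longleftrightarrow> (dist v z)\<^sup>2 < r\<^sup>2"
        using t r(2) by (simp add: dist_norm power2_norm_eq_inner field_simps)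
      also have "\<dots> \<longleftrightarrow> dist v z < r" using r(1) by (auto intro: power_strict_mono dest: power2_less_imp_less)
      finally show "z \<in> S u \<longleftrightarrow> z \<in> ball v r" by (simp add: S_def)
    qed
    then show ?thesis using ball[OF r(1)] by simp
  next
    case False
    have "?p z \<le> u" for z using heat_kernel_le_max[OF t, of "v - z"] False by linarith
    then have "S u = {}" by (auto simp: S_def not_less)
    then show ?thesis by simp
  qed
  have m: "(\<lambda>(u, z). indicator {0<..} u * indicator (S u) z :: ennreal) \<in> borel_measurable (lborel \<Otimes>\<^sub>M (lborel :: 'a measure))"
  proof -
    have "(\<lambda>(u::real, z::'a). indicator {0<..} u * indicator (S u) z :: ennreal) =
        (\<lambda>x. indicator {x. 0 < fst x \<and> fst x < ?p (snd x)} x)"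
      by (auto simp: fun_eq_iff S_def indicator_def)
    moreover have "Measurable.pred (lborel \<Otimes>\<^sub>M lborel) (\<lambda>x :: real \<times> 'a. 0 < fst x \<and> fst x < ?p (snd x))"
      by measurable
    ultimately show ?thesis by (simp add: pred_def)
  qed
  have "(\<integral>\<^sup>+z. f z * ennreal (?p z) \<partial>lborel) = (\<integral>\<^sup>+z. \<integral>\<^sup>+u. f z * (indicator {0<..} u * indicator (S u) z) \<partial>lborel \<partial>lborel)"
    unfolding lc using m by (intro nn_integral_cong nn_integral_cmult[symmetric]) (auto intro: measurable_compose_Pair1 measurable_Pair2)
  also have "\<dots> = (\<integral>\<^sup>+u. \<integral>\<^sup>+z. f z * (indicator {0<..} u * indicator (S u) z) \<partial>lborel \<partial>lborel)"
  proof (rule lborel_pair.Fubini')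
    have "(\<lambda>x. f (snd x) * (case x of (u, z) \<Rightarrow> indicator {0<..} u * indicator (S u) z)) \<in> borel_measurable (lborel \<Otimes>\<^sub>M lborel)"
      using m by measurable
    then show "(\<lambda>(u, z). f z * (indicator {0<..} u * indicator (S u) z)) \<in> borel_measurable (lborel \<Otimes>\<^sub>M lborel)"
      by (simp add: case_prod_beta')
  qed
  also have "\<dots> \<le> (\<integral>\<^sup>+u. K * (indicator {0<..} u * emeasure lborel (S u)) \<partial>lborel)"
  proof (intro nn_integral_mono)
    fix u :: real
    show "(\<integral>\<^sup>+z. f z * (indicator {0<..} u * indicator (S u) z) \<partial>lborel) \<le> K * (indicator {0<..} u * emeasure lborel (S u))"
      using level[of u] by (cases "0 < u") auto
  qed
  also have "\<dots> = K * (\<integral>\<^sup>+u. indicator {0<..} u * emeasure lborel (S u) \<partial>lborel)"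
  proof (rule nn_integral_cmult)
    have "(\<lambda>u. \<integral>\<^sup>+z. indicator {0<..} u * indicator (S u) z \<partial>lborel) \<in> borel_measurable lborel"
      using m by (intro lborel.borel_measurable_nn_integral) (simp add: case_prod_beta')
    moreover have "(\<integral>\<^sup>+z. indicator {0<..} u * indicator (S u) z \<partial>lborel) = indicator {0<..} u * emeasure lborel (S u)" for u :: real
      using S by (subst nn_integral_cmult) auto
    ultimately show "(\<lambda>u. indicator {0<..} u * emeasure lborel (S u)) \<in> borel_measurable lborel" by simp
  qed
  also have "(\<integral>\<^sup>+u. indicator {0<..} u * emeasure lborel (S u) \<partial>lborel) = (\<integral>\<^sup>+u. \<integral>\<^sup>+z. indicator {0<..} u * indicator (S u) z \<partial>lborel \<partial>lborel)"
    using S by (intro nn_integral_cong) (simp add: nn_integral_cmult)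
  also have "\<dots> = (\<integral>\<^sup>+z. \<integral>\<^sup>+u. indicator {0<..} u * indicator (S u) z \<partial>lborel \<partial>lborel)"
    by (rule lborel_pair.Fubini'[symmetric, OF m])
  also have "\<dots> = 1"
    unfolding lc[symmetric] using heat_kernel_translate_integral[OF t, of v]
    by (subst nn_integral_eq_integral) auto
  finally show ?thesis by simp
qed

text \<open>
  The growth conditions near the origin and at infinity are merged into single inequalities with the
  factor \<open>min 1 (z \<bullet> z)\<close>. For \<open>norm z < 1\<close> they say \<open>\<bar>w\<bar> \<lesssim> \<bar>z\<bar>\<^sup>b\<close>, \<open>\<bar>\<nabla>w\<bar> \<lesssim> \<bar>z\<bar>\<^bsup>b-1\<^esup>\<close> and \<open>\<Delta>w \<lesssim> \<bar>z\<bar>\<^bsup>b-2\<^esup>\<close>; for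
  \<open>norm z \<ge> 1\<close> they say \<open>\<bar>w\<bar> \<lesssim> \<bar>z\<bar>\<^bsup>s+2\<^esup>\<close>, \<open>\<bar>\<nabla>w\<bar> \<lesssim> \<bar>z\<bar>\<^bsup>s+1\<^esup>\<close> and \<open>\<Delta>w \<lesssim> \<bar>z\<bar>\<^sup>s\<close>.
\<close>

locale punctured_potential =
  fixes w :: "'a::euclidean_space \<Rightarrow> real" and G :: "'a \<Rightarrow> 'a" and H :: "'a \<Rightarrow> 'a \<Rightarrow> 'a"
    and b s C :: real
  assumes b: "- real DIM('a) < b" "b < 0" and s: "s < - real DIM('a)" "s < - 2" and C: "0 < C"
    and even: "w (- z) = w z"
    and gradient: "z \<noteq> 0 \<Longrightarrow> (w has_derivative (\<lambda>h. G z \<bullet> h)) (at z)"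
    and hessian: "z \<noteq> 0 \<Longrightarrow> (G has_derivative H z) (at z)"
    and hessian_continuous: "e \<in> Basis \<Longrightarrow> continuous_on (- {0}) (\<lambda>z. H z e)"
    and subharmonic: "z \<noteq> 0 \<Longrightarrow> 0 < (\<Sum>e\<in>Basis. H z e \<bullet> e)"
    and w_bound: "z \<noteq> 0 \<Longrightarrow> \<bar>w z\<bar> * min 1 (z \<bullet> z) \<le> C * majorant b s z * (z \<bullet> z)"
    and G_bound: "z \<noteq> 0 \<Longrightarrow> norm (G z) * min 1 (z \<bullet> z) \<le> C * majorant b s z * norm z"
    and lap_bound: "z \<noteq> 0 \<Longrightarrow> (\<Sum>e\<in>Basis. H z e \<bullet> e) * min 1 (z \<bullet> z) \<le> C * majorant b s z"
begin

definition lap :: "'a \<Rightarrow> real" where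
  "lap z = (if z = 0 then 0 else \<Sum>e\<in>Basis. H z e \<bullet> e)"

lemma lap_pos: "z \<noteq> 0 \<Longrightarrow> 0 < lap z" and lap_nonneg: "0 \<le> lap z"
  using subharmonic[of z] by (auto simp: lap_def less_imp_le)

lemma measurable_off_0:
  "continuous_on (- {0}) f \<Longrightarrow> f \<in> borel_measurable borel" for f :: "'a \<Rightarrow> 'b::topological_space"
  by (rule borel_measurable_continuous_countable_exceptions[where X = "{0}"]) auto

lemma w_continuous: "continuous_on (- {0}) w" and G_continuous: "continuous_on (- {0}) G"
  using gradient hessian by (auto intro!: continuous_at_imp_continuous_on dest: has_derivative_continuous)

lemma lap_continuous: "continuous_on (- {0}) lap"
proof -
  have "continuous_on (- {0}) (\<lambda>z. \<Sum>e\<in>Basis. H z e \<bullet> e)"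
    by (intro continuous_intros hessian_continuous)
  then show ?thesis by (rule continuous_on_cong[THEN iffD1, rotated -1]) (auto simp: lap_def)
qed

lemma w_measurable [measurable]: "w \<in> borel_measurable borel"
  and G_measurable [measurable]: "G \<in> borel_measurable borel"
  and lap_measurable [measurable]: "lap \<in> borel_measurable borel"
  by (rule measurable_off_0, rule w_continuous G_continuous lap_continuous)+

lemma AE_nonzero: "AE z in lborel. z \<noteq> (0::'a)"
  by (rule AE_lborel_singleton)

lemma majorant_integrable: "integrable lborel (majorant b s :: 'a \<Rightarrow> real)"
  by (rule integrable_majorant[OF b s(1)])

text \<open>
  The divergence theorem for \<open>w \<nabla>\<phi> - \<phi> \<nabla>w\<close>. The hypotheses on \<open>\<phi>\<close> are matched to the bounds of the
  locale: the functions \<open>w \<Delta>\<phi>\<close>, \<open>\<phi> \<Delta>w\<close> and \<open>\<bar>w \<nabla>\<phi> - \<phi> \<nabla>w\<bar> / \<bar>z\<bar>\<close> are all bounded by a multiple of the majorant.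
\<close>

lemma green:
  fixes \<phi> :: "'a \<Rightarrow> real" and \<Phi> :: "'a \<Rightarrow> 'a" and \<Psi> :: "'a \<Rightarrow> 'a \<Rightarrow> 'a"
  assumes \<phi>: "\<And>z. (\<phi> has_derivative (\<lambda>h. \<Phi> z \<bullet> h)) (at z)"
    and \<Phi>: "\<And>z. (\<Phi> has_derivative \<Psi> z) (at z)"
    and \<Psi>: "\<And>e. e \<in> Basis \<Longrightarrow> continuous_on UNIV (\<lambda>z. \<Psi> z e)"
    and bound: "\<And>z. \<bar>\<phi> z\<bar> \<le> A * min 1 (z \<bullet> z)" "\<And>z. norm (\<Phi> z) * norm z \<le> A * min 1 (z \<bullet> z)"
      "\<And>z. \<bar>\<Sum>e\<in>Basis. \<Psi> z e \<bullet> e\<bar> * (z \<bullet> z) \<le> A * min 1 (z \<bullet> z)"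
  shows "integrable lborel (\<lambda>z. w z * (\<Sum>e\<in>Basis. \<Psi> z e \<bullet> e))"
    and "integrable lborel (\<lambda>z. lap z * \<phi> z)"
    and "(\<integral>z. w z * (\<Sum>e\<in>Basis. \<Psi> z e \<bullet> e) \<partial>lborel) = (\<integral>z. lap z * \<phi> z \<partial>lborel)"
proof -
  let ?\<Delta> = "\<lambda>z. \<Sum>e\<in>Basis. \<Psi> z e \<bullet> e"
  let ?m = "majorant b s :: 'a \<Rightarrow> real"
  have A: "0 \<le> A"
  proof -
    obtain e :: 'a where "e \<in> Basis" using nonempty_Basis by blast
    then have "e \<bullet> e = 1" by simp
    then show ?thesis using bound(1)[of e] by simp
  qed
  have \<phi>c: "continuous_on S \<phi>" and \<Phi>c: "continuous_on S \<Phi>" for S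
    using has_derivative_continuous_on[of S \<phi>, OF has_derivative_at_withinI[OF \<phi>]]
      has_derivative_continuous_on[of S \<Phi>, OF has_derivative_at_withinI[OF \<Phi>]] by auto
  have [measurable]: "\<phi> \<in> borel_measurable borel" "\<Phi> \<in> borel_measurable borel" "?\<Delta> \<in> borel_measurable borel"
  proof -
    show "\<phi> \<in> borel_measurable borel" by (intro borel_measurable_continuous_onI \<phi>c)
    show "\<Phi> \<in> borel_measurable borel" by (intro borel_measurable_continuous_onI \<Phi>c)
    show "?\<Delta> \<in> borel_measurable borel" by (intro borel_measurable_continuous_onI continuous_intros \<Psi>)
  qed
  have mI: "integrable lborel (\<lambda>z. C * A * ?m z)" using majorant_integrable by simp
  have wb: "\<bar>w z\<bar> * y \<le> C * A * ?m z" if "z \<noteq> 0" "0 \<le> y" "y * (z \<bullet> z) \<le> A * min 1 (z \<bullet> z)" for z y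
  proof -
    have "\<bar>w z\<bar> * (y * (z \<bullet> z)) \<le> \<bar>w z\<bar> * (A * min 1 (z \<bullet> z))" using that by (intro mult_left_mono) auto
    also have "\<dots> \<le> A * (C * ?m z * (z \<bullet> z))" using mult_left_mono[OF w_bound[OF that(1)] A] by (simp add: mult_ac)
    finally have "(\<bar>w z\<bar> * y) * (z \<bullet> z) \<le> (C * A * ?m z) * (z \<bullet> z)" by (simp add: mult_ac)
    then show ?thesis using that(1) by (simp add: mult_le_cancel_right)
  qed
  show I1: "integrable lborel (\<lambda>z. w z * ?\<Delta> z)"
  proof (rule Bochner_Integration.integrable_bound[OF mI])
    show "AE z in lborel. norm (w z * ?\<Delta> z) \<le> norm (C * A * ?m z)"
      using AE_nonzero
    proof eventually_elim
      case (elim z)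
      have "\<bar>w z\<bar> * \<bar>?\<Delta> z\<bar> \<le> C * A * ?m z" using elim bound(3)[of z] by (intro wb) auto
      then show ?case using A C by (simp add: abs_mult)
    qed
  qed simp
  show I2: "integrable lborel (\<lambda>z. lap z * \<phi> z)"
  proof (rule Bochner_Integration.integrable_bound[OF mI])
    show "AE z in lborel. norm (lap z * \<phi> z) \<le> norm (C * A * ?m z)"
      using AE_nonzero
    proof eventually_elim
      case (elim z)
      have "lap z * \<bar>\<phi> z\<bar> \<le> lap z * (A * min 1 (z \<bullet> z))" using bound(1)[of z] lap_nonneg by (intro mult_left_mono)
      also have "\<dots> \<le> A * (C * ?m z)" using mult_left_mono[OF lap_bound[OF elim] A] elim by (simp add: lap_def mult_ac)
      finally show ?case using A C lap_nonneg[of z] by (simp add: abs_mult mult_ac)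
    qed
  qed simp
  define F where "F z = w z *\<^sub>R \<Phi> z - \<phi> z *\<^sub>R G z" for z
  define F' where "F' z h = ((G z \<bullet> h) *\<^sub>R \<Phi> z + w z *\<^sub>R \<Psi> z h) - ((\<Phi> z \<bullet> h) *\<^sub>R G z + \<phi> z *\<^sub>R H z h)" for z h
  have tr: "(\<Sum>e\<in>Basis. F' z e \<bullet> e) = w z * ?\<Delta> z - \<phi> z * (\<Sum>e\<in>Basis. H z e \<bullet> e)" for z
  proof -
    have comm: "(\<Sum>e\<in>Basis. (G z \<bullet> e) * (\<Phi> z \<bullet> e)) = (\<Sum>e\<in>Basis. (\<Phi> z \<bullet> e) * (G z \<bullet> e))"
      by (intro sum.cong refl mult.commute)
    have "(\<Sum>e\<in>Basis. F' z e \<bullet> e) = (\<Sum>e\<in>Basis. (G z \<bullet> e) * (\<Phi> z \<bullet> e)) + w z * ?\<Delta> z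
       - ((\<Sum>e\<in>Basis. (\<Phi> z \<bullet> e) * (G z \<bullet> e)) + \<phi> z * (\<Sum>e\<in>Basis. H z e \<bullet> e))"
      by (simp add: F'_def inner_diff_left inner_add_left sum_subtractf sum.distrib sum_distrib_left comm)
    then show ?thesis using comm by simp
  qed
  have tr': "AE z in lborel. (\<Sum>e\<in>Basis. F' z e \<bullet> e) = w z * ?\<Delta> z - lap z * \<phi> z"
    using AE_nonzero by eventually_elim (simp add: tr lap_def mult.commute)
  have trm: "(\<lambda>z. \<Sum>e\<in>Basis. F' z e \<bullet> e) \<in> borel_measurable lborel"
  proof -
    have "continuous_on (- {0}) (\<lambda>z. w z * ?\<Delta> z - \<phi> z * (\<Sum>e\<in>Basis. H z e \<bullet> e))"
      by (intro continuous_intros w_continuous hessian_continuous continuous_on_subset[OF \<Psi>] \<phi>c) auto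
    then show ?thesis unfolding tr using measurable_off_0 by simp
  qed
  have "(\<integral>z. (\<Sum>e\<in>Basis. F' z e \<bullet> e) \<partial>lborel) = 0"
  proof (rule integral_divergence_punctured[where F = F])
    show "(F has_derivative F' z) (at z)" if "z \<noteq> 0" for z
      unfolding F_def[abs_def] F'_def[abs_def] using that
      by (auto intro!: derivative_eq_intros \<phi> \<Phi> gradient hessian)
    show "continuous_on (- {0}) (\<lambda>z. F' z e)" if "e \<in> Basis" for e
      unfolding F'_def using that
      by (intro continuous_intros w_continuous G_continuous hessian_continuous continuous_on_subset[OF \<Psi>] \<phi>c \<Phi>c) auto
    have Fm: "F \<in> borel_measurable borel" unfolding F_def[abs_def] by measurable
    show "integrable lborel (\<lambda>z. norm (F z) / norm z)"
    proof (rule Bochner_Integration.integrable_bound)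
      show "integrable lborel (\<lambda>z. 2 * (C * A * ?m z))" using mI by simp
      show "AE z in lborel. norm (norm (F z) / norm z) \<le> norm (2 * (C * A * ?m z))"
        using AE_nonzero
      proof eventually_elim
        case (elim z)
        have "\<bar>w z\<bar> * (norm (\<Phi> z) / norm z) \<le> C * A * ?m z"
        proof (rule wb[OF elim])
          have "norm (\<Phi> z) / norm z * (z \<bullet> z) = norm (\<Phi> z) * norm z"
            using elim by (simp add: power2_norm_eq_inner[symmetric] power2_eq_square)
          then show "norm (\<Phi> z) / norm z * (z \<bullet> z) \<le> A * min 1 (z \<bullet> z)" using bound(2)[of z] by simp
        qed simp
        moreover have "\<bar>\<phi> z\<bar> * (norm (G z) / norm z) \<le> C * A * ?m z"
        proof -
          have "\<bar>\<phi> z\<bar> * norm (G z) \<le> A * min 1 (z \<bullet> z) * norm (G z)"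
            using bound(1)[of z] by (intro mult_right_mono) auto
          also have "\<dots> \<le> A * (C * ?m z * norm z)" using mult_left_mono[OF G_bound[OF elim] A] by (simp add: mult_ac)
          finally show ?thesis using elim by (simp add: field_simps)
        qed
        moreover have "norm (F z) / norm z \<le> \<bar>w z\<bar> * (norm (\<Phi> z) / norm z) + \<bar>\<phi> z\<bar> * (norm (G z) / norm z)"
        proof -
          have "norm (F z) \<le> \<bar>w z\<bar> * norm (\<Phi> z) + \<bar>\<phi> z\<bar> * norm (G z)"
            unfolding F_def by (intro order_trans[OF norm_triangle_ineq4]) simp
          from divide_right_mono[OF this, of "norm z"] show ?thesis by (simp add: add_divide_distrib)
        qed
        ultimately show ?case using A C by simp
      qed
    qed (use Fm in simp)
    show "integrable lborel (\<lambda>z. \<Sum>e\<in>Basis. F' z e \<bullet> e)"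
    proof (rule integrable_cong_AE_imp[OF _ trm])
      show "integrable lborel (\<lambda>z. w z * ?\<Delta> z - lap z * \<phi> z)" using I1 I2 by simp
    qed (use tr' in eventually_elim, simp)
  qed
  moreover have "(\<integral>z. (\<Sum>e\<in>Basis. F' z e \<bullet> e) \<partial>lborel) = (\<integral>z. w z * ?\<Delta> z - lap z * \<phi> z \<partial>lborel)"
    using tr' trm by (intro integral_cong_AE) auto
  ultimately show "(\<integral>z. w z * ?\<Delta> z \<partial>lborel) = (\<integral>z. lap z * \<phi> z \<partial>lborel)"
    using I1 I2 by simp
qed

end

section \<open>Heat regularisation of the potential\<close>

text \<open>
  Away from \<open>v\<close> the kernel \<open>p\<^sub>t\<close> is at most \<open>c(t) p\<^sub>1\<close> with \<open>c(t) \<rightarrow> 0\<close>; so integrability against Gaussians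
  is enough and \<open>f\<close> may be unbounded.
\<close>

lemma heat_kernel_approximate_identity:
  fixes f :: "'a::euclidean_space \<Rightarrow> real"
  assumes cont: "isCont f v"
    and int: "\<And>t. 0 < t \<Longrightarrow> integrable lborel (\<lambda>z. f z * heat_kernel t (v - z))"
  shows "((\<lambda>t. \<integral>z. f z * heat_kernel t (v - z) \<partial>lborel) \<longlongrightarrow> f v) (at_right 0)"
proof (rule tendstoI)
  fix \<eta> :: real assume \<eta>: "0 < \<eta>"
  obtain \<delta> where \<delta>: "0 < \<delta>" "\<And>z. dist z v < \<delta> \<Longrightarrow> \<bar>f z - f v\<bar> < \<eta> / 2"
    using cont \<eta> unfolding continuous_at_eps_delta dist_real_def by (metis half_gt_zero)
  \<comment> \<open>The quotient \<open>p\<^sub>t(y) / p\<^sub>1(y)\<close> decreases in \<open>norm y\<close>; this is its value at distance \<open>\<delta>\<close>.\<close>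
  define c where "c t = t powr - (real DIM('a) / 2) * exp (- \<delta>\<^sup>2 * (1 / (4 * t) - 1 / 4))" for t :: real
  define D where "D z = \<bar>f z - f v\<bar>" for z
  have far: "heat_kernel t y \<le> c t * heat_kernel 1 y" if "0 < t" "t \<le> 1" "\<delta> \<le> norm y" for t and y :: 'a
  proof -
    have "\<delta>\<^sup>2 * (1 / (4 * t) - 1 / 4) \<le> (y \<bullet> y) * (1 / (4 * t) - 1 / 4)"
      using that \<delta>(1) by (intro mult_right_mono) (auto simp: power2_norm_eq_inner[symmetric] field_simps)
    then have "- (y \<bullet> y) / (4 * t) \<le> - \<delta>\<^sup>2 * (1 / (4 * t) - 1 / 4) + - (y \<bullet> y) / (4 * 1)"
      by (simp add: algebra_simps)
    then have "exp (- (y \<bullet> y) / (4 * t)) \<le> exp (- \<delta>\<^sup>2 * (1 / (4 * t) - 1 / 4)) * exp (- (y \<bullet> y) / (4 * 1))"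
      by (simp only: exp_add[symmetric] exp_le_cancel_iff)
    moreover have "(4 * pi * t) powr p = t powr p * (4 * pi * 1) powr p" for p
      using that by (simp add: powr_mult mult.commute)
    ultimately show ?thesis unfolding heat_kernel_def c_def
      by (simp only: mult_ac) (intro mult_left_mono, simp_all add: mult_ac)
  qed
  have D: "integrable lborel (\<lambda>z. D z * heat_kernel t (v - z))" if "0 < t" for t
  proof -
    have "integrable lborel (\<lambda>z. f z * heat_kernel t (v - z) - f v * heat_kernel t (v - z))"
      using int[OF that] heat_kernel_translate_integral(1)[OF that, of v] by simp
    from integrable_abs[OF this] show ?thesis
      by (simp add: D_def abs_mult left_diff_distrib[symmetric])
  qed
  define I where "I = (\<integral>z. D z * heat_kernel 1 (v - z) \<partial>lborel)"
  have main: "\<bar>(\<integral>z. f z * heat_kernel t (v - z) \<partial>lborel) - f v\<bar> \<le> \<eta> / 2 + c t * I" if t: "0 < t" "t \<le> 1" for t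
  proof -
    note h = heat_kernel_translate_integral[OF t(1), of v]
    have "(\<integral>z. f z * heat_kernel t (v - z) \<partial>lborel) - f v
        = (\<integral>z. f z * heat_kernel t (v - z) - f v * heat_kernel t (v - z) \<partial>lborel)"
      using int[OF t(1)] h by simp
    also have "\<dots> = (\<integral>z. (f z - f v) * heat_kernel t (v - z) \<partial>lborel)" by (simp add: left_diff_distrib)
    also have "\<bar>\<dots>\<bar> \<le> (\<integral>z. \<bar>(f z - f v) * heat_kernel t (v - z)\<bar> \<partial>lborel)" by (rule integral_abs_bound)
    also have "\<dots> = (\<integral>z. D z * heat_kernel t (v - z) \<partial>lborel)" by (simp add: D_def abs_mult)
    also have "\<dots> \<le> (\<integral>z. \<eta> / 2 * heat_kernel t (v - z) + c t * (D z * heat_kernel 1 (v - z)) \<partial>lborel)"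
    proof (rule integral_mono)
      show "D z * heat_kernel t (v - z) \<le> \<eta> / 2 * heat_kernel t (v - z) + c t * (D z * heat_kernel 1 (v - z))" for z
      proof (cases "dist z v < \<delta>")
        case True
        then have "D z * heat_kernel t (v - z) \<le> \<eta> / 2 * heat_kernel t (v - z)"
          using \<delta>(2) by (intro mult_right_mono) (auto simp: D_def less_imp_le)
        moreover have "0 \<le> c t * (D z * heat_kernel 1 (v - z))" by (simp add: c_def D_def)
        ultimately show ?thesis by linarith
      next
        case False
        then have "D z * heat_kernel t (v - z) \<le> D z * (c t * heat_kernel 1 (v - z))"
          using t by (intro mult_left_mono far) (auto simp: D_def dist_norm norm_minus_commute)
        moreover have "0 \<le> \<eta> / 2 * heat_kernel t (v - z)" using \<eta> by simp
        ultimately show ?thesis by (simp add: mult_ac)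
      qed
    qed (use D[OF t(1)] D[of 1] h in auto)
    also have "\<dots> = \<eta> / 2 + c t * I" using D[of 1] h by (simp add: I_def)
    finally show ?thesis .
  qed
  have "(c \<longlongrightarrow> 0) (at_right 0)" unfolding c_def[abs_def] using \<delta>(1) by real_asymp
  then have "((\<lambda>t. c t * I) \<longlongrightarrow> 0) (at_right 0)" by (rule tendsto_mult_left_zero)
  then have "\<forall>\<^sub>F t in at_right 0. \<bar>c t * I\<bar> < \<eta> / 2"
    using \<eta> by (auto simp: tendsto_iff dist_real_def dest: spec[of _ "\<eta> / 2"])
  moreover have "\<forall>\<^sub>F t in at_right 0. t \<in> {0<..<1::real}" by (rule eventually_at_right_real) simp
  ultimately show "\<forall>\<^sub>F t in at_right 0. dist (\<integral>z. f z * heat_kernel t (v - z) \<partial>lborel) (f v) < \<eta>"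
  proof eventually_elim
    case (elim t)
    then show ?case using main[of t] by (auto simp: dist_real_def)
  qed
qed

context punctured_potential
begin

lemma w_far: assumes "1 \<le> norm z" shows "\<bar>w z\<bar> \<le> C * norm z powr (s + 2)"
proof -
  have z: "z \<noteq> 0" using assms by auto
  have "1 \<le> z \<bullet> z" using assms by (simp add: power2_norm_eq_inner[symmetric])
  then have "\<bar>w z\<bar> \<le> C * (norm z powr s * norm z powr 2)"
    using w_bound[OF z] assms z by (simp add: majorant_def min_absorb1 mult.assoc power2_norm_eq_inner[symmetric])
  then show ?thesis by (simp add: powr_add)
qed

lemma w_le: assumes "z \<noteq> 0" shows "\<bar>w z\<bar> \<le> C * majorant b s z + C"
proof (cases "norm z < 1")
  case True
  have "z \<bullet> z > 0" "z \<bullet> z \<le> 1" using True assms by (auto simp: power2_norm_eq_inner[symmetric] power_le_one)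
  then have "\<bar>w z\<bar> \<le> C * majorant b s z"
    using w_bound[OF assms] by (simp add: min_absorb2)
  then show ?thesis using C by simp
next
  case False
  have "norm z powr (s + 2) \<le> norm z powr 0" using False s by (intro powr_mono) auto
  then have "C * norm z powr (s + 2) \<le> C * 1" using C assms by (intro mult_left_mono) auto
  moreover have "0 \<le> C * majorant b s z" using C by simp
  ultimately show ?thesis using w_far[of z] False by linarith
qed

text \<open>
  The estimate is uniform in \<open>v\<close>: the singular part of \<open>w\<close> is integrable and meets the bounded
  function \<open>K\<close>, the rest of \<open>w\<close> is bounded and meets the integrable function \<open>K\<close>.
\<close>

lemma convolution_bound:
  assumes [measurable]: "K \<in> borel_measurable borel" and K: "integrable lborel K" "\<And>x. \<bar>K x\<bar> \<le> B"
  shows "integrable lborel (\<lambda>z. w z * K (v - z))"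
    and "(\<integral>z. \<bar>w z * K (v - z)\<bar> \<partial>lborel) \<le> C * B * (\<integral>z. majorant b s (z::'a) \<partial>lborel) + C * (\<integral>z. \<bar>K z\<bar> \<partial>lborel)"
proof -
  let ?m = "majorant b s :: 'a \<Rightarrow> real"
  have Kv: "integrable lborel (\<lambda>z. \<bar>K (v - z)\<bar>)" "(\<integral>z. \<bar>K (v - z)\<bar> \<partial>lborel) = (\<integral>z. \<bar>K z\<bar> \<partial>lborel)"
    using lborel_reflect(2)[OF K(1), of v] lborel_reflect(1)[of "\<lambda>z. \<bar>K z\<bar>" v] by auto
  have dom: "integrable lborel (\<lambda>z. C * B * ?m z + C * \<bar>K (v - z)\<bar>)"
    using majorant_integrable Kv by simp
  have le: "AE z in lborel. \<bar>w z * K (v - z)\<bar> \<le> C * B * ?m z + C * \<bar>K (v - z)\<bar>"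
    using AE_nonzero
  proof eventually_elim
    case (elim z)
    have "\<bar>w z * K (v - z)\<bar> \<le> (C * ?m z + C) * \<bar>K (v - z)\<bar>"
      unfolding abs_mult using w_le[OF elim] by (intro mult_right_mono) auto
    also have "\<dots> = C * ?m z * \<bar>K (v - z)\<bar> + C * \<bar>K (v - z)\<bar>" by (simp add: distrib_right)
    also have "C * ?m z * \<bar>K (v - z)\<bar> \<le> C * ?m z * B" using K(2) C by (intro mult_left_mono) auto
    finally show ?case by (simp add: mult_ac)
  qed
  show I: "integrable lborel (\<lambda>z. w z * K (v - z))"
    by (rule Bochner_Integration.integrable_bound[OF dom]) (use le in \<open>auto elim: eventually_mono\<close>)
  have "(\<integral>z. \<bar>w z * K (v - z)\<bar> \<partial>lborel) \<le> (\<integral>z. C * B * ?m z + C * \<bar>K (v - z)\<bar> \<partial>lborel)"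
    using I dom le by (intro integral_mono_AE) auto
  also have "\<dots> = C * B * (\<integral>z. ?m z \<partial>lborel) + C * (\<integral>z. \<bar>K z\<bar> \<partial>lborel)"
    using majorant_integrable Kv by simp
  finally show "(\<integral>z. \<bar>w z * K (v - z)\<bar> \<partial>lborel) \<le> C * B * (\<integral>z. ?m z \<partial>lborel) + C * (\<integral>z. \<bar>K z\<bar> \<partial>lborel)" .
qed

definition smoothed :: "real \<Rightarrow> 'a \<Rightarrow> real" where
  "smoothed t v = (\<integral>z. w z * heat_kernel t (v - z) \<partial>lborel)"

lemma heat_kernel_convolution_bound:
  assumes "0 < t"
  shows "integrable lborel (\<lambda>z. w z * heat_kernel t (v - z))"
    and "(\<integral>z. \<bar>w z * heat_kernel t (v - z)\<bar> \<partial>lborel) \<le> C * heat_kernel t (0::'a) * (\<integral>z. majorant b s (z::'a) \<partial>lborel) + C"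
  using convolution_bound[of "heat_kernel t" "heat_kernel t (0::'a)" v] heat_kernel_integral[OF assms, where 'a = 'a]
    heat_kernel_le_0[OF assms] by auto

lemma smoothed_bounded:
  assumes "0 < t" shows "\<bar>smoothed t v\<bar> \<le> C * heat_kernel t (0::'a) * (\<integral>z. majorant b s (z::'a) \<partial>lborel) + C"
  unfolding smoothed_def by (rule order_trans[OF integral_abs_bound heat_kernel_convolution_bound(2)[OF assms]])

lemma smoothed_measurable [measurable]: "smoothed t \<in> borel_measurable borel"
  unfolding smoothed_def[abs_def] by measurable

lemma heat_kernel_increment_bound:
  assumes "0 < t"
  shows "\<exists>K. 0 < K \<and> (\<forall>u\<in>{t/2..2*t}. \<forall>v z.
    \<bar>w z * heat_kernel u (v - z) - w z * heat_kernel t (v - z)\<bar> \<le> K * \<bar>w z * heat_kernel (4 * t) (v - z)\<bar> * \<bar>u - t\<bar>)"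
proof -
  obtain K where K: "K > 0" "\<And>u x. u \<in> {t/2..2*t} \<Longrightarrow>
      \<bar>heat_kernel u (x::'a) - heat_kernel t x\<bar> \<le> K * heat_kernel (4 * t) x * \<bar>u - t\<bar>"
    using heat_kernel_lipschitz_in_time[OF assms, where 'a = 'a] by blast
  have "\<bar>w z * heat_kernel u (v - z) - w z * heat_kernel t (v - z)\<bar> \<le> K * \<bar>w z * heat_kernel (4 * t) (v - z)\<bar> * \<bar>u - t\<bar>"
    if "u \<in> {t/2..2*t}" for u v z
    using mult_left_mono[OF K(2)[OF that, of "v - z"], of "\<bar>w z\<bar>"]
    by (simp add: right_diff_distrib[symmetric] abs_mult mult_ac)
  with K(1) show ?thesis by blast
qed

lemma smoothed_lipschitz_in_time:
  assumes "0 < t"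
  shows "\<exists>B. \<forall>u\<in>{t/2..2*t}. \<forall>v. \<bar>smoothed u v - smoothed t v\<bar> \<le> B * \<bar>u - t\<bar>"
proof -
  obtain K where K: "K > 0" "\<And>u v z. u \<in> {t/2..2*t} \<Longrightarrow>
     \<bar>w z * heat_kernel u (v - z) - w z * heat_kernel t (v - z)\<bar> \<le> K * \<bar>w z * heat_kernel (4 * t) (v - z)\<bar> * \<bar>u - t\<bar>"
    using heat_kernel_increment_bound[OF assms] by blast
  define B where "B = C * heat_kernel (4 * t) (0::'a) * (\<integral>z. majorant b s (z::'a) \<partial>lborel) + C"
  have "\<bar>smoothed u v - smoothed t v\<bar> \<le> K * B * \<bar>u - t\<bar>" if u: "u \<in> {t/2..2*t}" for u v
  proof -
    have "0 < u" using u assms by auto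
    note I = heat_kernel_convolution_bound[of u v, OF \<open>0 < u\<close>] heat_kernel_convolution_bound[of t v, OF assms]
      heat_kernel_convolution_bound[of "4 * t" v]
    have "\<bar>smoothed u v - smoothed t v\<bar> = \<bar>\<integral>z. w z * heat_kernel u (v - z) - w z * heat_kernel t (v - z) \<partial>lborel\<bar>"
      unfolding smoothed_def using I by simp
    also have "\<dots> \<le> (\<integral>z. \<bar>w z * heat_kernel u (v - z) - w z * heat_kernel t (v - z)\<bar> \<partial>lborel)"
      by (rule integral_abs_bound)
    also have "\<dots> \<le> (\<integral>z. K * \<bar>w z * heat_kernel (4 * t) (v - z)\<bar> * \<bar>u - t\<bar> \<partial>lborel)"
      using I assms K(2)[OF u] by (intro integral_mono) auto
    also have "\<dots> = K * (\<integral>z. \<bar>w z * heat_kernel (4 * t) (v - z)\<bar> \<partial>lborel) * \<bar>u - t\<bar>" by simp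
    also have "\<dots> \<le> K * B * \<bar>u - t\<bar>"
      unfolding B_def using I assms K(1) by (intro mult_right_mono mult_left_mono) auto
    finally show ?thesis .
  qed
  then show ?thesis by blast
qed

text \<open>
  Since \<open>w\<close> is even, \<open>\<Delta>p\<^sub>t(v - z)\<close> may be replaced by its even part in \<open>z\<close>, which is the Laplacian of
  \<open>heat_diff t v\<close>; then Green's identity applies.
\<close>

lemma heat_diff_integral:
  assumes "0 < t"
  shows "integrable lborel (\<lambda>z. lap z * heat_diff t v z)"
    and "(\<integral>z. w z * heat_rate t (v - z) \<partial>lborel) = (\<integral>z. lap z * heat_diff t v z \<partial>lborel)"
proof -
  let ?r = "\<lambda>z. (heat_rate t (v + z) + heat_rate t (v - z)) / 2"
  obtain A1 A2 A3 where A: "\<And>z. \<bar>heat_diff t v z\<bar> \<le> A1 * min 1 (z \<bullet> z)"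
    "\<And>z. norm (heat_diff_gradient t v z) * norm z \<le> A2 * min 1 (z \<bullet> z)"
    "\<And>z. \<bar>?r z\<bar> * (z \<bullet> z) \<le> A3 * min 1 (z \<bullet> z)"
    using heat_diff_bound[OF assms, where 'a = 'a] heat_diff_gradient_bound[OF assms, of v]
      heat_diff_laplacian_bound[OF assms, of v] by blast
  define A where "A = max A1 (max A2 A3)"
  have A': "x \<le> A * min 1 (z \<bullet> z)" if "x \<le> a * min 1 (z \<bullet> z)" "a \<le> A" for x a and z :: 'a
    using that by (intro order_trans[OF that(1)] mult_right_mono) auto
  have tr: "(\<Sum>e\<in>Basis. heat_diff_hessian t v z e \<bullet> e) = ?r z" for z
    by (rule trace_heat_diff_hessian[OF assms])
  have cont: "continuous_on UNIV (\<lambda>z. heat_diff_hessian t v z e)" for e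
    unfolding heat_diff_hessian_def by (intro continuous_intros)
  note gr = green[of "heat_diff t v" "heat_diff_gradient t v" "heat_diff_hessian t v" A, unfolded tr,
      OF heat_diff_has_derivative[OF assms] heat_diff_gradient_has_derivative[OF assms] cont
        A'[OF A(1)] A'[OF A(2)] A'[OF A(3)]]
  show "integrable lborel (\<lambda>z. lap z * heat_diff t v z)" by (rule gr(2)) (auto simp: A_def)
  have eq: "(\<integral>z. w z * ?r z \<partial>lborel) = (\<integral>z. lap z * heat_diff t v z \<partial>lborel)" by (rule gr(3)) (auto simp: A_def)
  obtain K where K: "K > 0" "\<And>x::'a. \<bar>heat_rate t x\<bar> \<le> K * heat_kernel (4 * t) x"
    using heat_rate_dominated[OF assms, where 'a = 'a] assms by fastforce
  have t4: "0 < 4 * t" using assms by simp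
  have rate_int: "integrable lborel (heat_rate t :: 'a \<Rightarrow> real)"
  proof (rule Bochner_Integration.integrable_bound)
    show "integrable lborel (\<lambda>x::'a. K * heat_kernel (4 * t) x)"
      using heat_kernel_integral[OF t4, where 'a = 'a] by simp
    show "AE x::'a in lborel. norm (heat_rate t x) \<le> norm (K * heat_kernel (4 * t) x)"
      using K by (auto simp: abs_mult)
  qed simp
  have rate_bd: "\<bar>heat_rate t x\<bar> \<le> K * heat_kernel (4 * t) (0::'a)" for x :: 'a
    using K(2)[of x] mult_left_mono[OF heat_kernel_le_0[OF t4, of x] less_imp_le[OF K(1)]] by linarith
  have I: "integrable lborel (\<lambda>z. w z * heat_rate t (v' - z))" for v'
    by (rule convolution_bound(1)[OF _ rate_int rate_bd]) simp
  have J: "(\<lambda>z. w z * heat_rate t (v + z)) = (\<lambda>z. (\<lambda>z. w z * heat_rate t (v - z)) (0 - z))"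
    by (simp add: even)
  have I': "integrable lborel (\<lambda>z. w z * heat_rate t (v + z))"
    unfolding J by (rule lborel_reflect(2)[OF I])
  have "(\<integral>z. w z * heat_rate t (v + z) \<partial>lborel) = (\<integral>z. w z * heat_rate t (v - z) \<partial>lborel)"
    unfolding J by (rule lborel_reflect(1))
  moreover have "(\<integral>z. w z * ?r z \<partial>lborel) = ((\<integral>z. w z * heat_rate t (v + z) \<partial>lborel) + (\<integral>z. w z * heat_rate t (v - z) \<partial>lborel)) / 2"
  proof -
    have "w z * ?r z = (w z * heat_rate t (v + z) + w z * heat_rate t (v - z)) / 2" for z
      by (simp add: distrib_left)
    then show ?thesis using I[of v] I' by simp
  qed
  ultimately show "(\<integral>z. w z * heat_rate t (v - z) \<partial>lborel) = (\<integral>z. lap z * heat_diff t v z \<partial>lborel)"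
    using eq by simp
qed

lemma smoothed_time_derivative:
  assumes "0 < t"
  shows "((\<lambda>t. smoothed t v) has_real_derivative (\<integral>z. lap z * heat_diff t v z \<partial>lborel)) (at t)"
proof -
  obtain K where K: "K > 0" "\<And>u v z. u \<in> {t/2..2*t} \<Longrightarrow>
     \<bar>w z * heat_kernel u (v - z) - w z * heat_kernel t (v - z)\<bar> \<le> K * \<bar>w z * heat_kernel (4 * t) (v - z)\<bar> * \<bar>u - t\<bar>"
    using heat_kernel_increment_bound[OF assms] by blast
  have "((\<lambda>u. \<integral>z. w z * heat_kernel u (v - z) \<partial>lborel) has_real_derivative (\<integral>z. w z * heat_rate t (v - z) \<partial>lborel)) (at t)"
  proof (rule DERIV_integral_dominated[where a = "t/2" and b = "2*t"])
    show "integrable lborel (\<lambda>z. w z * heat_kernel u (v - z))" if "u \<in> {t/2..2*t}" for u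
      using that assms by (intro heat_kernel_convolution_bound) auto
    show "((\<lambda>u. w z * heat_kernel u (v - z)) has_real_derivative w z * heat_rate t (v - z)) (at t)" for z
      by (intro DERIV_cmult heat_kernel_time_derivative assms)
    show "integrable lborel (\<lambda>z. K * \<bar>w z * heat_kernel (4 * t) (v - z)\<bar>)"
      using assms by (intro integrable_mult_right integrable_abs heat_kernel_convolution_bound) auto
  qed (use assms K in auto)
  then show ?thesis unfolding smoothed_def heat_diff_integral(2)[OF assms] .
qed

text \<open>
  Outside a large ball \<open>w\<close> is small; on the ball \<open>w\<close> is integrable and \<open>p\<^sub>t\<close> is at most
  \<open>p\<^sub>t(0) \<rightarrow> 0\<close>.
\<close>

lemma smoothed_vanishes:
  assumes "0 < \<eta>" shows "\<forall>\<^sub>F t in at_top. \<forall>v. \<bar>smoothed t v\<bar> \<le> \<eta>"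
proof -
  have "((\<lambda>r. C * r powr (s + 2)) \<longlongrightarrow> C * 0) at_top"
    using s by (intro tendsto_mult tendsto_const tendsto_neg_powr filterlim_ident) auto
  then have "\<forall>\<^sub>F r in at_top. C * r powr (s + 2) < \<eta> / 2"
    using assms by (intro order_tendstoD) auto
  then obtain R where R: "\<And>r. R \<le> r \<Longrightarrow> C * r powr (s + 2) < \<eta> / 2" unfolding eventually_at_top_linorder by blast
  define R' where "R' = max R 1"
  define I where "I = (\<integral>z. \<bar>w z\<bar> * indicator (ball 0 R') z \<partial>lborel)"
  have wI: "integrable lborel (\<lambda>z. \<bar>w z\<bar> * indicator (ball 0 R') z)"
  proof (rule Bochner_Integration.integrable_bound)
    show "integrable lborel (\<lambda>z. C * majorant b s (z::'a) + C * indicator (ball 0 R') z)"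
      using majorant_integrable
      by (intro Bochner_Integration.integrable_add integrable_mult_right integrable_real_indicator emeasure_lborel_ball_finite) auto
    show "AE z in lborel. norm (\<bar>w z\<bar> * indicator (ball 0 R') z) \<le> norm (C * majorant b s z + C * indicator (ball 0 R') z)"
      using AE_nonzero
    proof eventually_elim
      case (elim z)
      then show ?case using w_le[OF elim] C by (auto simp: indicator_def abs_of_nonneg)
    qed
  qed (simp, intro borel_measurable_times borel_measurable_abs borel_measurable_indicator, auto)
  have main: "\<bar>smoothed t v\<bar> \<le> \<eta> / 2 + heat_kernel t (0::'a) * I" if t: "0 < t" for t v
  proof -
    note h = heat_kernel_translate_integral[OF t, of v]
    have "\<bar>smoothed t v\<bar> \<le> (\<integral>z. \<bar>w z * heat_kernel t (v - z)\<bar> \<partial>lborel)"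
      unfolding smoothed_def by (rule integral_abs_bound)
    also have "\<dots> \<le> (\<integral>z. \<eta> / 2 * heat_kernel t (v - z) + heat_kernel t (0::'a) * (\<bar>w z\<bar> * indicator (ball 0 R') z) \<partial>lborel)"
    proof (rule integral_mono)
      show "\<bar>w z * heat_kernel t (v - z)\<bar> \<le> \<eta> / 2 * heat_kernel t (v - z) + heat_kernel t (0::'a) * (\<bar>w z\<bar> * indicator (ball 0 R') z)" for z
      proof (cases "norm z < R'")
        case True
        have "\<bar>w z\<bar> * heat_kernel t (v - z) \<le> \<bar>w z\<bar> * heat_kernel t (0::'a)"
          by (intro mult_left_mono heat_kernel_le_0 t) auto
        moreover have "0 \<le> \<eta> / 2 * heat_kernel t (v - z)" using assms by simp
        ultimately show ?thesis using True by (simp add: abs_mult mult_ac)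
      next
        case False
        then have "1 \<le> norm z" "R \<le> norm z" by (auto simp: R'_def)
        then have "\<bar>w z\<bar> \<le> \<eta> / 2" using w_far[of z] R[of "norm z"] by simp
        then have "\<bar>w z\<bar> * heat_kernel t (v - z) \<le> \<eta> / 2 * heat_kernel t (v - z)" by (intro mult_right_mono) auto
        then show ?thesis using False by (simp add: abs_mult)
      qed
    qed (use h wI heat_kernel_convolution_bound[OF t] in auto)
    also have "\<dots> = \<eta> / 2 + heat_kernel t (0::'a) * I" using h wI by (simp add: I_def)
    finally show ?thesis .
  qed
  have "((\<lambda>t. (4 * pi * t) powr - (real DIM('a) / 2)) \<longlongrightarrow> 0) at_top"
    using pi_gt_zero by (intro tendsto_neg_powr filterlim_tendsto_pos_mult_at_top[OF tendsto_const]) (auto simp: filterlim_ident)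
  then have "((\<lambda>t. heat_kernel t (0::'a) * I) \<longlongrightarrow> 0) at_top"
    by (intro tendsto_mult_left_zero) (simp add: heat_kernel_def)
  then have "\<forall>\<^sub>F t in at_top. heat_kernel t (0::'a) * I < \<eta> / 2" using assms by (intro order_tendstoD) auto
  then show ?thesis using eventually_gt_at_top[of 0]
  proof eventually_elim
    case (elim t)
    show ?case
    proof
      fix v show "\<bar>smoothed t v\<bar> \<le> \<eta>" using main[of t v] elim by linarith
    qed
  qed
qed

lemma smoothed_tendsto:
  assumes "isCont w v" shows "((\<lambda>t. smoothed t v) \<longlongrightarrow> w v) (at_right 0)"
  unfolding smoothed_def using assms heat_kernel_convolution_bound(1)
  by (rule heat_kernel_approximate_identity)

end

section \<open>Signed densities smoothed by the heat kernel\<close>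

lemma heat_kernel_at_infinity:
  assumes "0 < t" "filterlim x at_infinity F"
  shows "((\<lambda>i. heat_kernel t (x i :: 'a::euclidean_space)) \<longlongrightarrow> 0) F"
proof -
  obtain C where C: "\<And>x::'a. norm x ^ 1 * heat_kernel t x \<le> C"
    using heat_kernel_moment_bound[OF assms(1)] by blast
  have ev: "\<forall>\<^sub>F i in F. 1 \<le> norm (x i)"
    using assms(2) unfolding filterlim_at_infinity[of 0, OF order_refl] by (auto dest: spec[of _ 1])
  have "((\<lambda>i. C * inverse (norm (x i))) \<longlongrightarrow> C * 0) F"
    using assms(2) by (intro tendsto_intros tendsto_inverse_0_at_top filterlim_at_infinity_imp_norm_at_top)
  then have lim: "((\<lambda>i. C * inverse (norm (x i))) \<longlongrightarrow> 0) F" by simp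
  show ?thesis
  proof (rule tendsto_sandwich[OF _ _ tendsto_const lim])
    show "\<forall>\<^sub>F i in F. heat_kernel t (x i) \<le> C * inverse (norm (x i))"
      using ev
    proof eventually_elim
      case (elim i)
      then have "0 < norm (x i)" by linarith
      then show ?case using C[of "x i"] by (simp add: field_simps)
    qed
  qed simp
qed

text \<open>
  A finite signed measure with density \<open>\<sigma>\<close> relative to \<open>M\<close>; below, \<open>M\<close> is the total variation measure
  and \<open>\<sigma>\<close> the sign.
\<close>

locale signed_density = finite_measure M
  for M :: "'a::euclidean_space measure" +
  fixes \<sigma> :: "'a \<Rightarrow> real"
  assumes sets_M [measurable_cong]: "sets M = sets borel"
    and \<sigma>_measurable [measurable]: "\<sigma> \<in> borel_measurable borel"
    and \<sigma>_bound: "\<bar>\<sigma> x\<bar> \<le> 1"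
begin

abbreviation MM :: "('a \<times> 'a) measure" where "MM \<equiv> M \<Otimes>\<^sub>M M"

definition weight :: "'a \<times> 'a \<Rightarrow> real" where "weight p = \<sigma> (fst p) * \<sigma> (snd p)"

lemma sets_MM [measurable_cong]: "sets MM = sets (borel \<Otimes>\<^sub>M borel)"
  by (intro sets_pair_measure_cong sets_M)

lemma weight_measurable [measurable]: "weight \<in> borel_measurable MM"
  unfolding weight_def[abs_def] by measurable

lemma weight_bound: "\<bar>weight p\<bar> \<le> 1"
  unfolding weight_def abs_mult by (intro mult_le_one \<sigma>_bound) auto

lemma abs_weight_mult_le: "\<bar>weight p * y\<bar> \<le> \<bar>y\<bar>"
  using weight_bound[of p] by (simp add: abs_mult mult_left_le_one_le)

lemma abs_weight_heat_kernel_le: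
  assumes "0 < t" shows "\<bar>weight p * heat_kernel t (v::'a)\<bar> \<le> heat_kernel t (0::'a)"
  using order_trans[OF abs_weight_mult_le[of p "heat_kernel t v"], of "heat_kernel t (0::'a)"]
    heat_kernel_le_0[OF assms, of v] by simp

sublocale MM: finite_measure MM
  by (intro finite_measure_pair_measure) (rule finite_measure_axioms)+

sublocale pair: pair_sigma_finite M M ..

sublocale pair_lebesgue: pair_sigma_finite MM "lborel :: 'a measure" ..

sublocale single_lebesgue: pair_sigma_finite M "lborel :: 'a measure" ..

lemma bounded_integrable:
  fixes f :: "'a \<Rightarrow> real"
  assumes "f \<in> borel_measurable borel" "\<And>x. \<bar>f x\<bar> \<le> B" shows "integrable M f"
proof (rule integrable_const_bound)
  show "f \<in> borel_measurable M" using assms(1) by measurable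
qed (use assms(2) in auto)

lemma bounded_integrable_MM:
  fixes f :: "'a \<times> 'a \<Rightarrow> real"
  assumes "f \<in> borel_measurable MM" "\<And>x. \<bar>f x\<bar> \<le> B" shows "integrable MM f"
  by (rule MM.integrable_const_bound[where B = B, OF _ assms(1)]) (use assms(2) in auto)

definition autocorrelation :: "real \<Rightarrow> 'a \<Rightarrow> real" where
  "autocorrelation t z = (\<integral>p. weight p * heat_kernel t (fst p - snd p - z) \<partial>MM)"

definition heat_flow :: "real \<Rightarrow> 'a \<Rightarrow> real" where
  "heat_flow t u = (\<integral>x. \<sigma> x * heat_kernel t (x - u) \<partial>M)"

lemma heat_flow_measurable [measurable]: "heat_flow t \<in> borel_measurable borel"
  unfolding heat_flow_def[abs_def] by measurable

lemma heat_flow_integrand_integrable: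
  assumes "0 < t" shows "integrable M (\<lambda>x. \<sigma> x * heat_kernel t (x - u))"
proof (rule bounded_integrable)
  show "\<bar>\<sigma> x * heat_kernel t (x - u)\<bar> \<le> 1 * heat_kernel t (0::'a)" for x
    unfolding abs_mult using \<sigma>_bound[of x] heat_kernel_le_0[OF assms, of "x - u"] by (intro mult_mono) auto
qed measurable

lemma heat_flow_bounded:
  assumes "0 < t" shows "\<bar>heat_flow t u\<bar> \<le> heat_kernel t (0::'a) * measure M (space M)"
proof -
  have "\<bar>heat_flow t u\<bar> \<le> (\<integral>x. \<bar>\<sigma> x * heat_kernel t (x - u)\<bar> \<partial>M)"
    unfolding heat_flow_def by (rule integral_abs_bound)
  also have "\<dots> \<le> (\<integral>x. heat_kernel t (0::'a) \<partial>M)"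
  proof (rule integral_mono)
    show "\<bar>\<sigma> x * heat_kernel t (x - u)\<bar> \<le> heat_kernel t (0::'a)" for x
      using mult_mono[OF \<sigma>_bound[of x] heat_kernel_le_0[OF assms, of "x - u"]] by (simp add: abs_mult)
  qed (use heat_flow_integrand_integrable[OF assms] in auto)
  also have "\<dots> = heat_kernel t (0::'a) * measure M (space M)" by simp
  finally show ?thesis .
qed

lemma heat_flow_product_integrable:
  fixes h :: "'a \<Rightarrow> real"
  assumes t: "0 < t" and h [measurable]: "h \<in> borel_measurable borel" and B: "\<And>u. \<bar>h u\<bar> \<le> B"
  shows "integrable (M \<Otimes>\<^sub>M lborel) (\<lambda>(x, u). \<sigma> x * heat_kernel t (x - u) * h u)"
proof (rule single_lebesgue.Fubini_integrable)
  have [measurable]: "(\<lambda>(x, u). \<sigma> x * heat_kernel t (x - u) * h u) \<in> borel_measurable (borel \<Otimes>\<^sub>M borel)"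
    by measurable
  show "(\<lambda>(x, u). \<sigma> x * heat_kernel t (x - u) * h u) \<in> borel_measurable (M \<Otimes>\<^sub>M lborel)" by measurable
  have B0: "0 \<le> B" using B[of 0] by linarith
  have le: "\<bar>\<sigma> x * heat_kernel t (x - u) * h u\<bar> \<le> B * heat_kernel t (x - u)" for x u
  proof -
    have "\<bar>\<sigma> x\<bar> * heat_kernel t (x - u) * \<bar>h u\<bar> \<le> 1 * heat_kernel t (x - u) * B"
      by (intro mult_mono \<sigma>_bound B) auto
    then show ?thesis by (simp add: abs_mult mult.commute)
  qed
  have int: "integrable lborel (\<lambda>u. \<sigma> x * heat_kernel t (x - u) * h u)" for x
  proof (rule Bochner_Integration.integrable_bound)
    show "integrable lborel (\<lambda>u. B * heat_kernel t (x - u))"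
      using heat_kernel_translate_integral[OF t, of x] by simp
    show "AE u in lborel. norm (\<sigma> x * heat_kernel t (x - u) * h u) \<le> norm (B * heat_kernel t (x - u))"
      using le[of x] B0 by (auto simp: abs_mult[of B])
  qed measurable
  show "AE x in M. integrable lborel (\<lambda>u. (\<lambda>(x, u). \<sigma> x * heat_kernel t (x - u) * h u) (x, u))"
    using int by simp
  show "integrable M (\<lambda>x. \<integral>u. norm ((\<lambda>(x, u). \<sigma> x * heat_kernel t (x - u) * h u) (x, u)) \<partial>lborel)"
  proof (rule bounded_integrable)
    show "\<bar>\<integral>u. norm ((\<lambda>(x, u). \<sigma> x * heat_kernel t (x - u) * h u) (x, u)) \<partial>lborel\<bar> \<le> B" for x
    proof -
      have "(\<integral>u. \<bar>\<sigma> x * heat_kernel t (x - u) * h u\<bar> \<partial>lborel) \<le> (\<integral>u. B * heat_kernel t (x - u) \<partial>lborel)"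
        using int[of x] le[of x] heat_kernel_translate_integral[OF t, of x] by (intro integral_mono) auto
      also have "\<dots> = B" using heat_kernel_translate_integral[OF t, of x] by simp
      finally show ?thesis by simp
    qed
  qed measurable
qed

lemma integral_against_heat_flow:
  fixes h :: "'a \<Rightarrow> real"
  assumes t: "0 < t" and h [measurable]: "h \<in> borel_measurable borel" and B: "\<And>u. \<bar>h u\<bar> \<le> B"
  shows "integrable lborel (\<lambda>u. heat_flow t u * h u)"
    and "(\<integral>u. heat_flow t u * h u \<partial>lborel) = (\<integral>x. \<sigma> x * (\<integral>u. h u * heat_kernel t (x - u) \<partial>lborel) \<partial>M)"
proof -
  note I = heat_flow_product_integrable[OF assms]
  have eq: "(\<integral>x. \<sigma> x * heat_kernel t (x - u) * h u \<partial>M) = heat_flow t u * h u" for u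
    by (simp add: heat_flow_def)
  show "integrable lborel (\<lambda>u. heat_flow t u * h u)"
    using single_lebesgue.integrable_snd[OF I] unfolding eq .
  have "(\<integral>u. heat_flow t u * h u \<partial>lborel) = (\<integral>x. (\<integral>u. \<sigma> x * heat_kernel t (x - u) * h u \<partial>lborel) \<partial>M)"
    using single_lebesgue.integral_snd[OF I] single_lebesgue.integral_fst[OF I] unfolding eq by simp
  then show "(\<integral>u. heat_flow t u * h u \<partial>lborel) = (\<integral>x. \<sigma> x * (\<integral>u. h u * heat_kernel t (x - u) \<partial>lborel) \<partial>M)"
    by (simp add: mult.assoc mult.commute[of "heat_kernel _ _"])
qed

lemma heat_flow_square_integrable:
  assumes "0 < t" shows "integrable lborel (\<lambda>u. heat_flow t u * heat_flow t (u - z))"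
  by (rule integral_against_heat_flow(1)[OF assms _ heat_flow_bounded[OF assms]]) measurable

text \<open>
  Fubini and the semigroup law \<open>p\<^bsub>2t\<^esub>(x - y - z) = \<integral> p\<^sub>t(x - u) p\<^sub>t(y - (u - z)) du\<close>.
\<close>

lemma autocorrelation_eq:
  assumes t: "0 < t"
  shows "autocorrelation (2 * t) z = (\<integral>u. heat_flow t u * heat_flow t (u - z) \<partial>lborel)"
proof -
  have inner: "(\<integral>u. heat_flow t (u - z) * heat_kernel t (x - u) \<partial>lborel) = (\<integral>y. \<sigma> y * heat_kernel (2 * t) (x - y - z) \<partial>M)" for x
  proof -
    have "(\<integral>u. heat_flow t (u - z) * heat_kernel t (x - u) \<partial>lborel)
        = (\<integral>u. (\<lambda>u. heat_flow t u * heat_kernel t (x - z - u)) (u + - z) \<partial>lborel)"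
      by (simp add: algebra_simps)
    also have "\<dots> = (\<integral>u. heat_flow t u * heat_kernel t (x - z - u) \<partial>lborel)"
      by (rule lborel_integral_translate)
    also have "\<dots> = (\<integral>y. \<sigma> y * (\<integral>u. heat_kernel t (x - z - u) * heat_kernel t (y - u) \<partial>lborel) \<partial>M)"
      by (rule integral_against_heat_flow(2)[OF t, where B = "heat_kernel t (0::'a)"])
        (use heat_kernel_le_0[OF t] in auto)
    also have "\<dots> = (\<integral>y. \<sigma> y * heat_kernel (2 * t) (x - z - y) \<partial>M)"
      by (simp only: heat_kernel_semigroup(2)[OF t])
    also have "\<dots> = (\<integral>y. \<sigma> y * heat_kernel (2 * t) (x - y - z) \<partial>M)" by (simp add: algebra_simps)
    finally show ?thesis .
  qed
  have "(\<integral>u. heat_flow t u * heat_flow t (u - z) \<partial>lborel)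
      = (\<integral>x. \<sigma> x * (\<integral>u. heat_flow t (u - z) * heat_kernel t (x - u) \<partial>lborel) \<partial>M)"
    by (rule integral_against_heat_flow(2)[OF t _ heat_flow_bounded[OF t]]) measurable
  also have "\<dots> = (\<integral>x. \<sigma> x * (\<integral>y. \<sigma> y * heat_kernel (2 * t) (x - y - z) \<partial>M) \<partial>M)"
    by (simp only: inner)
  also have "\<dots> = autocorrelation (2 * t) z"
  proof -
    have I: "integrable MM (\<lambda>(x, y). \<sigma> x * (\<sigma> y * heat_kernel (2 * t) (x - y - z)))"
    proof (rule bounded_integrable_MM)
      show "(\<lambda>(x, y). \<sigma> x * (\<sigma> y * heat_kernel (2 * t) (x - y - z))) \<in> borel_measurable MM" by measurable
      have "0 < 2 * t" using t by simp
      from abs_weight_heat_kernel_le[OF this]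
      show "\<bar>case p of (x, y) \<Rightarrow> \<sigma> x * (\<sigma> y * heat_kernel (2 * t) (x - y - z))\<bar> \<le> heat_kernel (2 * t) (0::'a)" for p
        by (simp add: case_prod_beta' weight_def mult.assoc)
    qed
    show ?thesis using pair.integral_fst[OF I]
      by (simp add: autocorrelation_def weight_def case_prod_beta' mult.assoc)
  qed
  finally show ?thesis by simp
qed

lemma autocorrelation_0: 
  assumes "0 < t" shows "autocorrelation (2 * t) 0 = (\<integral>u. (heat_flow t u)\<^sup>2 \<partial>lborel)"
  using autocorrelation_eq[OF assms, of 0] by (simp add: power2_eq_square)

lemma autocorrelation_le:
  assumes "0 < t" shows "\<bar>autocorrelation t z\<bar> \<le> autocorrelation t 0"
proof -
  have t: "0 < t / 2" using assms by simp
  let ?f = "heat_flow (t / 2)"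
  have sq: "integrable lborel (\<lambda>u. ?f u * ?f u)" using heat_flow_square_integrable[OF t, of 0] by simp
  have sqz: "integrable lborel (\<lambda>u. ?f (u - z) * ?f (u - z))"
    "(\<integral>u. ?f (u - z) * ?f (u - z) \<partial>lborel) = (\<integral>u. ?f u * ?f u \<partial>lborel)"
    using lborel_integrable_translate[OF sq, of "- z"] lborel_integral_translate[of "\<lambda>u. ?f u * ?f u" "- z"] by simp_all
  have "\<bar>\<integral>u. ?f u * ?f (u - z) \<partial>lborel\<bar> \<le> (\<integral>u. \<bar>?f u * ?f (u - z)\<bar> \<partial>lborel)" by (rule integral_abs_bound)
  also have "\<dots> \<le> (\<integral>u. (?f u * ?f u + ?f (u - z) * ?f (u - z)) / 2 \<partial>lborel)"
  proof (rule integral_mono)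
    show "\<bar>?f u * ?f (u - z)\<bar> \<le> (?f u * ?f u + ?f (u - z) * ?f (u - z)) / 2" for u
    proof -
      have "0 \<le> (\<bar>?f u\<bar> - \<bar>?f (u - z)\<bar>)\<^sup>2" by simp
      then show ?thesis by (simp add: power2_diff abs_mult power2_eq_square[symmetric])
    qed
  qed (use sq sqz heat_flow_square_integrable[OF t, of z] in auto)
  also have "\<dots> = (\<integral>u. ?f u * ?f u \<partial>lborel)" using sq sqz by simp
  finally show ?thesis using autocorrelation_eq[OF t, of z] autocorrelation_eq[OF t, of 0] by simp
qed

lemma autocorrelation_at_infinity:
  assumes t: "0 < t" and z: "filterlim z at_infinity sequentially"
  shows "(\<lambda>n. autocorrelation t (z n)) \<longlonglongrightarrow> 0"
proof -
  have "(\<lambda>n. autocorrelation t (z n)) \<longlonglongrightarrow> (\<integral>p. 0 \<partial>MM)"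
    unfolding autocorrelation_def
  proof (rule integral_dominated_convergence)
    show "integrable MM (\<lambda>p. heat_kernel t (0::'a))" by simp
    show "AE p in MM. (\<lambda>n. weight p * heat_kernel t (fst p - snd p - z n)) \<longlonglongrightarrow> 0"
    proof (intro AE_I2)
      fix p
      have "filterlim (\<lambda>n. (fst p - snd p) + - z n) at_infinity sequentially"
        using z by (intro tendsto_add_filterlim_at_infinity[OF tendsto_const])
          (simp add: filterlim_at_infinity_conv_norm_at_top)
      from heat_kernel_at_infinity[OF t this]
      show "(\<lambda>n. weight p * heat_kernel t (fst p - snd p - z n)) \<longlonglongrightarrow> 0"
        by (intro tendsto_mult_right_zero) simp
    qed
    show "AE p in MM. norm (weight p * heat_kernel t (fst p - snd p - z n)) \<le> heat_kernel t (0::'a)" for n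
      using abs_weight_heat_kernel_le[OF t] by (intro AE_I2) simp
  qed measurable
  then show ?thesis by simp
qed

text \<open>
  \<open>autocorrelation (2 t) 0\<close> is the squared \<open>L\<^sup>2\<close> norm of \<open>heat_flow t\<close>, so the flow vanishes almost
  everywhere for all \<open>t > 0\<close>. Testing against \<open>h\<close> moves the kernel to \<open>h\<close>, and \<open>p\<^sub>t * h \<rightarrow> h\<close> as
  \<open>t \<rightarrow> 0\<close>.
\<close>

lemma heat_flow_determines:
  assumes zero: "\<And>t. 0 < t \<Longrightarrow> autocorrelation t 0 = 0"
    and h: "continuous_on UNIV h" "\<And>x. \<bar>h x\<bar> \<le> B"
  shows "(\<integral>x. \<sigma> x * h x \<partial>M) = 0"
proof -
  have [measurable]: "h \<in> borel_measurable borel" using h(1) by (rule borel_measurable_continuous_onI)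
  have B0: "0 \<le> B" using h(2)[of 0] by linarith
  have fz: "(\<integral>x. \<sigma> x * (\<integral>u. h u * heat_kernel t (x - u) \<partial>lborel) \<partial>M) = 0" if t: "0 < t" for t
  proof -
    have "integrable lborel (\<lambda>u. (heat_flow t u)\<^sup>2)"
      using heat_flow_square_integrable[OF t, of 0] by (simp add: power2_eq_square)
    moreover have "(\<integral>u. (heat_flow t u)\<^sup>2 \<partial>lborel) = 0"
      using zero[of "2 * t"] t by (simp add: autocorrelation_0)
    ultimately have "AE u in lborel. (heat_flow t u)\<^sup>2 = 0"
      by (subst integral_nonneg_eq_0_iff_AE[symmetric]) auto
    then have "(\<integral>u. heat_flow t u * h u \<partial>lborel) = (\<integral>u. 0 \<partial>(lborel :: 'a measure))"
      by (intro integral_cong_AE) (auto elim: eventually_mono)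
    then show ?thesis using integral_against_heat_flow(2)[OF t _ h(2)] by simp
  qed
  define \<epsilon> where "\<epsilon> n = 1 / real (Suc n)" for n
  have \<epsilon>: "0 < \<epsilon> n" for n by (simp add: \<epsilon>_def)
  have "\<epsilon> \<longlonglongrightarrow> 0" unfolding \<epsilon>_def[abs_def] by (rule LIMSEQ_Suc[OF lim_const_over_n])
  then have \<epsilon>0: "filterlim \<epsilon> (at_right 0) sequentially"
    using \<epsilon> by (intro tendsto_imp_filterlim_at_right) auto
  have hI: "integrable lborel (\<lambda>u. h u * heat_kernel t (x - u))" if "0 < t" for t x
  proof (rule Bochner_Integration.integrable_bound)
    show "integrable lborel (\<lambda>u. B * heat_kernel t (x - u))"
      using heat_kernel_translate_integral[OF that, of x] by simp
    show "AE u in lborel. norm (h u * heat_kernel t (x - u)) \<le> norm (B * heat_kernel t (x - u))"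
      using h(2) B0 by (auto simp: abs_mult intro!: mult_right_mono)
  qed measurable
  have "(\<lambda>n. \<integral>x. \<sigma> x * (\<integral>u. h u * heat_kernel (\<epsilon> n) (x - u) \<partial>lborel) \<partial>M) \<longlonglongrightarrow> (\<integral>x. \<sigma> x * h x \<partial>M)"
  proof (rule integral_dominated_convergence)
    show "integrable M (\<lambda>x. B)" by simp
    show "AE x in M. (\<lambda>n. \<sigma> x * (\<integral>u. h u * heat_kernel (\<epsilon> n) (x - u) \<partial>lborel)) \<longlonglongrightarrow> \<sigma> x * h x"
    proof (intro AE_I2 tendsto_mult tendsto_const)
      fix x
      have "isCont h x" using h(1) by (simp add: continuous_on_eq_continuous_at)
      from filterlim_compose[OF heat_kernel_approximate_identity[OF this hI] \<epsilon>0]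
      show "(\<lambda>n. \<integral>u. h u * heat_kernel (\<epsilon> n) (x - u) \<partial>lborel) \<longlonglongrightarrow> h x" by simp
    qed
    show "AE x in M. norm (\<sigma> x * (\<integral>u. h u * heat_kernel (\<epsilon> n) (x - u) \<partial>lborel)) \<le> B" for n
    proof (intro AE_I2)
      fix x
      have "\<bar>\<integral>u. h u * heat_kernel (\<epsilon> n) (x - u) \<partial>lborel\<bar> \<le> (\<integral>u. \<bar>h u * heat_kernel (\<epsilon> n) (x - u)\<bar> \<partial>lborel)"
        by (rule integral_abs_bound)
      also have "\<dots> \<le> (\<integral>u. B * heat_kernel (\<epsilon> n) (x - u) \<partial>lborel)"
        using integrable_abs[OF hI[OF \<epsilon>, of n x]] h(2) heat_kernel_translate_integral[OF \<epsilon>, of n x]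
        by (intro integral_mono) (auto simp: abs_mult intro!: mult_right_mono)
      also have "\<dots> = B" using heat_kernel_translate_integral[OF \<epsilon>, of n x] by simp
      finally have "\<bar>\<sigma> x\<bar> * \<bar>\<integral>u. h u * heat_kernel (\<epsilon> n) (x - u) \<partial>lborel\<bar> \<le> 1 * B"
        by (intro mult_mono \<sigma>_bound) auto
      then show "norm (\<sigma> x * (\<integral>u. h u * heat_kernel (\<epsilon> n) (x - u) \<partial>lborel)) \<le> B"
        by (simp add: abs_mult)
    qed
  qed measurable
  then show ?thesis by (simp add: fz[OF \<epsilon>] LIMSEQ_const_iff)
qed

end

section \<open>The regularised energy decreases in time\<close>

locale signed_energy = punctured_potential w G H b s C + signed_density M \<sigma>
  for w :: "'a::euclidean_space \<Rightarrow> real" and G H b s C and M :: "'a measure" and \<sigma>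
begin

definition smoothed_energy :: "real \<Rightarrow> real" where
  "smoothed_energy t = (\<integral>p. weight p * smoothed t (fst p - snd p) \<partial>MM)"

text \<open>
  The negative of the time derivative of the regularised energy.
\<close>

definition dissipation :: "real \<Rightarrow> real" where
  "dissipation t = (\<integral>z. lap z * (autocorrelation t 0 - (autocorrelation t z + autocorrelation t (- z)) / 2) \<partial>lborel)"

lemma smoothed_difference_measurable [measurable]: "(\<lambda>p. smoothed t (fst p - snd p)) \<in> borel_measurable MM"
  by measurable

lemma smoothed_energy_integrable:
  assumes "0 < t" shows "integrable MM (\<lambda>p. weight p * smoothed t (fst p - snd p))"
proof (rule bounded_integrable_MM)
  show "\<bar>weight p * smoothed t (fst p - snd p)\<bar> \<le> C * heat_kernel t (0::'a) * (\<integral>z. majorant b s (z::'a) \<partial>lborel) + C" for p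
    using smoothed_bounded[OF assms] by (rule order_trans[OF abs_weight_mult_le])
qed measurable

lemma heat_diff_measurable [measurable]:
  "(\<lambda>x. heat_diff t (fst (fst x) - snd (fst x)) (snd x)) \<in> borel_measurable (MM \<Otimes>\<^sub>M lborel)"
  unfolding heat_diff_def by measurable

text \<open>
  This justifies Fubini for the dissipation, and uses that the bound on \<open>heat_diff t v\<close> is uniform in
  \<open>v\<close>.
\<close>

lemma heat_diff_product_integrable:
  assumes t: "0 < t"
  shows "integrable (MM \<Otimes>\<^sub>M lborel) (\<lambda>(p, z). weight p * (lap z * heat_diff t (fst p - snd p) z))"
proof (rule pair_lebesgue.Fubini_integrable)
  have "(\<lambda>x. weight (fst x) * (lap (snd x) * heat_diff t (fst (fst x) - snd (fst x)) (snd x))) \<in> borel_measurable (MM \<Otimes>\<^sub>M lborel)"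
    by measurable
  then show m: "(\<lambda>(p, z). weight p * (lap z * heat_diff t (fst p - snd p) z)) \<in> borel_measurable (MM \<Otimes>\<^sub>M lborel)"
    by (simp add: case_prod_beta')
  obtain A where A: "\<And>v z::'a. \<bar>heat_diff t v z\<bar> \<le> A * min 1 (z \<bullet> z)"
    using heat_diff_bound[OF t] by blast
  have A0: "0 \<le> A"
  proof -
    obtain e :: 'a where "e \<in> Basis" using nonempty_Basis by blast
    then have "e \<bullet> e = 1" by simp
    then show ?thesis using A[of 0 e] by simp
  qed
  have le: "AE z in lborel. \<bar>weight p * (lap z * heat_diff t (fst p - snd p) z)\<bar> \<le> A * C * majorant b s z" for p
    using AE_nonzero
  proof eventually_elim
    case (elim z)
    have "\<bar>weight p * (lap z * heat_diff t (fst p - snd p) z)\<bar> \<le> lap z * \<bar>heat_diff t (fst p - snd p) z\<bar>"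
      using abs_weight_mult_le[of p "lap z * heat_diff t (fst p - snd p) z"] lap_nonneg[of z] by (simp add: abs_mult)
    also have "\<dots> \<le> lap z * (A * min 1 (z \<bullet> z))" using A lap_nonneg by (intro mult_left_mono) auto
    also have "\<dots> \<le> A * (C * majorant b s z)"
      using mult_left_mono[OF lap_bound[OF elim] A0] elim by (simp add: lap_def mult_ac)
    finally show ?case by (simp add: mult_ac)
  qed
  have int: "integrable lborel (\<lambda>z. weight p * (lap z * heat_diff t (fst p - snd p) z))" for p
    by (intro integrable_mult_right heat_diff_integral(1) t)
  then show "AE p in MM. integrable lborel (\<lambda>z. (\<lambda>(p, z). weight p * (lap z * heat_diff t (fst p - snd p) z)) (p, z))"
    by simp
  show "integrable MM (\<lambda>p. \<integral>z. norm ((\<lambda>(p, z). weight p * (lap z * heat_diff t (fst p - snd p) z)) (p, z)) \<partial>lborel)"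
  proof (rule bounded_integrable_MM)
    show "(\<lambda>p. \<integral>z. norm ((\<lambda>(p, z). weight p * (lap z * heat_diff t (fst p - snd p) z)) (p, z)) \<partial>lborel) \<in> borel_measurable MM"
      using m by measurable
    show "\<bar>\<integral>z. norm ((\<lambda>(p, z). weight p * (lap z * heat_diff t (fst p - snd p) z)) (p, z)) \<partial>lborel\<bar>
        \<le> (\<integral>z. A * C * majorant b s (z::'a) \<partial>lborel)" for p
    proof -
      have "(\<integral>z. \<bar>weight p * (lap z * heat_diff t (fst p - snd p) z)\<bar> \<partial>lborel) \<le> (\<integral>z. A * C * majorant b s (z::'a) \<partial>lborel)"
        using int[of p] le[of p] majorant_integrable by (intro integral_mono_AE) auto
      then show ?thesis by simp
    qed
  qed
qed

lemma autocorrelation_integrand_integrable: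
  assumes "0 < t" shows "integrable MM (\<lambda>p. weight p * heat_kernel t (fst p - snd p - z))"
  by (rule bounded_integrable_MM[OF _ abs_weight_heat_kernel_le[OF assms]]) measurable

lemma autocorrelation_heat_diff:
  assumes t: "0 < t"
  shows "(\<integral>p. weight p * (lap z * heat_diff t (fst p - snd p) z) \<partial>MM)
    = - (lap z * (autocorrelation t 0 - (autocorrelation t z + autocorrelation t (- z)) / 2))"
proof -
  have "weight p * (lap z * heat_diff t (fst p - snd p) z) = lap z *
      ((weight p * heat_kernel t (fst p - snd p - z) + weight p * heat_kernel t (fst p - snd p - - z)) / 2
        - weight p * heat_kernel t (fst p - snd p - 0))" for p
    by (simp add: heat_diff_def algebra_simps)
  then show ?thesis
    unfolding autocorrelation_def
    using autocorrelation_integrand_integrable[OF t, of z] autocorrelation_integrand_integrable[OF t, of "- z"]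
      autocorrelation_integrand_integrable[OF t, of 0]
    by (simp only: integral_mult_right_zero integral_divide_zero Bochner_Integration.integral_diff
        Bochner_Integration.integral_add Bochner_Integration.integrable_add integrable_divide_zero)
      (simp add: algebra_simps)
qed

lemma dissipation_eq:
  assumes t: "0 < t"
  shows "integrable lborel (\<lambda>z. lap z * (autocorrelation t 0 - (autocorrelation t z + autocorrelation t (- z)) / 2))"
    and "(\<integral>p. weight p * (\<integral>z. lap z * heat_diff t (fst p - snd p) z \<partial>lborel) \<partial>MM) = - dissipation t"
proof -
  note I = heat_diff_product_integrable[OF t]
  note eq = autocorrelation_heat_diff[OF t]
  have "integrable lborel (\<lambda>z. - (lap z * (autocorrelation t 0 - (autocorrelation t z + autocorrelation t (- z)) / 2)))"
    using pair_lebesgue.integrable_snd[OF I] unfolding eq .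
  then show "integrable lborel (\<lambda>z. lap z * (autocorrelation t 0 - (autocorrelation t z + autocorrelation t (- z)) / 2))"
    by simp
  have "(\<integral>p. \<integral>z. weight p * (lap z * heat_diff t (fst p - snd p) z) \<partial>lborel \<partial>MM) = - dissipation t"
    using pair_lebesgue.integral_snd[OF I] pair_lebesgue.integral_fst[OF I] unfolding eq dissipation_def by simp
  then show "(\<integral>p. weight p * (\<integral>z. lap z * heat_diff t (fst p - snd p) z \<partial>lborel) \<partial>MM) = - dissipation t"
    by simp
qed

lemma smoothed_energy_derivative:
  assumes t: "0 < t" shows "(smoothed_energy has_real_derivative - dissipation t) (at t)"
proof -
  obtain B where B: "\<And>u v. u \<in> {t/2..2*t} \<Longrightarrow> \<bar>smoothed u v - smoothed t v\<bar> \<le> B * \<bar>u - t\<bar>"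
    using smoothed_lipschitz_in_time[OF t] by blast
  have "((\<lambda>t. \<integral>p. weight p * smoothed t (fst p - snd p) \<partial>MM) has_real_derivative
      (\<integral>p. weight p * (\<integral>z. lap z * heat_diff t (fst p - snd p) z \<partial>lborel) \<partial>MM)) (at t)"
  proof (rule DERIV_integral_dominated[where a = "t/2" and b = "2*t" and B = "\<lambda>p. B"])
    show "integrable MM (\<lambda>p. weight p * smoothed u (fst p - snd p))" if "u \<in> {t/2..2*t}" for u
      using that t by (intro smoothed_energy_integrable) auto
    show "((\<lambda>u. weight p * smoothed u (fst p - snd p)) has_real_derivative
        weight p * (\<integral>z. lap z * heat_diff t (fst p - snd p) z \<partial>lborel)) (at t)" for p
      by (intro DERIV_cmult smoothed_time_derivative t)
    have "(\<lambda>x. lap (snd x) * heat_diff t (fst (fst x) - snd (fst x)) (snd x)) \<in> borel_measurable (MM \<Otimes>\<^sub>M lborel)"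
      by measurable
    then have [measurable]: "(\<lambda>p. \<integral>z. lap z * heat_diff t (fst p - snd p) z \<partial>lborel) \<in> borel_measurable MM"
      by (intro lborel.borel_measurable_lebesgue_integral) (simp add: case_prod_beta')
    show "(\<lambda>p. weight p * (\<integral>z. lap z * heat_diff t (fst p - snd p) z \<partial>lborel)) \<in> borel_measurable MM"
      by measurable
    show "\<bar>weight p * smoothed u (fst p - snd p) - weight p * smoothed t (fst p - snd p)\<bar> \<le> B * \<bar>u - t\<bar>"
      if "u \<in> {t/2..2*t}" for u p
      using order_trans[OF abs_weight_mult_le B[OF that]] by (simp add: right_diff_distrib[symmetric])
  qed (use t in auto)
  then show ?thesis unfolding smoothed_energy_def[abs_def] dissipation_eq(2)[OF t] .
qed

lemma dissipation_integrand_nonneg: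
  assumes "0 < t" shows "0 \<le> lap z * (autocorrelation t 0 - (autocorrelation t z + autocorrelation t (- z)) / 2)"
  using autocorrelation_le[OF assms, of z] autocorrelation_le[OF assms, of "- z"] lap_nonneg[of z]
  by (intro mult_nonneg_nonneg) (auto simp: abs_le_iff)

lemma dissipation_nonneg: "0 < t \<Longrightarrow> 0 \<le> dissipation t"
  unfolding dissipation_def by (intro integral_nonneg_AE AE_I2 dissipation_integrand_nonneg)

text \<open>
  The integrand is nonnegative, so \<open>A\<^sub>t(0) = (A\<^sub>t(z) + A\<^sub>t(-z)) / 2\<close> for almost all \<open>z\<close>, hence along some
  sequence with \<open>norm (z n) \<rightarrow> \<infinity>\<close>, where the right-hand side tends to 0.
\<close>

lemma dissipation_eq_0:
  assumes t: "0 < t" and "dissipation t = 0" shows "autocorrelation t 0 = 0"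
proof -
  have "AE z in lborel. lap z * (autocorrelation t 0 - (autocorrelation t z + autocorrelation t (- z)) / 2) = 0"
    using assms dissipation_eq(1)[OF t] dissipation_integrand_nonneg[OF t]
    unfolding dissipation_def by (subst integral_nonneg_eq_0_iff_AE[symmetric]) auto
  then have ae: "AE z in lborel. autocorrelation t 0 = (autocorrelation t z + autocorrelation t (- z)) / 2"
    using AE_nonzero by eventually_elim (use lap_pos in fastforce)
  have "\<exists>z. real n < norm z \<and> autocorrelation t 0 = (autocorrelation t z + autocorrelation t (- z)) / 2" for n
  proof (rule ccontr)
    assume none: "\<not> ?thesis"
    from ae have "AE z::'a in lborel. z \<notin> - cball 0 (real n)"
      by eventually_elim (use none in \<open>auto simp: not_le\<close>)
    then have "- cball 0 (real n) \<in> null_sets (lborel :: 'a measure)"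
      by (subst AE_iff_null_sets) auto
    then have "negligible (- cball (0::'a) (real n))"
      by (simp add: negligible_iff_null_sets null_sets_completionI)
    moreover have "open (- cball (0::'a) (real n))" by (simp add: open_Compl)
    moreover have "- cball (0::'a) (real n) \<noteq> {}"
      using bounded_cball[of "0::'a" "real n"] not_bounded_UNIV[where 'a = 'a] by (metis Compl_empty_eq double_complement)
    ultimately show False using open_not_negligible by blast
  qed
  then obtain z where z: "\<And>n. real n < norm (z n)"
    "\<And>n. autocorrelation t 0 = (autocorrelation t (z n) + autocorrelation t (- z n)) / 2" by metis
  have "filterlim (\<lambda>n. norm (z n)) at_top sequentially"
    using z(1) by (intro filterlim_at_top_mono[OF filterlim_real_sequentially]) (auto intro!: always_eventually less_imp_le)
  then have "filterlim z at_infinity sequentially" "filterlim (\<lambda>n. - z n) at_infinity sequentially"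
    by (simp_all add: filterlim_at_infinity_conv_norm_at_top)
  then have "(\<lambda>n. (autocorrelation t (z n) + autocorrelation t (- z n)) / 2) \<longlonglongrightarrow> (0 + 0) / 2"
    by (intro tendsto_intros autocorrelation_at_infinity t) auto
  then show ?thesis by (simp add: z(2)[symmetric] LIMSEQ_const_iff)
qed

lemma smoothed_energy_antimono:
  assumes "0 < u" "u \<le> t" shows "smoothed_energy t \<le> smoothed_energy u"
proof (rule DERIV_nonpos_imp_nonincreasing[OF assms(2)])
  fix x assume "u \<le> x" "x \<le> t"
  then show "\<exists>y. (smoothed_energy has_real_derivative y) (at x) \<and> y \<le> 0"
    using smoothed_energy_derivative[of x] dissipation_nonneg[of x] assms by (intro exI[of _ "- dissipation x"]) auto
qed

lemma smoothed_energy_vanishes: "(smoothed_energy \<longlongrightarrow> 0) at_top"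
proof (rule tendstoI)
  fix e :: real assume e: "0 < e"
  define m where "m = measure MM (space MM) + 1"
  have m: "0 < m" by (simp add: m_def add_nonneg_pos)
  have "\<forall>\<^sub>F t in at_top. \<forall>v. \<bar>smoothed t v\<bar> \<le> e / (2 * m)" using e m by (intro smoothed_vanishes) auto
  then show "\<forall>\<^sub>F t in at_top. dist (smoothed_energy t) 0 < e" using eventually_gt_at_top[of 0]
  proof eventually_elim
    case (elim t)
    have "\<bar>smoothed_energy t\<bar> \<le> (\<integral>p. \<bar>weight p * smoothed t (fst p - snd p)\<bar> \<partial>MM)"
      unfolding smoothed_energy_def by (rule integral_abs_bound)
    also have "\<dots> \<le> (\<integral>p. e / (2 * m) \<partial>MM)"
    proof (rule integral_mono)
      show "\<bar>weight p * smoothed t (fst p - snd p)\<bar> \<le> e / (2 * m)" for p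
        using elim(1) by (intro order_trans[OF abs_weight_mult_le]) auto
    qed (use smoothed_energy_integrable[OF elim(2)] in auto)
    also have "\<dots> = measure MM (space MM) * (e / (2 * m))" by simp
    also have "\<dots> \<le> m * (e / (2 * m))" using e m by (intro mult_right_mono) (auto simp: m_def)
    also have "\<dots> < e" using e m by simp
    finally show ?case by (simp add: dist_real_def)
  qed
qed

lemma smoothed_energy_nonneg:
  assumes "0 < u" shows "0 \<le> smoothed_energy u"
proof (rule tendsto_upperbound[OF smoothed_energy_vanishes])
  show "\<forall>\<^sub>F t in at_top. smoothed_energy t \<le> smoothed_energy u"
    using eventually_ge_at_top[of u] by eventually_elim (rule smoothed_energy_antimono[OF assms])
qed simp

text \<open>
  A decreasing nonnegative function with limit \<open>E \<le> 0\<close> at time 0 vanishes identically, and so does its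
  derivative.
\<close>

lemma smoothed_energy_limit_pos:
  assumes X: "filterlim X (at_right 0) sequentially"
    and lim: "(\<lambda>n. smoothed_energy (X n)) \<longlonglongrightarrow> E"
    and h: "continuous_on UNIV h" "\<And>x. \<bar>h x\<bar> \<le> B" "(\<integral>x. \<sigma> x * h x \<partial>M) \<noteq> 0"
  shows "0 < E"
proof (rule ccontr)
  assume "\<not> 0 < E"
  have le: "smoothed_energy t \<le> E" if "0 < t" for t
  proof (rule tendsto_lowerbound[OF lim])
    have "\<forall>\<^sub>F u in at_right 0. smoothed_energy t \<le> smoothed_energy u"
      using eventually_at_right_real[OF that] by eventually_elim (use smoothed_energy_antimono in auto)
    then show "\<forall>\<^sub>F n in sequentially. smoothed_energy t \<le> smoothed_energy (X n)"
      by (rule eventually_compose_filterlim[OF _ X])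
  qed simp
  have zero: "smoothed_energy t = 0" if "0 < t" for t
    using le[OF that] smoothed_energy_nonneg[OF that] \<open>\<not> 0 < E\<close> by linarith
  have "dissipation t = 0" if "0 < t" for t
  proof -
    have "((\<lambda>_. 0) has_real_derivative - dissipation t) (at t)"
      using smoothed_energy_derivative[OF that]
      by (rule has_field_derivative_transform_within_open[where S = "{0<..}"]) (use that zero in auto)
    then show ?thesis using DERIV_unique[OF DERIV_const[of "0::real"]] by fastforce
  qed
  then have "(\<integral>x. \<sigma> x * h x \<partial>M) = 0"
    by (intro heat_flow_determines[OF dissipation_eq_0 h(1,2)]) auto
  with h(3) show False by simp
qed

end

section \<open>Interaction energies as nonnegative integrals\<close>

text \<open>
  Adding a lower bound turns signed extended-real integrals into nonnegative ones.
\<close>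

lemma ereal_integral_bounded_below:
  fixes f :: "'a \<Rightarrow> ereal"
  assumes "finite_measure M" and [measurable]: "f \<in> borel_measurable M"
    and c: "0 \<le> c" and lb: "\<And>x. ereal (- c) \<le> f x"
  shows "ereal_integral M f = enn2ereal (\<integral>\<^sup>+x. e2ennreal (f x + ereal c) \<partial>M) - ereal (c * measure M (space M))"
proof -
  interpret finite_measure M by fact
  define X where "X = (\<integral>\<^sup>+x. e2ennreal (f x + ereal c) \<partial>M)"
  define A where "A = (\<integral>\<^sup>+x. e2ennreal (max 0 (f x)) \<partial>M)"
  define B where "B = (\<integral>\<^sup>+x. e2ennreal (max 0 (- f x)) \<partial>M)"
  have pt: "e2ennreal (f x + ereal c) + e2ennreal (max 0 (- f x)) = e2ennreal (max 0 (f x)) + ennreal c" for x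
  proof (cases "f x")
    case (real r)
    have "ennreal (r + c) + ennreal (max 0 (- r)) = ennreal (max 0 r) + ennreal c"
      using c lb[of x] real by (auto simp: ennreal_plus[symmetric] max_def simp del: ennreal_plus)
    moreover have "e2ennreal (max 0 (ereal u)) = ennreal (max 0 u)" for u
      by (metis e2ennreal_ereal ereal_max zero_ereal_def)
    ultimately show ?thesis using real by simp
  qed (use lb[of x] in \<open>auto simp: max_def\<close>)
  have B: "B \<le> ennreal (c * measure M (space M))"
  proof -
    have "e2ennreal (max 0 (- f x)) \<le> ennreal c" for x
    proof -
      have "- f x \<le> ereal c" using lb[of x] by (cases "f x") auto
      then have "max 0 (- f x) \<le> ereal c" using c by simp
      then show ?thesis by (metis e2ennreal_ereal e2ennreal_mono)
    qed
    then have "B \<le> (\<integral>\<^sup>+x. ennreal c \<partial>M)" unfolding B_def by (intro nn_integral_mono)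
    then show ?thesis using c by (simp add: emeasure_eq_measure ennreal_mult)
  qed
  have "X + B = A + ennreal (c * measure M (space M))"
  proof -
    have "X + B = (\<integral>\<^sup>+x. e2ennreal (f x + ereal c) + e2ennreal (max 0 (- f x)) \<partial>M)"
      unfolding X_def B_def by (subst nn_integral_add) auto
    also have "\<dots> = (\<integral>\<^sup>+x. e2ennreal (max 0 (f x)) + ennreal c \<partial>M)" by (simp only: pt)
    also have "\<dots> = A + ennreal (c * measure M (space M))"
      unfolding A_def using c by (subst nn_integral_add) (auto simp: emeasure_eq_measure ennreal_mult)
    finally show ?thesis .
  qed
  then have "enn2ereal X + enn2ereal B = enn2ereal A + ereal (c * measure M (space M))"
    using c by (metis enn2ereal_ennreal measure_nonneg mult_nonneg_nonneg plus_ennreal.rep_eq)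
  moreover have "enn2ereal B \<noteq> \<infinity>" using B by (metis ennreal_neq_top enn2ereal_eq_top_iff infinity_ereal_def top_ereal_def top_unique)
  moreover have "enn2ereal B \<ge> 0" "enn2ereal A \<ge> 0" "enn2ereal X \<ge> 0" by auto
  ultimately have "enn2ereal A - enn2ereal B = enn2ereal X - ereal (c * measure M (space M))"
    by (cases "enn2ereal A"; cases "enn2ereal B"; cases "enn2ereal X") auto
  then show ?thesis unfolding ereal_integral_def A_def B_def X_def by simp
qed

lemma interaction_bounded_below:
  fixes W :: "'a::euclidean_space \<Rightarrow> ereal"
  assumes P: "finite_measure P" "sets P = sets borel" and N: "finite_measure N" "sets N = sets borel"
    and W [measurable]: "W \<in> borel_measurable borel" and c: "0 \<le> c" and lb: "\<And>x. ereal (- c) \<le> W x"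
  shows "interaction W P N = enn2ereal (\<integral>\<^sup>+y. \<integral>\<^sup>+x. e2ennreal (W (x - y) + ereal c) \<partial>P \<partial>N)
    - ereal (c * measure P (space P) * measure N (space N))"
proof -
  interpret P: finite_measure P by fact
  interpret N: finite_measure N by fact
  note [measurable_cong] = P(2) N(2)
  define J where "J y = (\<integral>\<^sup>+x. e2ennreal (W (x - y) + ereal c) \<partial>P)" for y
  have "(\<lambda>(y, x). e2ennreal (W (x - y) + ereal c)) \<in> borel_measurable (N \<Otimes>\<^sub>M P)" by measurable
  then have [measurable]: "J \<in> borel_measurable N"
    unfolding J_def by (rule P.borel_measurable_nn_integral)
  define k where "k = c * measure P (space P)"
  have k: "0 \<le> k" using c by (simp add: k_def)
  have "ereal_integral P (\<lambda>x. W (x - y)) = enn2ereal (J y) - ereal k" for y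
    unfolding J_def k_def by (rule ereal_integral_bounded_below[OF P(1) _ c lb]) measurable
  moreover have cancel: "enn2ereal (J y) - ereal k + ereal k = enn2ereal (J y)" for y
    by (cases "enn2ereal (J y)") auto
  ultimately have "interaction W P N = ereal_integral N (\<lambda>y. enn2ereal (J y) - ereal k)"
    by (simp add: interaction_def)
  also have "\<dots> = enn2ereal (\<integral>\<^sup>+y. e2ennreal (enn2ereal (J y) - ereal k + ereal k) \<partial>N) - ereal (k * measure N (space N))"
  proof (rule ereal_integral_bounded_below[OF N(1) _ k])
    show "ereal (- k) \<le> enn2ereal (J y) - ereal k" for y
      using enn2ereal_nonneg[of "J y"] by (cases "enn2ereal (J y)") auto
  qed measurable
  finally show ?thesis unfolding cancel e2ennreal_enn2ereal by (simp add: J_def k_def)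
qed

text \<open>
  \<open>M = P + N\<close> is the total variation measure; both parts are densities of it, so that one product
  measure \<open>M \<Otimes>\<^sub>M M\<close> carries all four interactions.
\<close>

lemma sum_of_singular_measures:
  fixes P N :: "'a::topological_space measure"
  assumes P: "finite_measure P" "sets P = sets borel" "emeasure P (- S) = 0"
    and N: "finite_measure N" "sets N = sets borel" "emeasure N S = 0"
    and S: "S \<in> sets borel"
  obtains M where "finite_measure M" "sets M = sets borel"
    "P = density M (indicator S)" "N = density M (indicator (- S))"
proof -
  interpret P: finite_measure P by fact
  interpret N: finite_measure N by fact
  define M where "M = measure_of UNIV (sets borel) (\<lambda>A. emeasure P A + emeasure N A)"
  have sM: "sets M = sets borel" unfolding M_def by (metis sets.sets_measure_of_eq space_borel)
  have "countably_additive (sets borel) (\<lambda>A. emeasure P A + emeasure N A)"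
  proof (rule countably_additiveI)
    fix A :: "nat \<Rightarrow> 'a set" assume A: "range A \<subseteq> sets borel" "disjoint_family A"
    then show "(\<Sum>i. emeasure P (A i) + emeasure N (A i)) = emeasure P (\<Union>i. A i) + emeasure N (\<Union>i. A i)"
      using P(2) N(2) by (simp add: suminf_add[symmetric] suminf_emeasure)
  qed
  then have e: "emeasure M A = emeasure P A + emeasure N A" if "A \<in> sets borel" for A
    using that sM by (intro emeasure_measure_of[OF M_def]) (auto simp: positive_def)
  have "finite_measure M"
    by (rule finite_measureI) (simp add: e sets_eq_imp_space_eq[OF sM])
  have null: "emeasure P (A \<inter> - S) = 0" "emeasure N (A \<inter> S) = 0" if "A \<in> sets borel" for A
    using that S P(2,3) N(2,3) emeasure_mono[of "A \<inter> - S" "- S" P] emeasure_mono[of "A \<inter> S" S N] by auto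
  have split: "emeasure Q A = emeasure Q (A \<inter> S) + emeasure Q (A \<inter> - S)" if "A \<in> sets borel" "sets Q = sets borel" for A and Q :: "'a measure"
  proof -
    have "(A \<inter> S) \<union> (A \<inter> - S) = A" by auto
    then show ?thesis using that S by (subst plus_emeasure) auto
  qed
  have "P = density M (indicator S)"
  proof (rule measure_eqI)
    fix A assume "A \<in> sets P"
    then have A: "A \<in> sets borel" using P(2) by simp
    then have "emeasure (density M (indicator S)) A = emeasure M (A \<inter> S)"
      using S sM by (subst emeasure_density) (auto simp: indicator_inter_arith[symmetric] mult.commute)
    then show "emeasure P A = emeasure (density M (indicator S)) A"
      using A S null[OF A] split[OF A P(2)] by (simp add: e)
  qed (use P(2) sM in simp)
  moreover have "N = density M (indicator (- S))"
  proof (rule measure_eqI)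
    fix A assume "A \<in> sets N"
    then have A: "A \<in> sets borel" using N(2) by simp
    then have "emeasure (density M (indicator (- S))) A = emeasure M (A \<inter> - S)"
      using S sM by (subst emeasure_density) (auto simp: indicator_inter_arith[symmetric] mult.commute)
    then show "emeasure N A = emeasure (density M (indicator (- S))) A"
      using A S null[OF A] split[OF A N(2)] by (simp add: e)
  qed (use N(2) sM in simp)
  ultimately show ?thesis using that \<open>finite_measure M\<close> sM by blast
qed

lemma finite_measures_eq_if_open_eq:
  fixes P N :: "'a::topological_space measure"
  assumes "finite_measure P" "sets P = sets borel" "sets N = sets borel"
    and eq: "\<And>U. open U \<Longrightarrow> emeasure P U = emeasure N U"
  shows "P = N"
proof (rule measure_eqI_generator_eq[where E = "{U. open U}" and \<Omega> = UNIV and A = "\<lambda>_. UNIV"])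
  show "Int_stable {U::'a set. open U}" by (auto simp: Int_stable_def)
  show "emeasure P UNIV \<noteq> \<infinity>"
    using assms(1,2) by (metis finite_measure.emeasure_finite infinity_ennreal_def)
qed (use assms in \<open>auto simp: borel_def\<close>)

lemma open_indicator_limit:
  fixes U :: "'a::metric_space set"
  assumes "open U"
  obtains h :: "nat \<Rightarrow> 'a \<Rightarrow> real" where "\<And>n. continuous_on UNIV (h n)" "\<And>n x. \<bar>h n x\<bar> \<le> 1"
    "\<And>x. (\<lambda>n. h n x) \<longlonglongrightarrow> indicator U x"
proof (cases "U = UNIV")
  case True
  then show ?thesis by (intro that[of "\<lambda>_ _. 1"]) auto
next
  case False
  then have ne: "- U \<noteq> {}" and cl: "closed (- U)" using assms by auto
  define h where "h n x = min 1 (real n * infdist x (- U))" for n x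
  show ?thesis
  proof (rule that)
    show "continuous_on UNIV (h n)" for n unfolding h_def by (intro continuous_intros)
    show "\<bar>h n x\<bar> \<le> 1" for n x by (auto simp: h_def infdist_nonneg)
    show "(\<lambda>n. h n x) \<longlonglongrightarrow> indicator U x" for x
    proof (cases "x \<in> U")
      case True
      then have pos: "0 < infdist x (- U)"
        using in_closed_iff_infdist_zero[OF cl ne, of x] infdist_nonneg[of x "- U"] by auto
      obtain k where k: "1 < real k * infdist x (- U)" using reals_Archimedean3[OF pos] by blast
      have "h n x = 1" if "k \<le> n" for n
      proof -
        have "real k * infdist x (- U) \<le> real n * infdist x (- U)" using that pos by (intro mult_right_mono) auto
        then show ?thesis using k by (simp add: h_def)
      qed
      then have "\<forall>\<^sub>F n in sequentially. h n x = 1" by (auto simp: eventually_sequentially)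
      then show ?thesis using True by (simp add: tendsto_eventually)
    next
      case False
      then have "infdist x (- U) = 0" by simp
      then show ?thesis using False by (simp add: h_def)
    qed
  qed
qed

section \<open>Removing the regularisation\<close>

context punctured_potential
begin

text \<open>
  The differences \<open>v = x - y\<close> at which the regularised potential converges to \<open>w v\<close> and is
  dominated.
\<close>

definition regular_point :: "real \<Rightarrow> real \<Rightarrow> 'a \<Rightarrow> bool" where
  "regular_point c A v \<longleftrightarrow> isCont w v \<and> - c \<le> w v \<and>
     (\<forall>t. 0 < t \<and> t \<le> 1 \<longrightarrow> - c \<le> smoothed t v \<and> smoothed t v + c \<le> A * (1 + (w v + c)))"

end

context signed_energy
begin

text \<open>
  When \<open>\<sigma>\<close> is a sign, \<open>\<alpha>\<close> and \<open>\<beta>\<close> are the indicators of pairs with equal and with opposite signs. On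
  the \<open>\<alpha>\<close> part domination is available by assumption. On the \<open>\<beta>\<close> part integrability of \<open>w\<close> has to be
  proved first: positivity of the regularised energy bounds the \<open>\<beta>\<close> integral by the \<open>\<alpha>\<close> integral, and
  Fatou's lemma passes to the limit.
\<close>

lemma smoothed_energy_tendsto:
  assumes A: "0 \<le> A" and c: "0 \<le> c"
    and reg: "AE p in MM. regular_point c A (fst p - snd p)"
    and fin: "integrable MM (\<lambda>p. (1 + weight p) / 2 * w (fst p - snd p))"
    and X: "\<And>n. 0 < X n" "\<And>n. X n \<le> 1" "X \<longlonglongrightarrow> 0"
  shows "integrable MM (\<lambda>p. w (fst p - snd p))"
    and "(\<lambda>n. smoothed_energy (X n)) \<longlonglongrightarrow> (\<integral>p. weight p * w (fst p - snd p) \<partial>MM)"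
proof -
  define \<alpha> where "\<alpha> p = (1 + weight p) / 2" for p
  define \<beta> where "\<beta> p = (1 - weight p) / 2" for p
  have \<alpha>\<beta>: "0 \<le> \<alpha> p" "0 \<le> \<beta> p" "\<alpha> p \<le> 1" "\<beta> p \<le> 1" "\<alpha> p + \<beta> p = 1" "\<alpha> p - \<beta> p = weight p" for p
    using weight_bound[of p] by (auto simp: \<alpha>_def \<beta>_def abs_le_iff field_simps)
  have [measurable]: "\<alpha> \<in> borel_measurable MM" "\<beta> \<in> borel_measurable MM"
    unfolding \<alpha>_def[abs_def] \<beta>_def[abs_def] by measurable
  let ?w = "\<lambda>p. w (fst p - snd p)" and ?s = "\<lambda>n p. smoothed (X n) (fst p - snd p)"
  have [measurable]: "?w \<in> borel_measurable MM" by measurable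
  have sB: "\<exists>B. \<forall>p. \<bar>?s n p\<bar> \<le> B" for n using smoothed_bounded[OF X(1)] by blast
  have sI: "integrable MM (\<lambda>p. f p * (?s n p + c))" if "f \<in> borel_measurable MM" "\<And>p. \<bar>f p\<bar> \<le> 1" for f n
  proof -
    obtain B where B: "\<And>p. \<bar>?s n p\<bar> \<le> B" using sB by blast
    have "\<bar>f p * (?s n p + c)\<bar> \<le> 1 * (B + c)" for p
      unfolding abs_mult using that(2)[of p] B[of p] c by (intro mult_mono) auto
    moreover have "(\<lambda>p. f p * (?s n p + c)) \<in> borel_measurable MM"
      using that(1) by (intro borel_measurable_times borel_measurable_add smoothed_difference_measurable) auto
    ultimately show ?thesis by (intro bounded_integrable_MM)
  qed
  have absab: "\<bar>\<alpha> p\<bar> \<le> 1" "\<bar>\<beta> p\<bar> \<le> 1" for p using \<alpha>\<beta>[of p] by auto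
  have X0: "filterlim X (at_right 0) sequentially"
    using X by (intro tendsto_imp_filterlim_at_right) auto
  have lim: "(\<lambda>n. ?s n p) \<longlonglongrightarrow> ?w p" if "regular_point c A (fst p - snd p)" for p
    using filterlim_compose[OF smoothed_tendsto X0] that by (simp add: regular_point_def)
  have reg_le: "- c \<le> ?s n p" "?s n p + c \<le> A * (1 + (?w p + c))" "- c \<le> ?w p"
    if "regular_point c A (fst p - snd p)" for n p
    using that X(1,2)[of n] by (auto simp: regular_point_def)
  have \<alpha>I: "integrable MM (\<lambda>p. \<alpha> p * ?w p)" using fin by (simp add: \<alpha>_def)
  have \<alpha>1: "integrable MM \<alpha>" using absab by (intro bounded_integrable_MM) auto
  have \<alpha>D: "integrable MM (\<lambda>p. A * (\<alpha> p * (1 + c) + \<alpha> p * ?w p))" using \<alpha>I \<alpha>1 by simp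
  define K where "K = (\<integral>p. A * (\<alpha> p * (1 + c) + \<alpha> p * ?w p) \<partial>MM) + c * measure MM (space MM)"
  have \<beta>_le: "(\<integral>p. \<beta> p * (?s n p + c) \<partial>MM) \<le> K" for n
  proof -
    have "(\<integral>p. \<beta> p * (?s n p + c) \<partial>MM) = (\<integral>p. \<alpha> p * (?s n p + c) - weight p * (?s n p + c) \<partial>MM)"
      by (intro Bochner_Integration.integral_cong refl) (simp add: \<alpha>\<beta>(6)[symmetric] algebra_simps)
    also have "\<dots> = (\<integral>p. \<alpha> p * (?s n p + c) \<partial>MM) - (\<integral>p. weight p * (?s n p + c) \<partial>MM)"
      using absab weight_bound by (intro Bochner_Integration.integral_diff sI) auto
    finally have eq: "(\<integral>p. \<beta> p * (?s n p + c) \<partial>MM) = (\<integral>p. \<alpha> p * (?s n p + c) \<partial>MM) - (\<integral>p. weight p * (?s n p + c) \<partial>MM)" .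
    have "(\<integral>p. weight p * (?s n p + c) \<partial>MM) = smoothed_energy (X n) + (\<integral>p. weight p * c \<partial>MM)"
      unfolding smoothed_energy_def distrib_left
      using weight_bound by (intro Bochner_Integration.integral_add smoothed_energy_integrable X integrable_mult_left bounded_integrable_MM) auto
    moreover have "(\<integral>p. \<alpha> p * (?s n p + c) \<partial>MM) \<le> (\<integral>p. A * (\<alpha> p * (1 + c) + \<alpha> p * ?w p) \<partial>MM)"
    proof (intro integral_mono_AE sI \<alpha>D absab)
      show "AE p in MM. \<alpha> p * (?s n p + c) \<le> A * (\<alpha> p * (1 + c) + \<alpha> p * ?w p)"
        using reg
      proof eventually_elim
        case (elim p)
        from mult_left_mono[OF reg_le(2)[OF elim, of n] \<alpha>\<beta>(1)[of p]] show ?case by (simp add: algebra_simps)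
      qed
    qed measurable
    moreover have "- (\<integral>p. weight p * c \<partial>MM) \<le> c * measure MM (space MM)"
    proof -
      have "\<bar>\<integral>p. weight p * c \<partial>MM\<bar> \<le> (\<integral>p. \<bar>weight p * c\<bar> \<partial>MM)" by (rule integral_abs_bound)
      also have "\<dots> \<le> (\<integral>p. c \<partial>MM)"
        using weight_bound c abs_weight_mult_le[of _ c]
        by (intro integral_mono integrable_abs integrable_mult_left bounded_integrable_MM) auto
      finally show ?thesis by (simp add: mult.commute)
    qed
    ultimately show ?thesis using eq smoothed_energy_nonneg[OF X(1), of n] unfolding K_def by linarith
  qed
  have \<beta>I: "integrable MM (\<lambda>p. \<beta> p * (?w p + c))"
  proof (rule integrableI_bounded)
    have "(\<integral>\<^sup>+p. ennreal (norm (\<beta> p * (?w p + c))) \<partial>MM) = (\<integral>\<^sup>+p. liminf (\<lambda>n. ennreal (\<beta> p * (?s n p + c))) \<partial>MM)"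
    proof (rule nn_integral_cong_AE)
      show "AE p in MM. ennreal (norm (\<beta> p * (?w p + c))) = liminf (\<lambda>n. ennreal (\<beta> p * (?s n p + c)))"
        using reg
      proof eventually_elim
        case (elim p)
        have "(\<lambda>n. ennreal (\<beta> p * (?s n p + c))) \<longlonglongrightarrow> ennreal (\<beta> p * (?w p + c))"
          by (intro tendsto_ennrealI tendsto_intros lim[OF elim])
        then have "liminf (\<lambda>n. ennreal (\<beta> p * (?s n p + c))) = ennreal (\<beta> p * (?w p + c))"
          by (intro lim_imp_Liminf) auto
        moreover have "0 \<le> \<beta> p * (?w p + c)" using \<alpha>\<beta>(2)[of p] reg_le(3)[OF elim] by simp
        ultimately show ?case by simp
      qed
    qed
    also have "\<dots> \<le> liminf (\<lambda>n. \<integral>\<^sup>+p. ennreal (\<beta> p * (?s n p + c)) \<partial>MM)"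
      by (rule nn_integral_liminf) measurable
    also have "\<dots> \<le> liminf (\<lambda>n. ennreal K)"
    proof (intro Liminf_mono always_eventually allI)
      fix n
      have "(\<integral>\<^sup>+p. ennreal (\<beta> p * (?s n p + c)) \<partial>MM) = ennreal (\<integral>p. \<beta> p * (?s n p + c) \<partial>MM)"
      proof (rule nn_integral_eq_integral)
        show "AE p in MM. 0 \<le> \<beta> p * (?s n p + c)"
          using reg
        proof eventually_elim
          case (elim p)
          then show ?case using \<alpha>\<beta>(2)[of p] reg_le(1)[OF elim, of n] by (intro mult_nonneg_nonneg) auto
        qed
      qed (use absab in \<open>intro sI, auto\<close>)
      then show "(\<integral>\<^sup>+p. ennreal (\<beta> p * (?s n p + c)) \<partial>MM) \<le> ennreal K" using \<beta>_le by (simp add: ennreal_leI)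
    qed
    also have "\<dots> < \<infinity>" by (simp add: Liminf_const)
    finally show "(\<integral>\<^sup>+p. ennreal (norm (\<beta> p * (?w p + c))) \<partial>MM) < \<infinity>" .
  qed measurable
  show wI: "integrable MM ?w"
  proof -
    have "integrable MM (\<lambda>p. \<alpha> p * ?w p + (\<beta> p * (?w p + c) - \<beta> p * c))"
      by (intro Bochner_Integration.integrable_add Bochner_Integration.integrable_diff integrable_mult_left \<alpha>I \<beta>I)
        (use absab in \<open>intro bounded_integrable_MM, auto\<close>)
    moreover have "\<alpha> p * ?w p + (\<beta> p * (?w p + c) - \<beta> p * c) = ?w p" for p
    proof -
      have "\<alpha> p * ?w p + (\<beta> p * (?w p + c) - \<beta> p * c) = (\<alpha> p + \<beta> p) * ?w p"
        by (simp add: algebra_simps)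
      then show ?thesis by (simp only: \<alpha>\<beta>(5) mult_1_left)
    qed
    ultimately show ?thesis by simp
  qed
  show "(\<lambda>n. smoothed_energy (X n)) \<longlonglongrightarrow> (\<integral>p. weight p * ?w p \<partial>MM)"
    unfolding smoothed_energy_def
  proof (rule integral_dominated_convergence)
    show "integrable MM (\<lambda>p. A * (1 + (?w p + c)) + c)" using wI by simp
    show "AE p in MM. (\<lambda>n. weight p * ?s n p) \<longlonglongrightarrow> weight p * ?w p"
      using reg by eventually_elim (intro tendsto_intros lim)
    show "AE p in MM. norm (weight p * ?s n p) \<le> A * (1 + (?w p + c)) + c" for n
      using reg
    proof eventually_elim
      case (elim p)
      have "0 \<le> A * (1 + (?w p + c))" using A reg_le(3)[OF elim] by simp
      then have "\<bar>?s n p\<bar> \<le> A * (1 + (?w p + c)) + c"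
        using reg_le(1,2)[OF elim, of n] c by (auto simp: abs_le_iff)
      then show ?case using abs_weight_mult_le[of p "?s n p"] by simp
    qed
  qed measurable
qed

end

lemma bounded_up_to_constE:
  assumes "bounded_up_to_const S f g" obtains C where "C > 0" "\<And>x. x \<in> S \<Longrightarrow> f x \<le> C * g x"
  using assms unfolding bounded_up_to_const_def by blast

text \<open>
  The exponent \<open>s\<close> of the locale is \<open>a - 2\<close>, the decay of the Laplacian at infinity.
\<close>

lemma essentially_convex_potential:
  fixes W :: "'a::euclidean_space \<Rightarrow> ereal"
  assumes W: "essentially_convex W"
  obtains G H b s C where "punctured_potential (\<lambda>x. real_of_ereal (W x)) G H b s C"
proof -
  define w where "w x = real_of_ereal (W x)" for x
  let ?d = "real DIM('a)"
  from W have C2: "C2_on (- {0}) w" and lap: "\<And>x. x \<noteq> 0 \<Longrightarrow> laplacian w x > 0"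
    and ev: "\<And>x. W x = W (- x)"
    unfolding essentially_convex_def Let_def w_def[abs_def] W0_def by auto
  from W obtain b where b: "- ?d < b" "b < min (2 - ?d) 0" and nb: "power_growth {x. 0 < norm x \<and> norm x < 1} w b"
    unfolding essentially_convex_def Let_def w_def[abs_def] by auto
  from W obtain a where a: "- ?d < a" "a < min (2 - ?d) 0" and na: "power_growth {x. 1 \<le> norm x} w a"
    unfolding essentially_convex_def Let_def w_def[abs_def] by auto
  from C2 obtain G and H :: "'a \<Rightarrow> 'a \<Rightarrow>\<^sub>L 'a" where G: "\<And>x. x \<noteq> 0 \<Longrightarrow> GDERIV w x :> G x"
    and H: "\<And>x. x \<noteq> 0 \<Longrightarrow> (G has_derivative blinfun_apply (H x)) (at x)" and Hc: "continuous_on (- {0}) H"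
    unfolding C2_on_def by auto
  have gw: "gradient w x = G x" if "x \<noteq> 0" for x
    unfolding gradient_def
  proof (rule the_equality)
    fix D assume "GDERIV w x :> D"
    then have "(\<lambda>h. h \<bullet> D) = (\<lambda>h. h \<bullet> G x)"
      using G[OF that] has_derivative_unique unfolding gderiv_def by blast
    then show "D = G x" by (metis inner_commute vector_eq_rdot)
  qed (rule G[OF that])
  have lw: "laplacian w x = (\<Sum>e\<in>Basis. blinfun_apply (H x) e \<bullet> e)" if "x \<noteq> 0" for x
  proof -
    have "(gradient w has_derivative blinfun_apply (H x)) (at x)"
      by (rule has_derivative_transform_within_open[OF H[OF that], of "- {0}"]) (use that gw in auto)
    then have "frechet_derivative (gradient w) (at x) = blinfun_apply (H x)"
      by (metis frechet_derivative_at)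
    then show ?thesis by (simp add: laplacian_def)
  qed
  obtain B1 where B1: "B1 > 0" "\<And>x. x \<in> {x. 0 < norm x \<and> norm x < 1} \<Longrightarrow> \<bar>w x\<bar> \<le> B1 * norm x powr b"
    using nb unfolding power_growth_def by (auto elim: bounded_up_to_constE)
  obtain B2 where B2: "B2 > 0" "\<And>x. x \<in> {x. 0 < norm x \<and> norm x < 1} \<Longrightarrow> norm (gradient w x) \<le> B2 * norm x powr (b - 1)"
    using nb unfolding power_growth_def by (auto elim: bounded_up_to_constE)
  obtain B3 where B3: "B3 > 0" "\<And>x. x \<in> {x. 0 < norm x \<and> norm x < 1} \<Longrightarrow> \<bar>laplacian w x\<bar> \<le> B3 * norm x powr (b - 2)"
    using nb unfolding power_growth_def by (auto elim: bounded_up_to_constE)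
  obtain A1 where A1: "A1 > 0" "\<And>x. x \<in> {x. 1 \<le> norm x} \<Longrightarrow> \<bar>w x\<bar> \<le> A1 * norm x powr a"
    using na unfolding power_growth_def by (auto elim: bounded_up_to_constE)
  obtain A2 where A2: "A2 > 0" "\<And>x. x \<in> {x. 1 \<le> norm x} \<Longrightarrow> norm (gradient w x) \<le> A2 * norm x powr (a - 1)"
    using na unfolding power_growth_def by (auto elim: bounded_up_to_constE)
  obtain A3 where A3: "A3 > 0" "\<And>x. x \<in> {x. 1 \<le> norm x} \<Longrightarrow> \<bar>laplacian w x\<bar> \<le> A3 * norm x powr (a - 2)"
    using na unfolding power_growth_def by (auto elim: bounded_up_to_constE)
  define C where "C = B1 + B2 + B3 + A1 + A2 + A3"
  have C: "C > 0" "B1 \<le> C" "B2 \<le> C" "B3 \<le> C" "A1 \<le> C" "A2 \<le> C" "A3 \<le> C"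
    using A1(1) A2(1) A3(1) B1(1) B2(1) B3(1) by (auto simp: C_def)
  let ?m = "majorant b (a - 2) :: 'a \<Rightarrow> real"
  have mult: "x \<le> K * y \<Longrightarrow> K \<le> C \<Longrightarrow> 0 \<le> y \<Longrightarrow> x \<le> C * y" for x y K :: real
    by (meson mult_right_mono order_trans)
  have "\<bar>w z\<bar> * min 1 (z \<bullet> z) \<le> C * ?m z * (z \<bullet> z) \<and> norm (G z) * min 1 (z \<bullet> z) \<le> C * ?m z * norm z \<and>
      (\<Sum>e\<in>Basis. blinfun_apply (H z) e \<bullet> e) * min 1 (z \<bullet> z) \<le> C * ?m z" if z: "z \<noteq> 0" for z
  proof (cases "norm z < 1")
    case True
    let ?r = "norm z"
    have r: "0 < ?r" using z by simp
    have zz: "z \<bullet> z = ?r * ?r" by (simp add: power2_norm_eq_inner[symmetric] power2_eq_square)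
    have "?r * ?r \<le> 1" using True r by (simp add: mult_le_one)
    then have min: "min 1 (?r * ?r) = ?r * ?r" by simp
    have p: "?r powr (b - 1) * ?r = ?r powr b" "?r powr (b - 2) * (?r * ?r) = ?r powr b"
      using r by (simp_all add: powr_diff power2_eq_square)
    have "\<bar>w z\<bar> \<le> C * ?r powr b" "norm (G z) \<le> C * ?r powr (b - 1)"
      "(\<Sum>e\<in>Basis. blinfun_apply (H z) e \<bullet> e) \<le> C * ?r powr (b - 2)"
      using B1(2)[of z] B2(2)[of z] order_trans[OF abs_ge_self B3(2)[of z]] r True C gw[OF z] lw[OF z]
      by (auto intro: mult)
    then have "\<bar>w z\<bar> * (?r * ?r) \<le> C * ?r powr b * (?r * ?r)" "norm (G z) * (?r * ?r) \<le> C * ?r powr (b - 1) * (?r * ?r)"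
      "(\<Sum>e\<in>Basis. blinfun_apply (H z) e \<bullet> e) * (?r * ?r) \<le> C * ?r powr (b - 2) * (?r * ?r)"
      by (auto intro!: mult_right_mono)
    moreover have "C * ?r powr (b - 1) * (?r * ?r) = C * ?r powr b * ?r" by (simp add: p(1)[symmetric])
    moreover have "C * ?r powr (b - 2) * (?r * ?r) = C * ?r powr b" by (simp add: p(2)[symmetric])
    ultimately show ?thesis using True by (simp add: min zz majorant_def)
  next
    case False
    let ?r = "norm z"
    have r: "1 \<le> ?r" "0 < ?r" using False by auto
    have zz: "z \<bullet> z = ?r * ?r" by (simp add: power2_norm_eq_inner[symmetric] power2_eq_square)
    have "1 \<le> ?r * ?r" using r mult_mono[of 1 ?r 1 ?r] by simp
    then have min: "min 1 (?r * ?r) = 1" by simp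
    have p: "?r powr (a - 2) * ?r = ?r powr (a - 1)" "?r powr (a - 2) * (?r * ?r) = ?r powr a"
      using r by (simp_all add: powr_diff power2_eq_square)
    have "\<bar>w z\<bar> \<le> C * ?r powr a" "norm (G z) \<le> C * ?r powr (a - 1)"
      "(\<Sum>e\<in>Basis. blinfun_apply (H z) e \<bullet> e) \<le> C * ?r powr (a - 2)"
      using A1(2)[of z] A2(2)[of z] order_trans[OF abs_ge_self A3(2)[of z]] r C gw[OF z] lw[OF z]
      by (auto intro: mult)
    then show ?thesis using False by (simp add: min zz majorant_def mult.assoc p)
  qed
  note bounds = this
  have "punctured_potential w G (\<lambda>x. blinfun_apply (H x)) b (a - 2) C"
  proof
    show "w (- z) = w z" for z using ev[of z] by (simp add: w_def)
    show "(w has_derivative (\<lambda>h. G z \<bullet> h)) (at z)" if "z \<noteq> 0" for z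
      using G[OF that] by (simp add: gderiv_def inner_commute)
    show "continuous_on (- {0}) (\<lambda>z. blinfun_apply (H z) e)" for e
      by (intro continuous_intros Hc)
    show "0 < (\<Sum>e\<in>Basis. blinfun_apply (H z) e \<bullet> e)" if "z \<noteq> 0" for z
      using lap[OF that] lw[OF that] by simp
  qed (use a b C H bounds in auto)
  then show ?thesis using that by (simp add: w_def[abs_def])
qed

lemma ball_integral_from_average:
  fixes W :: "'a::euclidean_space \<Rightarrow> ereal"
  assumes [measurable]: "W \<in> borel_measurable borel" and c: "0 \<le> c" and lb: "\<And>x. ereal (- c) \<le> W x"
    and r: "0 < r" and avg: "ball_average W v r \<le> ereal K"
  shows "(\<integral>\<^sup>+z. e2ennreal (W z + ereal c) * indicator (ball v r) z \<partial>lborel) \<le> ennreal (K + c) * emeasure lborel (ball v r)"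
proof -
  let ?B = "ball v r" and ?R = "restrict_space lborel (ball v r)"
  define X where "X = (\<integral>\<^sup>+z. e2ennreal (W z + ereal c) * indicator ?B z \<partial>lborel)"
  define m where "m = measure lborel ?B"
  have m: "0 < m" "emeasure lborel ?B = ennreal m"
    using r content_ball_gt_0_iff[of v r] emeasure_lborel_ball_finite[of v r]
    by (simp_all add: m_def emeasure_eq_ennreal_measure less_top)
  have fin: "finite_measure ?R"
    by (rule finite_measureI) (simp add: emeasure_restrict_space space_restrict_space m)
  have "ereal_integral ?R W = enn2ereal X - ereal (c * m)"
  proof -
    have "ereal_integral ?R W = enn2ereal (\<integral>\<^sup>+z. e2ennreal (W z + ereal c) \<partial>?R) - ereal (c * measure ?R (space ?R))"
      by (rule ereal_integral_bounded_below[OF fin _ c lb]) (intro measurable_restrict_space1, measurable)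
    moreover have "(\<integral>\<^sup>+z. e2ennreal (W z + ereal c) \<partial>?R) = X"
      unfolding X_def by (rule nn_integral_restrict_space) simp
    moreover have "measure ?R (space ?R) = m"
      by (simp add: measure_restrict_space space_restrict_space m_def)
    ultimately show ?thesis by simp
  qed
  then have "ereal (1 / m) * (enn2ereal X - ereal (c * m)) \<le> ereal K"
    using avg by (simp add: ball_average_def m_def)
  then have "enn2ereal X \<le> ereal ((K + c) * m)"
    using m(1) enn2ereal_nonneg[of X] by (cases "enn2ereal X") (auto simp: field_simps)
  then have "X \<le> ennreal ((K + c) * m)"
    by (metis e2ennreal_enn2ereal e2ennreal_ereal e2ennreal_mono)
  then show ?thesis using m by (simp add: X_def ennreal_mult'')
qed

text \<open>
  Ball averages of \<open>W + c\<close> are compared with \<open>1 + W v + c\<close> in three cases. For radius at least 1 the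
  integral of the majorant is absorbed by the volume of the ball; for radius below 1 and \<open>norm v < 2\<close>
  condition (W1) applies; in the remaining case the ball stays away from the unit ball, where \<open>W\<close> is bounded.
\<close>

lemma regular_points:
  fixes W :: "'a::euclidean_space \<Rightarrow> ereal"
  assumes W: "essentially_convex W" and pot: "punctured_potential (\<lambda>x. real_of_ereal (W x)) G H b s C"
  obtains c A where "0 \<le> c" "0 \<le> A" "\<And>x. ereal (- c) \<le> W x"
    "\<And>v. W v \<noteq> \<infinity> \<Longrightarrow> punctured_potential.regular_point (\<lambda>x. real_of_ereal (W x)) c A v"
proof -
  define w where "w x = real_of_ereal (W x)" for x
  interpret punctured_potential w G H b s C using pot by (simp add: w_def[abs_def])
  obtain c0 where c0: "\<And>x. ereal c0 \<le> W x" using W unfolding essentially_convex_def W0_def by blast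
  define c where "c = \<bar>c0\<bar>"
  have c: "0 \<le> c" and lb: "ereal (- c) \<le> W x" for x
    using c0[of x] by (auto simp: c_def intro: order_trans[rotated])
  have Wm [measurable]: "W \<in> borel_measurable borel"
    using W unfolding essentially_convex_def W0_def locally_integrable_def by blast
  have Wfin: "W x = ereal (w x)" if "W x \<noteq> \<infinity>" for x
    using that lb[of x] by (cases "W x") (auto simp: w_def)
  have Wz: "W x \<noteq> \<infinity>" if "x \<noteq> 0" for x
    using W that unfolding essentially_convex_def by auto
  have wlb: "- c \<le> w x" if "W x \<noteq> \<infinity>" for x
    using lb[of x] Wfin[OF that] by simp
  have cont: "isCont w v" if "W v \<noteq> \<infinity>" for v
  proof (cases "v = 0")
    case True
    have "(W \<longlongrightarrow> ereal (w 0)) (at 0)" using W Wfin that True unfolding essentially_convex_def W1_def by metis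
    then have "(w \<longlongrightarrow> w 0) (at 0)" unfolding w_def[abs_def] by (simp add: lim_real_of_ereal w_def)
    then show ?thesis using True by (simp add: isCont_def)
  next
    case False
    then show ?thesis using gradient[OF False] has_derivative_continuous by blast
  qed
  obtain C1 C2 where avg: "\<And>x \<epsilon>. norm x < 2 \<Longrightarrow> 0 < \<epsilon> \<Longrightarrow> \<epsilon> < 1 \<Longrightarrow> ball_average W x \<epsilon> \<le> ereal C1 + ereal C2 * W x"
  proof -
    have "(2::real) > 0" by simp
    then show ?thesis using W that unfolding essentially_convex_def W1_def by meson
  qed
  define u where "u z = e2ennreal (W z + ereal c)" for z
  have um [measurable]: "u \<in> borel_measurable borel" unfolding u_def[abs_def] by measurable
  have u: "u z = ennreal (w z + c)" if "z \<noteq> 0" for z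
    using Wfin[OF Wz[OF that]] by (simp add: u_def)
  define Im where "Im = (\<integral>z. majorant b s (z::'a) \<partial>lborel)"
  have Im: "0 \<le> Im" "(\<integral>\<^sup>+z. ennreal (majorant b s (z::'a)) \<partial>lborel) = ennreal Im"
    unfolding Im_def using majorant_integrable by (auto simp: nn_integral_eq_integral)
  define v1 where "v1 = unit_ball_vol (real DIM('a))"
  have v1: "0 < v1" by (simp add: v1_def)
  define A where "A = C * Im / v1 + C + \<bar>C1\<bar> + \<bar>C2\<bar> + c + \<bar>C2\<bar> * c"
  have A0: "0 \<le> A" unfolding A_def using C Im v1 c by simp
  have parts: "C * Im / v1 + C + c \<le> A" "C + c \<le> A" "\<bar>C1\<bar> + c + \<bar>C2\<bar> * c \<le> A" "\<bar>C2\<bar> \<le> A"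
    unfolding A_def using C Im v1 c by simp_all
  have ball: "(\<integral>\<^sup>+z. u z * indicator (ball v r) z \<partial>lborel) \<le> ennreal (A * (1 + (w v + c))) * emeasure lborel (ball v r)"
    if v: "W v \<noteq> \<infinity>" and r: "0 < r" for v r
  proof -
    have wv: "0 \<le> w v + c" using wlb[OF v] by simp
    have A1: "A \<le> A * (1 + (w v + c))" using A0 wv by (simp add: mult_le_cancel_left1)
    consider "1 \<le> r" | "r < 1" "norm v < 2" | "r < 1" "2 \<le> norm v" by linarith
    then show ?thesis
    proof cases
      case 1
      have "(\<integral>\<^sup>+z. u z * indicator (ball v r) z \<partial>lborel)
          \<le> (\<integral>\<^sup>+z. ennreal (C * majorant b s z) + ennreal (C + c) * indicator (ball v r) z \<partial>lborel)"
      proof (rule nn_integral_mono_AE)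
        show "AE z in lborel. u z * indicator (ball v r) z \<le> ennreal (C * majorant b s z) + ennreal (C + c) * indicator (ball v r) z"
          using AE_nonzero
        proof eventually_elim
          case (elim z)
          have "u z \<le> ennreal (C * majorant b s z) + ennreal (C + c)"
            unfolding u[OF elim] using w_le[OF elim] C c
            by (subst ennreal_plus[symmetric]) (auto intro!: ennreal_leI simp del: ennreal_plus)
          then show ?case by (auto simp: indicator_def)
        qed
      qed
      also have "\<dots> = ennreal (C * Im) + ennreal (C + c) * emeasure lborel (ball v r)"
      proof (subst nn_integral_add)
        show "(\<lambda>z. ennreal (C + c) * indicator (ball v r) z) \<in> borel_measurable lborel"
          by (intro borel_measurable_times_ennreal borel_measurable_const borel_measurable_indicator) auto
        show "(\<integral>\<^sup>+z. ennreal (C * majorant b s (z::'a)) \<partial>lborel) + (\<integral>\<^sup>+z. ennreal (C + c) * indicator (ball v r) z \<partial>lborel)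
            = ennreal (C * Im) + ennreal (C + c) * emeasure lborel (ball v r)"
          using C Im by (simp add: ennreal_mult nn_integral_cmult nn_integral_cmult_indicator)
      qed simp
      also have "\<dots> \<le> ennreal (C * Im / v1 + C + c) * emeasure lborel (ball v r)"
      proof -
        have e: "emeasure lborel (ball v r) = ennreal (v1 * r ^ DIM('a))"
          using r by (simp add: emeasure_ball v1_def)
        have "C * Im * 1 \<le> C * Im * r ^ DIM('a)" using C Im 1 by (intro mult_left_mono) auto
        moreover have "(C * Im / v1 + C + c) * (v1 * r ^ DIM('a)) = C * Im * r ^ DIM('a) + (C + c) * (v1 * r ^ DIM('a))"
          using v1 by (simp add: field_simps)
        ultimately have "C * Im + (C + c) * (v1 * r ^ DIM('a)) \<le> (C * Im / v1 + C + c) * (v1 * r ^ DIM('a))"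
          by linarith
        then show ?thesis unfolding e using C c Im v1 r
          by (simp add: ennreal_mult[symmetric] ennreal_plus[symmetric] ennreal_leI del: ennreal_plus)
      qed
      also have "\<dots> \<le> ennreal (A * (1 + (w v + c))) * emeasure lborel (ball v r)"
        using parts(1) A1 by (intro mult_right_mono ennreal_leI) auto
      finally show ?thesis .
    next
      case 2
      have "ball_average W v r \<le> ereal (C1 + C2 * w v)"
        using avg[OF 2(2) r 2(1)] Wfin[OF v] by simp
      from ball_integral_from_average[OF Wm c lb r this]
      have "(\<integral>\<^sup>+z. u z * indicator (ball v r) z \<partial>lborel) \<le> ennreal (C1 + C2 * w v + c) * emeasure lborel (ball v r)"
        by (simp add: u_def)
      also have "\<dots> \<le> ennreal (A * (1 + (w v + c))) * emeasure lborel (ball v r)"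
      proof (intro mult_right_mono ennreal_leI)
        have "C2 * w v \<le> \<bar>C2\<bar> * (w v + c) + \<bar>C2\<bar> * c"
        proof -
          have "C2 * w v \<le> \<bar>C2\<bar> * \<bar>w v\<bar>" by (metis abs_ge_self abs_mult)
          also have "\<dots> \<le> \<bar>C2\<bar> * ((w v + c) + c)" using wv c by (intro mult_left_mono) auto
          finally show ?thesis by (simp only: distrib_left)
        qed
        moreover have "\<bar>C2\<bar> * (w v + c) \<le> A * (w v + c)" using parts(4) wv by (intro mult_right_mono)
        moreover have "A * (1 + (w v + c)) = A + A * (w v + c)" by (simp only: distrib_left mult_1_right)
        ultimately show "C1 + C2 * w v + c \<le> A * (1 + (w v + c))"
          using parts(3) abs_ge_self[of C1] by linarith
      qed simp
      finally show ?thesis .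
    next
      case 3
      have le: "u z \<le> ennreal (C + c)" if "z \<in> ball v r" for z
      proof -
        have "norm v \<le> norm z + dist v z" unfolding dist_norm by (rule norm_triangle_sub)
        moreover have "dist v z < r" using that by simp
        ultimately have z: "1 \<le> norm z" using 3 by linarith
        then have z0: "z \<noteq> 0" by auto
        have "norm z powr (s + 2) \<le> norm z powr 0" using z s by (intro powr_mono) auto
        moreover have "norm z powr 0 = 1" using z0 by simp
        ultimately have "C * norm z powr (s + 2) \<le> C * 1" using C by (intro mult_left_mono) linarith+
        then have "w z \<le> C" using w_far[OF z] by linarith
        then show ?thesis unfolding u[OF z0] by (intro ennreal_leI) simp
      qed
      have "(\<integral>\<^sup>+z. u z * indicator (ball v r) z \<partial>lborel) \<le> (\<integral>\<^sup>+z. ennreal (C + c) * indicator (ball v r) z \<partial>lborel)"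
      proof (intro nn_integral_mono)
        fix z
        show "u z * indicator (ball v r) z \<le> ennreal (C + c) * indicator (ball v r) z"
          using le[of z] by (cases "z \<in> ball v r") (simp_all del: mem_ball)
      qed
      also have "\<dots> = ennreal (C + c) * emeasure lborel (ball v r)" by (rule nn_integral_cmult_indicator) simp
      also have "\<dots> \<le> ennreal (A * (1 + (w v + c))) * emeasure lborel (ball v r)"
        using parts(2) A1 by (intro mult_right_mono ennreal_leI) auto
      finally show ?thesis .
    qed
  qed
  have "regular_point c A v" if v: "W v \<noteq> \<infinity>" for v
    unfolding regular_point_def
  proof (intro conjI allI impI)
    fix t :: real assume t: "0 < t \<and> t \<le> 1"
    then have t0: "0 < t" by simp
    note h = heat_kernel_translate_integral[OF t0, of v]
    note wI = heat_kernel_convolution_bound(1)[OF t0, of v]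
    have eq: "smoothed t v + c = (\<integral>z. (w z + c) * heat_kernel t (v - z) \<partial>lborel)"
      unfolding smoothed_def distrib_right using h wI by simp
    have nn: "AE z in lborel. 0 \<le> (w z + c) * heat_kernel t (v - z)"
      using AE_nonzero
    proof eventually_elim
      case (elim z)
      then show ?case using wlb[OF Wz[OF elim]] by (intro mult_nonneg_nonneg) auto
    qed
    have "0 \<le> (\<integral>z. (w z + c) * heat_kernel t (v - z) \<partial>lborel)" by (rule integral_nonneg_AE[OF nn])
    then show "- c \<le> smoothed t v" using eq by linarith
    have "ennreal (\<integral>z. (w z + c) * heat_kernel t (v - z) \<partial>lborel) = (\<integral>\<^sup>+z. ennreal ((w z + c) * heat_kernel t (v - z)) \<partial>lborel)"
      using h wI nn by (intro nn_integral_eq_integral[symmetric]) (auto simp: distrib_right)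
    also have "\<dots> = (\<integral>\<^sup>+z. u z * ennreal (heat_kernel t (v - z)) \<partial>lborel)"
    proof (rule nn_integral_cong_AE)
      show "AE z in lborel. ennreal ((w z + c) * heat_kernel t (v - z)) = u z * ennreal (heat_kernel t (v - z))"
        using AE_nonzero by eventually_elim (simp add: u ennreal_mult'')
    qed
    also have "\<dots> \<le> ennreal (A * (1 + (w v + c)))"
      by (rule heat_average_le_ball_averages[OF um t0 ball[OF v]])
    finally show "smoothed t v + c \<le> A * (1 + (w v + c))"
      unfolding eq using A0 wlb[OF v] by (subst (asm) ennreal_le_iff) auto
  qed (use cont[OF v] wlb[OF v] in auto)
  then show ?thesis using that[OF c A0 lb] by (simp add: w_def[abs_def])
qed

section \<open>Strict positive definiteness\<close>

context signed_density
begin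

lemma nn_integral_density_pair:
  assumes [measurable]: "f \<in> borel_measurable (borel \<Otimes>\<^sub>M borel)" and [measurable]: "A \<in> sets borel" "B \<in> sets borel"
  shows "(\<integral>\<^sup>+y. \<integral>\<^sup>+x. f (x, y) \<partial>density M (indicator A) \<partial>density M (indicator B))
    = (\<integral>\<^sup>+p. indicator A (fst p) * indicator B (snd p) * f p \<partial>MM)"
proof -
  have inner: "(\<integral>\<^sup>+x. f (x, y) \<partial>density M (indicator A)) = (\<integral>\<^sup>+x. indicator A x * f (x, y) \<partial>M)" for y
    by (rule nn_integral_density) measurable
  have "(\<lambda>(y, x). indicator A x * f (x, y)) \<in> borel_measurable (M \<Otimes>\<^sub>M M)" by measurable
  then have "(\<lambda>y. \<integral>\<^sup>+x. indicator A x * f (x, y) \<partial>M) \<in> borel_measurable M"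
    by (rule borel_measurable_nn_integral)
  then have "(\<integral>\<^sup>+y. \<integral>\<^sup>+x. f (x, y) \<partial>density M (indicator A) \<partial>density M (indicator B))
      = (\<integral>\<^sup>+y. indicator B y * (\<integral>\<^sup>+x. indicator A x * f (x, y) \<partial>M) \<partial>M)"
    unfolding inner by (intro nn_integral_density) measurable
  also have "\<dots> = (\<integral>\<^sup>+y. \<integral>\<^sup>+x. (\<lambda>p. indicator A (fst p) * indicator B (snd p) * f p) (x, y) \<partial>M \<partial>M)"
    by (intro nn_integral_cong, subst nn_integral_cmult[symmetric]) (measurable, auto intro!: nn_integral_cong simp: mult_ac)
  also have "\<dots> = (\<integral>\<^sup>+p. indicator A (fst p) * indicator B (snd p) * f p \<partial>MM)"
    by (rule pair.nn_integral_snd) measurable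
  finally show ?thesis .
qed

lemma measure_density_indicator:
  assumes "A \<in> sets borel" shows "measure (density M (indicator A)) (space M) = measure M A"
proof -
  have "emeasure (density M (indicator A)) (space M) = emeasure M A"
  proof -
    have A: "A \<in> sets M" using assms sets_M by simp
    then have "emeasure (density M (indicator A)) (space M) = (\<integral>\<^sup>+x. indicator A x * indicator (space M) x \<partial>M)"
      by (intro emeasure_density) auto
    also have "\<dots> = (\<integral>\<^sup>+x. indicator A x \<partial>M)" by (intro nn_integral_cong) simp
    also have "\<dots> = emeasure M A" using A by simp
    finally show ?thesis .
  qed
  then show ?thesis by (simp add: measure_def)
qed

lemma integral_indicator_pair:
  assumes "A \<in> sets borel" "B \<in> sets borel"
  shows "(\<integral>p. indicator A (fst p) * indicator B (snd p) \<partial>MM) = measure M A * measure M B"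
proof -
  have "(\<integral>p. indicator A (fst p) * indicator B (snd p) \<partial>MM) = (\<integral>p. indicator (A \<times> B) p \<partial>MM :: real)"
    by (intro Bochner_Integration.integral_cong) (auto simp: indicator_def split: prod.splits)
  also have "\<dots> = measure MM (A \<times> B)" using assms sets_M by simp
  also have "emeasure MM (A \<times> B) = emeasure M A * emeasure M B"
    using assms sets_M by (intro emeasure_pair_measure_Times) auto
  then have "measure MM (A \<times> B) = measure M A * measure M B"
    by (simp add: measure_def enn2real_mult)
  finally show ?thesis .
qed

end

text \<open>
  All interactions are integrals over \<open>M \<Otimes>\<^sub>M M\<close> with \<open>M = \<bar>\<mu>\<bar>\<close>. When both self-energies are finite, \<open>W\<close> is
  finite almost everywhere there: on pairs with equal signs because the self-energies are finite, on
  pairs with opposite signs because the two points differ. So almost every difference \<open>x - y\<close> is a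
  regular point, also when \<open>W 0 = \<infinity>\<close>.
\<close>

lemma essentially_convex_strictly_positive_definite:
  fixes W :: "'a::euclidean_space \<Rightarrow> ereal"
  assumes W: "essentially_convex W"
  shows "strictly_positive_definite W"
  unfolding strictly_positive_definite_def
proof (intro allI impI, elim conjE)
  fix \<mu> :: "'a set \<Rightarrow> real"
  assume \<mu>: "signed_borel_measure \<mu>" and nontriv: "nontrivial_measure \<mu>" and wd: "energy_well_defined W \<mu>"
  define P where "P = pos_part \<mu>"
  define N where "N = neg_part \<mu>"
  have J: "jordan_decomposition \<mu> P N" unfolding P_def N_def by (rule jordan_decomposition_parts[OF \<mu>])
  then obtain S where S: "S \<in> sets borel" "emeasure P (- S) = 0" "emeasure N S = 0"
    and P: "finite_measure P" "sets P = sets borel" and N: "finite_measure N" "sets N = sets borel"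
    and \<mu>PN: "\<And>A. A \<in> sets borel \<Longrightarrow> \<mu> A = measure P A - measure N A"
    unfolding jordan_decomposition_def by blast
  have [measurable]: "S \<in> sets borel" and Sc [measurable]: "- S \<in> sets borel" using S(1) by auto
  obtain M where M: "finite_measure M" "sets M = sets borel"
    and PM: "P = density M (indicator S)" and NM: "N = density M (indicator (- S))"
    using sum_of_singular_measures[OF P S(2) N S(3) S(1)] by blast
  obtain G H b s C where pot: "punctured_potential (\<lambda>x. real_of_ereal (W x)) G H b s C"
    using essentially_convex_potential[OF W] by blast
  obtain c A where c: "0 \<le> c" and A: "0 \<le> A" and lb: "\<And>x. ereal (- c) \<le> W x"
    and reg0: "\<And>v. W v \<noteq> \<infinity> \<Longrightarrow> punctured_potential.regular_point (\<lambda>x. real_of_ereal (W x)) c A v"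
    using regular_points[OF W pot] by blast
  define w where "w x = real_of_ereal (W x)" for x
  have weq: "(\<lambda>x. real_of_ereal (W x)) = w" by (simp add: fun_eq_iff w_def)
  define \<sigma> :: "'a \<Rightarrow> real" where "\<sigma> x = indicator S x - indicator (- S) x" for x
  interpret M: finite_measure M by (rule M(1))
  interpret punctured_potential w G H b s C using pot unfolding weq .
  interpret signed_energy w G H b s C M \<sigma>
  proof
    show "\<sigma> \<in> borel_measurable borel" unfolding \<sigma>_def[abs_def] by measurable
    show "\<bar>\<sigma> x\<bar> \<le> 1" for x by (auto simp: \<sigma>_def indicator_def)
  qed (rule M(2))
  have reg: "regular_point c A v" if "W v \<noteq> \<infinity>" for v
    using reg0[OF that] unfolding weq .
  have [measurable]: "W \<in> borel_measurable borel"
    using W unfolding essentially_convex_def W0_def locally_integrable_def by blast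
  have Wz: "W x \<noteq> \<infinity>" if "x \<noteq> 0" for x
    using W that unfolding essentially_convex_def by auto
  define u where "u p = e2ennreal (W (fst p - snd p) + ereal c)" for p :: "'a \<times> 'a"
  have um [measurable]: "u \<in> borel_measurable (borel \<Otimes>\<^sub>M borel)" unfolding u_def[abs_def] by measurable
  have uw: "u p = ennreal (w (fst p - snd p) + c)" "0 \<le> w (fst p - snd p) + c" if "W (fst p - snd p) \<noteq> \<infinity>" for p
    using that lb[of "fst p - snd p"] by (cases "W (fst p - snd p)"; simp add: u_def w_def)+
  define I :: "'a set \<Rightarrow> 'a set \<Rightarrow> 'a \<times> 'a \<Rightarrow> real" where "I A B p = indicator A (fst p) * indicator B (snd p)" for A B p
  have I01: "0 \<le> I A B p" "I A B p \<le> 1" for A B p by (auto simp: I_def indicator_def)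
  have Im [measurable]: "I A B \<in> borel_measurable MM" if [measurable]: "A \<in> sets borel" "B \<in> sets borel" for A B
    unfolding I_def[abs_def] by measurable
  define K where "K A B = (\<integral>\<^sup>+p. ennreal (I A B p) * u p \<partial>MM)" for A B
  have inter: "interaction W (density M (indicator A)) (density M (indicator B)) = enn2ereal (K A B) - ereal (c * measure M A * measure M B)"
    if "finite_measure (density M (indicator A))" "finite_measure (density M (indicator B))"
      and AB [measurable]: "A \<in> sets borel" "B \<in> sets borel" for A B
  proof -
    have "(\<integral>\<^sup>+y. \<integral>\<^sup>+x. u (x, y) \<partial>density M (indicator A) \<partial>density M (indicator B)) = K A B"
      unfolding nn_integral_density_pair[OF um AB] K_def
      by (intro nn_integral_cong) (auto simp: I_def indicator_def)
    then show ?thesis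
      using interaction_bounded_below[OF that(1) _ that(2) _ \<open>W \<in> borel_measurable borel\<close> c lb] M(2)
      by (simp add: u_def measure_density_indicator[OF AB(1)] measure_density_indicator[OF AB(2)])
  qed
  let ?p = "measure M S" and ?n = "measure M (- S)"
  have iPP: "interaction W P P = enn2ereal (K S S) - ereal (c * ?p * ?p)"
    and iNN: "interaction W N N = enn2ereal (K (- S) (- S)) - ereal (c * ?n * ?n)"
    and iPN: "interaction W P N = enn2ereal (K S (- S)) - ereal (c * ?p * ?n)"
    using P(1) N(1) by (simp_all add: PM NM inter)
  have en: "energy W \<mu> = ereal (1/2) * interaction W P P + ereal (1/2) * interaction W N N - interaction W P N"
    by (simp add: energy_def self_energy_def P_def N_def)
  have fromI: "interaction W Q Q' \<noteq> -\<infinity>" if "interaction W Q Q' = enn2ereal x - ereal y" for Q Q' x y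
    using that enn2ereal_nonneg[of x] by (cases "enn2ereal x") auto
  show "0 < energy W \<mu>"
  proof (cases "K S S = \<infinity> \<or> K (- S) (- S) = \<infinity>")
    case True
    \<comment> \<open>An infinite self-energy makes the energy infinite, since \<open>\<infinity> - \<infinity>\<close> is excluded.\<close>
    then have "interaction W P P = \<infinity> \<or> interaction W N N = \<infinity>" by (auto simp: iPP iNN)
    then have self: "ereal (1/2) * interaction W P P + ereal (1/2) * interaction W N N = \<infinity>"
      using fromI[OF iPP] fromI[OF iNN] by (cases "interaction W P P"; cases "interaction W N N") auto
    then have "interaction W P N \<noteq> \<infinity>"
      using wd by (simp add: energy_well_defined_def self_energy_def P_def N_def)
    then show ?thesis unfolding en self by (cases "interaction W P N") auto
  next
    case False
    have finAE: "AE p in MM. ennreal (I A B p) * u p \<noteq> \<infinity>" if "K A B \<noteq> \<infinity>" "A \<in> sets borel" "B \<in> sets borel" for A B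
      using that unfolding K_def by (intro nn_integral_PInf_AE) auto
    have AEfin: "AE p in MM. W (fst p - snd p) \<noteq> \<infinity>"
    proof -
      have a: "AE p in MM. ennreal (I S S p) * u p \<noteq> \<infinity>" and b: "AE p in MM. ennreal (I (- S) (- S) p) * u p \<noteq> \<infinity>"
        using False S(1) Sc finAE[of S S] finAE[of "- S" "- S"] by blast+
      from a b show ?thesis
      proof eventually_elim
        case (elim p)
        show ?case
        proof (cases "fst p \<in> S \<longleftrightarrow> snd p \<in> S")
          case True
          with elim have "u p \<noteq> \<infinity>" by (cases "fst p \<in> S") (auto simp: I_def)
          then show ?thesis by (auto simp: u_def)
        next
          case False
          then show ?thesis by (intro Wz) auto
        qed
      qed
    qed
    let ?f = "\<lambda>p. w (fst p - snd p)"
    have [measurable]: "?f \<in> borel_measurable MM" by measurable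
    have Kn: "K A B = (\<integral>\<^sup>+p. ennreal (I A B p * (?f p + c)) \<partial>MM)" for A B
      unfolding K_def
    proof (rule nn_integral_cong_AE)
      show "AE p in MM. ennreal (I A B p) * u p = ennreal (I A B p * (?f p + c))"
        using AEfin by eventually_elim (use I01 in \<open>simp add: uw ennreal_mult\<close>)
    qed
    have nn: "AE p in MM. 0 \<le> I A B p * (?f p + c)" for A B
      using AEfin by eventually_elim (use I01 in \<open>simp add: uw\<close>)
    have II: "integrable MM (I A B)" if "A \<in> sets borel" "B \<in> sets borel" for A B
      using that I01 by (intro bounded_integrable_MM[where B = 1]) auto
    have KI: "integrable MM (\<lambda>p. I A B p * (?f p + c))" if "K A B \<noteq> \<infinity>" "A \<in> sets borel" "B \<in> sets borel" for A B
    proof (rule integrableI_nonneg)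
      show "(\<lambda>p. I A B p * (?f p + c)) \<in> borel_measurable MM" using Im[OF that(2,3)] by measurable
      show "(\<integral>\<^sup>+p. ennreal (I A B p * (?f p + c)) \<partial>MM) < \<infinity>" using that(1) unfolding Kn by (simp add: less_top)
    qed (rule nn)
    have fI: "integrable MM (\<lambda>p. I A B p * ?f p)" if "K A B \<noteq> \<infinity>" "A \<in> sets borel" "B \<in> sets borel" for A B
    proof -
      have "integrable MM (\<lambda>p. I A B p * (?f p + c) - I A B p * c)"
        using KI[OF that] II[OF that(2,3)] by simp
      then show ?thesis by (simp add: distrib_left)
    qed
    have weight: "weight p = I S S p + I (- S) (- S) p - I S (- S) p - I (- S) S p"
      and half: "(1 + weight p) / 2 = I S S p + I (- S) (- S) p" for p
      by (auto simp: weight_def \<sigma>_def I_def indicator_def)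
    define X where "X n = 1 / real (Suc n)" for n
    have X: "0 < X n" "X n \<le> 1" for n by (auto simp: X_def)
    have X0: "X \<longlonglongrightarrow> 0" unfolding X_def[abs_def] by (rule LIMSEQ_Suc[OF lim_const_over_n])
    have regAE: "AE p in MM. regular_point c A (fst p - snd p)"
      using AEfin by eventually_elim (rule reg)
    have fin: "integrable MM (\<lambda>p. (1 + weight p) / 2 * ?f p)"
      unfolding half distrib_right using False fI by (intro Bochner_Integration.integrable_add) auto
    note conv = smoothed_energy_tendsto[OF A c regAE fin X X0]
    define E where "E = (\<integral>p. weight p * ?f p \<partial>MM)"
    have "0 < E"
    proof -
      have "\<exists>h B. continuous_on UNIV h \<and> (\<forall>x. \<bar>h x\<bar> \<le> B) \<and> (\<integral>x. \<sigma> x * h x \<partial>M) \<noteq> 0"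
      proof (rule ccontr)
        assume "\<not> ?thesis"
        then have zero: "(\<integral>x. \<sigma> x * h x \<partial>M) = 0" if "continuous_on UNIV h" "\<And>x. \<bar>h x\<bar> \<le> 1" for h
          using that by blast
        \<comment> \<open>Indicators of open sets are limits of continuous functions, so \<open>\<sigma>\<close> integrates every open set to 0.\<close>
        have "P = N"
        proof (rule finite_measures_eq_if_open_eq[OF P(1,2) N(2)])
          fix U :: "'a set" assume U: "open U"
          then have [measurable]: "U \<in> sets borel" by simp
          obtain h :: "nat \<Rightarrow> 'a \<Rightarrow> real" where h: "\<And>n. continuous_on UNIV (h n)" "\<And>n x. \<bar>h n x\<bar> \<le> 1"
            "\<And>x. (\<lambda>n. h n x) \<longlonglongrightarrow> indicator U x" using open_indicator_limit[OF U] by blast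
          have [measurable]: "h n \<in> borel_measurable borel" for n using h(1) by (rule borel_measurable_continuous_onI)
          have "(\<lambda>n. \<integral>x. \<sigma> x * h n x \<partial>M) \<longlonglongrightarrow> (\<integral>x. \<sigma> x * indicator U x \<partial>M)"
          proof (rule integral_dominated_convergence)
            show "integrable M (\<lambda>x. 1 :: real)" by simp
            show "AE x in M. (\<lambda>n. \<sigma> x * h n x) \<longlonglongrightarrow> \<sigma> x * indicator U x"
              by (intro AE_I2 tendsto_intros h)
            show "AE x in M. norm (\<sigma> x * h n x) \<le> 1" for n
              using \<sigma>_bound h(2) by (auto simp: abs_mult intro!: AE_I2 mult_le_one)
          qed measurable
          then have "0 = (\<integral>x. \<sigma> x * indicator U x \<partial>M)"
            using zero[OF h(1,2)] by (simp add: LIMSEQ_const_iff)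
          also have "(\<integral>x. \<sigma> x * indicator U x \<partial>M) = (\<integral>x. indicator (U \<inter> S) x - indicator (U \<inter> - S) x \<partial>M)"
            by (intro Bochner_Integration.integral_cong) (auto simp: \<sigma>_def indicator_def)
          also have "\<dots> = measure M (U \<inter> S) - measure M (U \<inter> - S)"
            using M(2) by (subst Bochner_Integration.integral_diff) (auto simp: less_top[symmetric])
          finally have "measure M (U \<inter> S) = measure M (U \<inter> - S)" by simp
          moreover have "emeasure (density M (indicator Q)) U = emeasure M (U \<inter> Q)" if "Q \<in> sets borel" for Q
            using that M(2) by (subst emeasure_density) (auto simp: indicator_inter_arith[symmetric] Int_commute)
          ultimately show "emeasure P U = emeasure N U"
            by (simp add: PM NM M.emeasure_eq_measure)
        qed
        then have "\<mu> B = 0" if "B \<in> sets borel" for B using \<mu>PN[OF that] by simp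
        then show False using nontriv by (auto simp: nontrivial_measure_def)
      qed
      then obtain h B where h: "continuous_on UNIV h" "\<And>x. \<bar>h x\<bar> \<le> B" "(\<integral>x. \<sigma> x * h x \<partial>M) \<noteq> 0" by blast
      have "filterlim X (at_right 0) sequentially"
        using X X0 by (intro tendsto_imp_filterlim_at_right) auto
      from smoothed_energy_limit_pos[OF this conv(2) h] show ?thesis by (simp add: E_def)
    qed
    moreover have "energy W \<mu> = ereal (E / 2)"
    proof -
      define k where "k A B = (\<integral>p. I A B p * ?f p \<partial>MM)" for A B
      have kI: "integrable MM (\<lambda>p. I A B p * ?f p)" if "A \<in> sets borel" "B \<in> sets borel" for A B
        by (rule Bochner_Integration.integrable_bound[OF conv(1)])
          (use Im[OF that] I01 in \<open>auto simp: abs_mult intro!: AE_I2 mult_left_le_one_le\<close>)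
      have Kk: "enn2ereal (K A B) = ereal (k A B + c * measure M A * measure M B)" if AB: "A \<in> sets borel" "B \<in> sets borel" for A B
      proof -
        have int: "integrable MM (\<lambda>p. I A B p * (?f p + c))"
          unfolding distrib_left using kI[OF AB] II[OF AB] by simp
        have "(\<integral>p. I A B p * (?f p + c) \<partial>MM) = k A B + c * (\<integral>p. I A B p \<partial>MM)"
          unfolding distrib_left k_def using kI[OF AB] II[OF AB] by simp
        also have "(\<integral>p. I A B p \<partial>MM) = measure M A * measure M B"
          unfolding I_def by (rule integral_indicator_pair[OF AB])
        finally have eq: "(\<integral>p. I A B p * (?f p + c) \<partial>MM) = k A B + c * measure M A * measure M B" by simp
        have "K A B = ennreal (k A B + c * measure M A * measure M B)"
          unfolding Kn eq[symmetric] by (rule nn_integral_eq_integral[OF int nn])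
        moreover have "0 \<le> k A B + c * measure M A * measure M B"
          unfolding eq[symmetric] by (rule integral_nonneg_AE[OF nn])
        ultimately show ?thesis by (simp add: enn2ereal_ennreal)
      qed
      have sym: "k (- S) S = k S (- S)"
      proof -
        have "(\<integral>(x, y). (\<lambda>p. I S (- S) p * ?f p) (y, x) \<partial>MM) = k S (- S)"
          unfolding k_def by (rule pair.integral_product_swap) measurable
        moreover have "(\<integral>(x, y). (\<lambda>p. I S (- S) p * ?f p) (y, x) \<partial>MM) = k (- S) S"
          unfolding k_def
        proof (intro Bochner_Integration.integral_cong refl)
          fix p :: "'a \<times> 'a"
          have "w (snd p - fst p) = w (fst p - snd p)" using even[of "fst p - snd p"] by simp
          then show "(case p of (x, y) \<Rightarrow> (\<lambda>p. I S (- S) p * ?f p) (y, x)) = I (- S) S p * ?f p"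
            by (simp add: case_prod_beta' I_def)
        qed
        ultimately show ?thesis by simp
      qed
      have "E = k S S + k (- S) (- S) - k S (- S) - k (- S) S"
        unfolding E_def k_def weight left_diff_distrib distrib_right using kI by simp
      then show ?thesis
        unfolding en iPP iNN iPN using S(1) by (simp add: Kk sym field_simps)
    qed
    ultimately show ?thesis by simp
  qed
qed

theorem lemma1p14:
  fixes W :: "real ^ 'd \<Rightarrow> ereal"
  assumes "essentially_convex W"
  shows "strictly_positive_definite W"
  using assms by (rule essentially_convex_strictly_positive_definite)

end
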